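(* Let $\Gamma$ be a countable discrete sofic group with sofic approximation $\Sigma$. Let $\rho\colon\Gamma\to\mathcal{O}(\mathcal{H})$ be an orthogonal representation on a nonzero real separable Hilbert space $\mathcal{H}$ with $\rho\ll\lambda_{\Gamma,\mathbb{R}}$, and let $\Gamma\curvearrowright(X_\rho,\mu_\rho)$ be the associated Gaussian action. Let $\Gamma\curvearrowright(Y,\nu)$ be a probability measure-preserving action on a standard probability space with $h_{\Sigma,\nu}(Y,\Gamma)\ge0$. Then $h_{\Sigma,\mu_\rho\otimes\nu}(X_\rho\times Y,\Gamma)=\infty$ for the diagonal action.
   Context: $h_{\Sigma,\mu}(X,\Gamma)\in\{-\infty\}\cup[0,\infty]$ denotes the sofic entropy (Bowen, Kerr–Li) of a probability measure-preserving action on a standard probability space with respect to the sofic approximation $\Sigma=(\sigma_i\colon\Gamma\to S_{d_i})$. Gaussian action: the (unique up to isomorphism) probability measure-preserving action $\Gamma\curvearrowright(X_\rho,\mu_\rho)$ on a standard probability space with measurable maps $u(\xi)\colon X_\rho\to\{|z|=1\}$, $\xi\in\mathcal{H}$, such that $u(\xi_1+\xi_2)=u(\xi_1)u(\xi_2)$, $\int u(\xi)\,d\mu_\rho=\exp(-\pi\|\xi\|^2)$, the $u(\xi)$ generate $L^\infty(X_\rho,\mu_\rho)$ as a von Neumann algebra, and $u(\xi)\circ g^{-1}=u(\rho(g)\xi)$. $\lambda_{\Gamma,\mathbb{R}}$ is the left regular orthogonal representation on $\ell^2(\Gamma,\mathbb{R})$; $\rho\ll\lambda_{\Gamma,\mathbb{R}}$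 means $\rho$ is isomorphic to a subrepresentation of the countable direct sum $\lambda_{\Gamma,\mathbb{R}}^{\oplus\infty}$. *)

theory Defs
  imports "HOL-Probability.Probability" "HOL-Algebra.Group" "HOL-Combinatorics.Permutations"
begin

definition sofic_approx :: "'g monoid \<Rightarrow> (nat \<Rightarrow> nat) \<Rightarrow> (nat \<Rightarrow> 'g \<Rightarrow> nat \<Rightarrow> nat) \<Rightarrow> bool" where
  "sofic_approx G d \<sigma> \<longleftrightarrow>
     (\<forall>i. \<forall>s\<in>carrier G. \<sigma> i s permutes {..<d i}) \<and>
     filterlim d at_top sequentially \<and>
     (\<forall>s\<in>carrier G. \<forall>t\<in>carrier G.
        (\<lambda>i. real (card {v. v < d i \<and> \<sigma> i (s \<otimes>\<^bsub>G\<^esub> t) v = \<sigma> i s (\<sigma> i t v)}) / real (d i))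
          \<longlonglongrightarrow> 1) \<and>
     (\<forall>s\<in>carrier G. \<forall>t\<in>carrier G. s \<noteq> t \<longrightarrow>
        (\<lambda>i. real (card {v. v < d i \<and> \<sigma> i s v \<noteq> \<sigma> i t v}) / real (d i)) \<longlonglongrightarrow> 1)"

definition pmp_action :: "'g monoid \<Rightarrow> 'x measure \<Rightarrow> ('g \<Rightarrow> 'x \<Rightarrow> 'x) \<Rightarrow> bool" where
  "pmp_action G M T \<longleftrightarrow> prob_space M \<and>
     (\<forall>g\<in>carrier G. T g \<in> M \<rightarrow>\<^sub>M M \<and> bij_betw (T g) (space M) (space M) \<and> distr M M (T g) = M) \<and>
     (\<forall>x\<in>space M. T \<one>\<^bsub>G\<^esub> x = x) \<and>
     (\<forall>g\<in>carrier G. \<forall>h\<in>carrier G. \<forall>x\<in>space M. T (g \<otimes>\<^bsub>G\<^esub> h) x = T g (T h x))"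

text \<open>Standard Borel space: measurably isomorphic to a Borel subset of the reals
  (Kuratowski's theorem: equivalently, to the Borel space of a Polish space).\<close>
definition standard_borel :: "'x measure \<Rightarrow> bool" where
  "standard_borel M \<longleftrightarrow> (\<exists>B \<in> sets (borel :: real measure). \<exists>f.
     bij_betw f (space M) B \<and> f \<in> M \<rightarrow>\<^sub>M restrict_space borel B \<and>
     the_inv_into (space M) f \<in> restrict_space borel B \<rightarrow>\<^sub>M M)"

definition standard_prob_space :: "'x measure \<Rightarrow> bool" where
  "standard_prob_space M \<longleftrightarrow> prob_space M \<and> standard_borel M"

section \<open>Sofic measure entropy (Kerr's finite partition formulation, equal to Kerr--Li's)\<close>

definition fin_meas_partition :: "'x measure \<Rightarrow> 'x set set \<Rightarrow> bool" where
  "fin_meas_partition M P \<longleftrightarrow> finite P \<and> P \<subseteq> sets M \<and> {} \<notin> P \<and> \<Union>P = space M \<and> disjoint P"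

definition refines :: "'x set set \<Rightarrow> 'x set set \<Rightarrow> bool" where
  "refines Q P \<longleftrightarrow> (\<forall>A\<in>Q. \<exists>B\<in>P. A \<subseteq> B)"

definition part_alg :: "'x set set \<Rightarrow> 'x set set" where
  "part_alg P = {\<Union>Q | Q. Q \<subseteq> P}"

definition part_join :: "'x measure \<Rightarrow> ('g \<Rightarrow> 'x \<Rightarrow> 'x) \<Rightarrow> 'x set set \<Rightarrow> 'g set \<Rightarrow> 'x set set" where
  "part_join M T P F = {space M \<inter> (\<Inter>s\<in>F. T s ` c s) | c. \<forall>s\<in>F. c s \<in> P} - {{}}"

definition bool_hom :: "'x measure \<Rightarrow> 'x set set \<Rightarrow> nat \<Rightarrow> ('x set \<Rightarrow> nat set) \<Rightarrow> bool" where
  "bool_hom M P d \<phi> \<longleftrightarrow>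
     (\<forall>A. A \<notin> part_alg P \<longrightarrow> \<phi> A = {}) \<and>
     (\<forall>A\<in>part_alg P. \<phi> A \<subseteq> {..<d}) \<and>
     \<phi> (space M) = {..<d} \<and>
     (\<forall>A\<in>part_alg P. \<forall>B\<in>part_alg P. \<phi> (A \<union> B) = \<phi> A \<union> \<phi> B) \<and>
     (\<forall>A\<in>part_alg P. \<phi> (space M - A) = {..<d} - \<phi> A)"

definition symdiff :: "'a set \<Rightarrow> 'a set \<Rightarrow> 'a set" where
  "symdiff A B = (A - B) \<union> (B - A)"

definition sofic_homs :: "'x measure \<Rightarrow> ('g \<Rightarrow> 'x \<Rightarrow> 'x) \<Rightarrow> nat \<Rightarrow> ('g \<Rightarrow> nat \<Rightarrow> nat)
     \<Rightarrow> 'x set set \<Rightarrow> 'g set \<Rightarrow> real \<Rightarrow> ('x set \<Rightarrow> nat set) set" where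
  "sofic_homs M T d \<tau> P F \<delta> = {\<phi>. bool_hom M (part_join M T P F) d \<phi> \<and>
     (\<forall>s\<in>F. (\<Sum>A\<in>P. real (card (symdiff (\<phi> (T s ` A)) (\<tau> s ` \<phi> A))) / real d) < \<delta>) \<and>
     (\<Sum>A\<in>part_join M T P F. \<bar>real (card (\<phi> A)) / real d - measure M A\<bar>) < \<delta>}"

definition restr_count :: "'x set set \<Rightarrow> ('x set \<Rightarrow> nat set) set \<Rightarrow> nat" where
  "restr_count Q H = card ((\<lambda>\<phi> A. if A \<in> part_alg Q then \<phi> A else {}) ` H)"

definition log_count :: "nat \<Rightarrow> nat \<Rightarrow> ereal" where
  "log_count d N = (if N = 0 then -\<infinity> else ereal (ln (real N) / real d))"

definition sofic_entropy :: "'g monoid \<Rightarrow> (nat \<Rightarrow> nat) \<Rightarrow> (nat \<Rightarrow> 'g \<Rightarrow> nat \<Rightarrow> nat)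
     \<Rightarrow> 'x measure \<Rightarrow> ('g \<Rightarrow> 'x \<Rightarrow> 'x) \<Rightarrow> ereal" where
  "sofic_entropy G d \<sigma> M T =
     (SUP Q\<in>{Q. fin_meas_partition M Q}.
       INF P\<in>{P. fin_meas_partition M P \<and> refines P Q}.
        INF F\<in>{F. finite F \<and> F \<subseteq> carrier G \<and> \<one>\<^bsub>G\<^esub> \<in> F}.
         INF \<delta>\<in>{\<delta>::real. \<delta> > 0}.
          limsup (\<lambda>i. log_count (d i) (restr_count Q (sofic_homs M T (d i) (\<sigma> i) P F \<delta>))))"

definition separable_space :: "'h::real_normed_vector itself \<Rightarrow> bool" where
  "separable_space _ \<longleftrightarrow> (\<exists>D::'h set. countable D \<and> closure D = UNIV)"

definition orth_rep :: "'g monoid \<Rightarrow> ('g \<Rightarrow> 'h::real_inner \<Rightarrow> 'h) \<Rightarrow> bool" where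
  "orth_rep G \<rho> \<longleftrightarrow>
     (\<forall>g\<in>carrier G. linear (\<rho> g) \<and> surj (\<rho> g) \<and> (\<forall>x. norm (\<rho> g x) = norm x)) \<and>
     \<rho> \<one>\<^bsub>G\<^esub> = id \<and>
     (\<forall>g\<in>carrier G. \<forall>h\<in>carrier G. \<rho> (g \<otimes>\<^bsub>G\<^esub> h) = \<rho> g \<circ> \<rho> h)"

text \<open>rho << lambda: rho is isomorphic to a subrepresentation of the countable direct sum of
  copies of the left regular representation on l^2(G,R), i.e. of the representation on
  l^2(N x G, R) given by (g.f)(n,h) = f(n, g^-1 h).  Equivalently there is a linear
  isometric intertwiner V from H into that space.\<close>
definition reg_subrep :: "'g monoid \<Rightarrow> ('g \<Rightarrow> 'h::real_inner \<Rightarrow> 'h) \<Rightarrow> bool" where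
  "reg_subrep G \<rho> \<longleftrightarrow> (\<exists>V :: 'h \<Rightarrow> nat \<times> 'g \<Rightarrow> real.
     (\<forall>\<xi> \<eta> p. V (\<xi> + \<eta>) p = V \<xi> p + V \<eta> p) \<and>
     (\<forall>a \<xi> p. V (a *\<^sub>R \<xi>) p = a * V \<xi> p) \<and>
     (\<forall>\<xi> n h. h \<notin> carrier G \<longrightarrow> V \<xi> (n, h) = 0) \<and>
     (\<forall>\<xi>. ((\<lambda>p. (V \<xi> p)\<^sup>2) has_sum (norm \<xi>)\<^sup>2) UNIV) \<and>
     (\<forall>g\<in>carrier G. \<forall>\<xi> n. \<forall>h\<in>carrier G. V (\<rho> g \<xi>) (n, h) = V \<xi> (n, inv\<^bsub>G\<^esub> g \<otimes>\<^bsub>G\<^esub> h)))"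

text \<open>Gaussian action of rho (characterized up to isomorphism).  "The u(xi) generate
  L^infinity as a von Neumann algebra" is expressed as: the sigma-algebra generated by
  the functions u(xi) equals the whole sigma-algebra modulo null sets.\<close>
definition gaussian_action :: "'g monoid \<Rightarrow> ('g \<Rightarrow> 'h::real_inner \<Rightarrow> 'h) \<Rightarrow> 'x measure
     \<Rightarrow> ('g \<Rightarrow> 'x \<Rightarrow> 'x) \<Rightarrow> bool" where
  "gaussian_action G \<rho> M T \<longleftrightarrow> pmp_action G M T \<and> standard_prob_space M \<and>
     (\<exists>u :: 'h \<Rightarrow> 'x \<Rightarrow> complex.
        (\<forall>\<xi>. u \<xi> \<in> borel_measurable M) \<and>
        (\<forall>\<xi>. AE x in M. cmod (u \<xi> x) = 1) \<and>
        (\<forall>\<xi>1 \<xi>2. AE x in M. u (\<xi>1 + \<xi>2) x = u \<xi>1 x * u \<xi>2 x) \<and>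
        (\<forall>\<xi>. integral\<^sup>L M (u \<xi>) = complex_of_real (exp (- pi * (norm \<xi>)\<^sup>2))) \<and>
        (\<forall>g\<in>carrier G. \<forall>\<xi>. AE x in M. u \<xi> (T (inv\<^bsub>G\<^esub> g) x) = u (\<rho> g \<xi>) x) \<and>
        (\<forall>A\<in>sets M. \<exists>B\<in>sigma_sets (space M) {u \<xi> -` U \<inter> space M | \<xi> U. U \<in> sets borel}.
            emeasure M (symdiff A B) = 0))"

end

(* The Gaussian action is a factor, via a measurable map Theta, of the Bernoulli shift over G with
   base a countable product of Gaussians: rho sits inside a multiple of the regular representation,
   so u(xi) corresponds to e^{i W(xi)} for a Gaussian linear functional W(xi), and points are
   reconstructed from the values of countably many u(xi).  Given labels y_v in Y at the vertices v of
   a sofic approximation that come from a sofic homomorphism of Y, put i.i.d. Gaussians on the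
   vertices, let x_v be Theta of the Bernoulli name seen from v, and use the random points (x_v, y_v)
   as a microstate of X x Y.  The x_v have the right law, are equivariant up to a small error because
   Theta is approximable by cylinder functions, and are independent at most pairs of vertices, so a
   second moment estimate shows that this is a good microstate with probability at least 1/2.
   On the other hand, for fixed xi the random values u(xi)(x_v) satisfy a small-ball estimate: the
   probability that they all fall into prescribed arcs of length 1/N is at most (C/N)^(c d), where C
   and c depend only on xi.  Hence there are at least (N/C)^(c d) / 2 microstates that are
   distinguished by the partition of X into preimages of arcs under u(xi), and N is arbitrary. *)

theory Submission
  imports Defs
begin

section \<open>Approximation of measurable sets\<close>

text \<open>The quantifiers of the entropy shape the proof: the observing partition and the growth
  rate come before the partition, the finite set of group elements and the tolerance that a
  microstate must respect. The small-ball exponent must therefore survive any enlargement of the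
  window through which Bernoulli names are read. Names at different vertices share Gaussians, so the
  values of \<open>W\<close> there are correlated. A finite core of the coefficients, chosen from
  \<xi> alone, carries most of the variance and hits each shared variable a bounded number of times.
  Counting dimensions then yields a positive proportion of vertices whose coefficient vectors stay
  uniformly far from the span of those chosen earlier, whatever the rest of the window does. Only
  \<open>W\<close> modulo 2\<pi> is visible, so trigonometric sums and the characteristic function
  replace Gaussian densities. Outside the window, and at vertices where the approximation is
  degenerate, a name uses variables private to its vertex. Each point of the model then has exactly
  the right law, and errors concern only equivariance and empirical averages.\<close>

lemma sigma_sets_countable_generators:
  assumes "A \<in> sigma_sets \<Omega> G"
  shows "\<exists>G'\<subseteq>G. countable G' \<and> A \<in> sigma_sets \<Omega> G'"
  using assms
proof induction
  case (Basic a)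
  then show ?case by (intro exI[of _ "{a}"]) (auto intro: sigma_sets.Basic)
next
  case Empty
  then show ?case by (intro exI[of _ "{}"]) (auto intro: sigma_sets.Empty)
next
  case (Compl a)
  then show ?case by (meson sigma_sets.Compl)
next
  case (Union a)
  then obtain G' where G': "\<And>i::nat. G' i \<subseteq> G" "\<And>i. countable (G' i)" "\<And>i. a i \<in> sigma_sets \<Omega> (G' i)"
    by metis
  have "a i \<in> sigma_sets \<Omega> (\<Union>i. G' i)" for i
    using sigma_sets_mono'[of "G' i" "\<Union>i. G' i"] G'(3) by blast
  then show ?case
    using G' by (intro exI[of _ "\<Union>i. G' i"]) (auto intro: sigma_sets.Union)
qed

lemma (in finite_measure) approx_by_algebra:
  assumes alg: "algebra (space M) \<A>" and gen: "sets M = sigma_sets (space M) \<A>"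
    and A: "A \<in> sets M" and e: "e > 0"
  shows "\<exists>D\<in>\<A>. measure M (symdiff A D) < e"
proof -
  interpret algebra "space M" \<A> by (rule alg)
  have sub: "\<A> \<subseteq> sets M" unfolding gen by (auto intro: sigma_sets.Basic)
  have "A \<in> sigma_sets (space M) \<A>" using A gen by simp
  then show ?thesis using e
  proof (induction arbitrary: e)
    case (Basic a)
    then show ?case by (intro bexI[of _ a]) (auto simp: symdiff_def)
  next
    case Empty
    then show ?case by (intro bexI[of _ "{}"]) (auto simp: symdiff_def)
  next
    case (Compl a)
    then obtain D where D: "D \<in> \<A>" "measure M (symdiff a D) < e" by blast
    have a: "a \<in> sets M" using Compl(1) gen by simp
    have "symdiff (space M - a) (space M - D) = symdiff a D"
      using sets.sets_into_space[OF a] sets.sets_into_space[of D M] D sub unfolding symdiff_def by blast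
    then show ?case using D by (intro bexI[of _ "space M - D"]) auto
  next
    case (Union a)
    have a: "a i \<in> sets M" for i using Union(1) gen by simp
    have "(\<lambda>n. measure M (\<Union>i<n. a i)) \<longlonglongrightarrow> measure M (\<Union>n. \<Union>i<n. a i)"
      using a by (intro finite_Lim_measure_incseq incseq_SucI UN_mono) auto
    moreover have "(\<Union>n. \<Union>i<n. a i) = (\<Union>i. a i)" by auto
    ultimately have "\<forall>\<^sub>F n in sequentially. dist (measure M (\<Union>i<n. a i)) (measure M (\<Union>i. a i)) < e/2"
      using Union(3) by (intro tendstoD) auto
    then obtain n where n: "dist (measure M (\<Union>i<n. a i)) (measure M (\<Union>i. a i)) < e/2"
      by (meson eventually_sequentially order_refl)
    \<comment> \<open>The tail of the union costs e/2; the other half is split evenly among the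
      first n terms, with n + 1 in place of n to avoid dividing by zero.\<close>
    have "\<exists>D\<in>\<A>. measure M (symdiff (a i) D) < e / (2 * (real n + 1))" for i
      using Union by auto
    then obtain D where D: "\<And>i. D i \<in> \<A>" "\<And>i. measure M (symdiff (a i) (D i)) < e / (2 * (real n + 1))"
      by metis
    have Dm: "D i \<in> sets M" for i using D sub by auto
    have sdm: "symdiff (a i) (D i) \<in> sets M" for i using a Dm by (auto simp: symdiff_def)
    have "measure M (symdiff (\<Union>i. a i) (\<Union>i<n. D i))
       \<le> measure M (((\<Union>i. a i) - (\<Union>i<n. a i)) \<union> (\<Union>i<n. symdiff (a i) (D i)))"
      using a Dm sdm by (intro finite_measure_mono) (auto simp: symdiff_def)
    also have "\<dots> \<le> measure M ((\<Union>i. a i) - (\<Union>i<n. a i)) + measure M (\<Union>i<n. symdiff (a i) (D i))"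
      using a sdm by (intro measure_Un_le) auto
    also have "measure M ((\<Union>i. a i) - (\<Union>i<n. a i)) = measure M (\<Union>i. a i) - measure M (\<Union>i<n. a i)"
      using a by (intro finite_measure_Diff) auto
    also have "\<dots> < e/2" using n unfolding dist_real_def by linarith
    also have "measure M (\<Union>i<n. symdiff (a i) (D i)) \<le> (\<Sum>i<n. measure M (symdiff (a i) (D i)))"
      using sdm by (intro finite_measure_subadditive_finite) auto
    also have "\<dots> \<le> (\<Sum>i<n. e / (2 * (real n + 1)))"
      using D(2) by (intro sum_mono) (auto intro: less_imp_le)
    also have "\<dots> \<le> e / 2" using Union(3) by (simp add: field_simps)
    finally show ?case
      using D(1) by (intro bexI[of _ "\<Union>i<n. D i"]) auto
  qed
qed

text \<open>Sets whose section over y depends only on a finite label of y form an algebra containing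
  the rectangles, so approximation by a generating algebra applies. This form is wanted because a
  sofic homomorphism of Y controls points of Y only through finitely many labels.\<close>

lemma approx_sections:
  assumes "prob_space M" "prob_space N" and A: "A \<in> sets (M \<Otimes>\<^sub>M N)" and e: "e > 0"
  shows "\<exists>\<kappa> C (m::nat). \<kappa> \<in> measurable N (count_space UNIV) \<and> (\<forall>y. \<kappa> y < m) \<and> (\<forall>l. C l \<in> sets M) \<and>
     measure (M \<Otimes>\<^sub>M N) (symdiff A {p \<in> space (M \<Otimes>\<^sub>M N). fst p \<in> C (\<kappa> (snd p))}) < e"
proof -
  interpret M: prob_space M by fact
  interpret N: prob_space N by fact
  interpret P: pair_prob_space M N ..
  define S where "S = (\<lambda>(\<kappa>::_\<Rightarrow>nat) C. {p \<in> space (M \<Otimes>\<^sub>M N). fst p \<in> C (\<kappa> (snd p))})"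
  define \<A> where "\<A> = {S \<kappa> C | \<kappa> C m. \<kappa> \<in> measurable N (count_space UNIV) \<and> (\<forall>y. \<kappa> y < m) \<and> (\<forall>l. C l \<in> sets M)}"
  have Sm: "S \<kappa> C \<in> sets (M \<Otimes>\<^sub>M N)" if [measurable]: "\<kappa> \<in> measurable N (count_space UNIV)" "\<And>l. C l \<in> sets M" for \<kappa> C
  proof -
    have "S \<kappa> C = (\<Union>l. C l \<times> (\<kappa> -` {l} \<inter> space N))"
      using sets.sets_into_space[OF that(2)] by (auto simp: S_def space_pair_measure)
    then show ?thesis by simp
  qed
  have "algebra (space (M \<Otimes>\<^sub>M N)) \<A>"
    unfolding algebra_iff_Un
  proof (intro conjI ballI)
    show "\<A> \<subseteq> Pow (space (M \<Otimes>\<^sub>M N))" by (auto simp: \<A>_def S_def)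
    show "{} \<in> \<A>" unfolding \<A>_def
      by (intro CollectI exI[of _ "\<lambda>_. 0"] exI[of _ "\<lambda>_. {}"] exI[of _ 1]) (auto simp: S_def)
    fix a assume "a \<in> \<A>"
    then obtain \<kappa> C m where a: "a = S \<kappa> C" "\<kappa> \<in> measurable N (count_space UNIV)" "\<forall>y. \<kappa> y < m" "\<forall>l. C l \<in> sets M"
      by (auto simp: \<A>_def)
    have "space (M \<Otimes>\<^sub>M N) - a = S \<kappa> (\<lambda>l. space M - C l)"
      by (auto simp: a S_def space_pair_measure)
    then show "space (M \<Otimes>\<^sub>M N) - a \<in> \<A>" using a unfolding \<A>_def by blast
    fix b assume "b \<in> \<A>"
    then obtain \<kappa>' C' m' where b: "b = S \<kappa>' C'" "\<kappa>' \<in> measurable N (count_space UNIV)" "\<forall>y. \<kappa>' y < m'" "\<forall>l. C' l \<in> sets M"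
      by (auto simp: \<A>_def)
    \<comment> \<open>Both labels are stored in one number to base \<open>m'\<close>; the strict
      bound on \<open>\<kappa>'\<close> makes the digits recoverable.\<close>
    define k where "k y = \<kappa> y * m' + \<kappa>' y" for y
    have k: "k y div m' = \<kappa> y" "k y mod m' = \<kappa>' y" for y
      using b(3)[rule_format, of y] by (auto simp: k_def div_mult_self3[OF less_imp_neq[THEN not_sym]])
    have "a \<union> b = S k (\<lambda>l. C (l div m') \<union> C' (l mod m'))"
      unfolding a b S_def k by auto
    moreover have "k \<in> measurable N (count_space UNIV)"
      unfolding k_def using a(2) b(2) by measurable
    moreover have "k y < m * m'" for y
    proof -
      have "k y < Suc (\<kappa> y) * m'" using b(3) by (simp add: k_def)
      also have "\<dots> \<le> m * m'" using a(3) by (intro mult_right_mono) (auto simp: Suc_le_eq)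
      finally show ?thesis .
    qed
    ultimately show "a \<union> b \<in> \<A>" using a b unfolding \<A>_def
      by (intro CollectI exI[of _ k] exI[of _ "\<lambda>l. C (l div m') \<union> C' (l mod m')"] exI[of _ "m * m'"]) auto
  qed
  moreover have "sets (M \<Otimes>\<^sub>M N) = sigma_sets (space (M \<Otimes>\<^sub>M N)) \<A>"
  proof
    have "a \<times> b \<in> \<A>" if "a \<in> sets M" "b \<in> sets N" for a b
    proof -
      have "a \<times> b = S (\<lambda>y. if y \<in> b then 1 else 0) (\<lambda>l. if l = 0 then {} else a)"
        using sets.sets_into_space[OF that(1)] sets.sets_into_space[OF that(2)]
        by (auto simp: S_def space_pair_measure)
      moreover have "(\<lambda>y. if y \<in> b then 1 else 0::nat) \<in> measurable N (count_space UNIV)"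
        using that by measurable
      ultimately show ?thesis unfolding \<A>_def using that
        by (intro CollectI exI[of _ "\<lambda>y. if y \<in> b then 1 else 0"] exI[of _ "\<lambda>l. if l = 0 then {} else a"] exI[of _ 2]) auto
    qed
    then show "sets (M \<Otimes>\<^sub>M N) \<subseteq> sigma_sets (space (M \<Otimes>\<^sub>M N)) \<A>"
      unfolding sets_pair_measure space_pair_measure by (intro sigma_sets_mono') auto
    show "sigma_sets (space (M \<Otimes>\<^sub>M N)) \<A> \<subseteq> sets (M \<Otimes>\<^sub>M N)"
      by (intro sets.sigma_sets_subset) (auto simp: \<A>_def intro!: Sm)
  qed
  ultimately obtain D where "D \<in> \<A>" "measure (M \<Otimes>\<^sub>M N) (symdiff A D) < e"
    using P.approx_by_algebra A e by blast
  then show ?thesis unfolding \<A>_def S_def by blast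
qed

text \<open>Dependence on finitely many coordinates is expressed as invariance under agreement on J,
  so that it can be applied to one random vector read through two different index maps.\<close>

lemma approx_cylinder:
  fixes A :: "('i \<Rightarrow> 'a) set"
  assumes N: "prob_space N" "space N = UNIV" and A: "A \<in> sets (PiM UNIV (\<lambda>_::'i. N))" and e: "e > 0"
  shows "\<exists>D J. D \<in> sets (PiM UNIV (\<lambda>_. N)) \<and> finite J \<and> (\<forall>\<omega> \<omega>'. (\<forall>i\<in>J. \<omega> i = \<omega>' i) \<longrightarrow> (\<omega> \<in> D \<longleftrightarrow> \<omega>' \<in> D)) \<and>
    measure (PiM UNIV (\<lambda>_. N)) (symdiff A D) < e"
proof -
  let ?P = "PiM UNIV (\<lambda>_::'i. N)"
  interpret P: prob_space ?P using N by (intro prob_space_PiM)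
  have sp: "space ?P = UNIV" by (simp add: space_PiM N)
  define det where "det J D \<longleftrightarrow> (\<forall>\<omega> \<omega>'. (\<forall>i\<in>J. \<omega> i = \<omega>' i) \<longrightarrow> (\<omega> \<in> D \<longleftrightarrow> \<omega>' \<in> D))"
    for J and D :: "('i \<Rightarrow> 'a) set"
  define \<A> where "\<A> = {D \<in> sets ?P. \<exists>J. finite J \<and> det J D}"
  have "algebra (space ?P) \<A>"
    unfolding algebra_iff_Un
  proof (intro conjI ballI)
    show "\<A> \<subseteq> Pow (space ?P)" by (simp add: sp)
    show "{} \<in> \<A>" unfolding \<A>_def det_def by blast
    fix a assume a: "a \<in> \<A>"
    then obtain J where J: "finite J" "det J a" unfolding \<A>_def by blast
    then have "det J (space ?P - a)" unfolding det_def sp by simp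
    then show "space ?P - a \<in> \<A>" using J a unfolding \<A>_def by blast
    fix b assume b: "b \<in> \<A>"
    from a b obtain J J' where "finite J" "det J a" "finite J'" "det J' b" unfolding \<A>_def by blast
    then have "finite (J \<union> J')" "det (J \<union> J') (a \<union> b)"
      unfolding det_def by (simp, blast)
    then show "a \<union> b \<in> \<A>" using a b unfolding \<A>_def by blast
  qed
  moreover have "sets ?P = sigma_sets (space ?P) \<A>"
  proof
    have *: "{f. f i \<in> B} \<in> \<A>" if "B \<in> sets N" for i B
    proof -
      have "(\<lambda>f. f i) -` B \<inter> space ?P \<in> sets ?P" using that by measurable
      then have "{f. f i \<in> B} \<in> sets ?P" by (simp add: sp vimage_def)
      then show ?thesis unfolding \<A>_def det_def by (intro CollectI conjI exI[of _ "{i}"]) auto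
    qed
    show "sets ?P \<subseteq> sigma_sets (space ?P) \<A>"
      unfolding sets_PiM_single space_PiM using * by (intro sigma_sets_mono') (auto simp: N)
    show "sigma_sets (space ?P) \<A> \<subseteq> sets ?P"
      by (intro sets.sigma_sets_subset) (auto simp: \<A>_def)
  qed
  ultimately obtain D where "D \<in> \<A>" "measure ?P (symdiff A D) < e"
    using P.approx_by_algebra A e by blast
  then show ?thesis unfolding \<A>_def det_def by blast
qed

section \<open>Uniqueness of measures on the infinite torus\<close>

text \<open>On the torus these are the characters. There \<open>cnj\<close> is the inverse, so
  negative exponents still give functions that are continuous, hence Borel, on the whole product
  space.\<close>

definition torus_monomial :: "(nat \<Rightarrow> nat) \<Rightarrow> (nat \<Rightarrow> nat) \<Rightarrow> nat \<Rightarrow> (nat \<Rightarrow> complex) \<Rightarrow> complex" where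
  "torus_monomial a b L z = (\<Prod>j<L. z j ^ a j * cnj (z j) ^ b j)"

text \<open>Complex coefficients make the set closed under products and conjugation. Its real parts
  then form a real algebra, to which the Stone-Weierstrass locale \<open>function_ring_on\<close>
  applies.\<close>

inductive_set trig_poly :: "((nat \<Rightarrow> complex) \<Rightarrow> complex) set" where
  monomial: "(\<lambda>z. c * torus_monomial a b L z) \<in> trig_poly"
| add: "f \<in> trig_poly \<Longrightarrow> g \<in> trig_poly \<Longrightarrow> (\<lambda>z. f z + g z) \<in> trig_poly"

lemma torus_monomial_mult:
  "\<exists>a'' b'' L''. \<forall>z. torus_monomial a b L z * torus_monomial a' b' L' z = torus_monomial a'' b'' L'' z"
proof -
  \<comment> \<open>Exponents are extended by zero to a common length, so that monomials can be
    multiplied coordinatewise.\<close>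
  have pad: "torus_monomial a b L z = (\<Prod>j<K. z j ^ (if j < L then a j else 0) * cnj (z j) ^ (if j < L then b j else 0))"
    if "L \<le> K" for a b L K z
    unfolding torus_monomial_def using that by (intro prod.mono_neutral_cong_left) auto
  let ?K = "max L L'"
  have "torus_monomial a b L z * torus_monomial a' b' L' z =
     torus_monomial (\<lambda>j. (if j < L then a j else 0) + (if j < L' then a' j else 0))
       (\<lambda>j. (if j < L then b j else 0) + (if j < L' then b' j else 0)) ?K z" for z
    by (subst pad[of L ?K], simp, subst pad[of L' ?K], simp)
       (simp add: torus_monomial_def power_add prod.distrib[symmetric] mult_ac)
  then show ?thesis by blast
qed

lemma trig_poly_mult:
  assumes "f \<in> trig_poly" "g \<in> trig_poly"
  shows "(\<lambda>z. f z * g z) \<in> trig_poly"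
  using assms
proof (induction arbitrary: g)
  case (monomial c a b L)
  from monomial.prems show ?case
  proof induction
    case (monomial c' a' b' L')
    obtain a'' b'' L'' where "\<forall>z. torus_monomial a b L z * torus_monomial a' b' L' z = torus_monomial a'' b'' L'' z"
      using torus_monomial_mult by blast
    then have "(\<lambda>z. c * torus_monomial a b L z * (c' * torus_monomial a' b' L' z)) = (\<lambda>z. (c * c') * torus_monomial a'' b'' L'' z)"
      by (auto simp: fun_eq_iff mult_ac)
    then show ?case by (simp only: trig_poly.monomial)
  next
    case (add f g)
    then show ?case by (simp add: distrib_left trig_poly.add)
  qed
next
  case (add f h)
  then show ?case by (simp add: distrib_right trig_poly.add)
qed

lemma trig_poly_cnj:
  assumes "f \<in> trig_poly"
  shows "(\<lambda>z. cnj (f z)) \<in> trig_poly"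
  using assms
proof induction
  case (monomial c a b L)
  have "(\<lambda>z. cnj (c * torus_monomial a b L z)) = (\<lambda>z. cnj c * torus_monomial b a L z)"
    by (auto simp: fun_eq_iff torus_monomial_def mult_ac)
  then show ?case by (simp only: trig_poly.monomial)
next
  case (add f g)
  then show ?case by (simp add: trig_poly.add)
qed

lemma trig_poly_const: "(\<lambda>_. c) \<in> trig_poly"
  using trig_poly.monomial[of c _ _ 0] by (simp add: torus_monomial_def)

lemma continuous_torus_monomial: "continuous_on UNIV (torus_monomial a b L)"
  unfolding torus_monomial_def by (intro continuous_intros continuous_on_product_coordinates)

lemma continuous_trig_poly: "f \<in> trig_poly \<Longrightarrow> continuous_on UNIV f"
  by (induction rule: trig_poly.induct) (auto intro!: continuous_intros continuous_torus_monomial)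

lemma function_ring_on_trig_poly:
  "function_ring_on {\<lambda>z. Re (f z) | f. f \<in> trig_poly} (PiE UNIV (\<lambda>_. sphere 0 1))"
proof
  show "compact (PiE UNIV (\<lambda>_. sphere 0 1) :: (nat \<Rightarrow> complex) set)"
    using compactin_PiE[of "\<lambda>_::nat. euclidean :: complex topology" UNIV "\<lambda>_. sphere 0 1"]
    by (simp add: euclidean_product_topology compactin_euclidean_iff)
next
  fix g assume "g \<in> {\<lambda>z. Re (f z) | f. f \<in> trig_poly}"
  then obtain f where f: "f \<in> trig_poly" "g = (\<lambda>z. Re (f z))" by auto
  show "continuous_on (PiE UNIV (\<lambda>_. sphere 0 1)) g"
    unfolding f(2) by (intro continuous_intros continuous_on_subset[OF continuous_trig_poly[OF f(1)]]) auto
  fix g' assume "g' \<in> {\<lambda>z. Re (f z) | f. f \<in> trig_poly}"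
  then obtain f' where f': "f' \<in> trig_poly" "g' = (\<lambda>z. Re (f' z))" by auto
  have "(\<lambda>z. f z + f' z) \<in> trig_poly" using f f' by (intro trig_poly.add)
  then show "(\<lambda>z. g z + g' z) \<in> {\<lambda>z. Re (f z) | f. f \<in> trig_poly}"
    unfolding f f' by (intro CollectI exI[of _ "\<lambda>z. f z + f' z"]) auto
  \<comment> \<open>The product of two real parts is the real part of half of
    \<open>f * f' + f * cnj f'\<close>; this is where closure under conjugation enters.\<close>
  have "(\<lambda>z. (\<lambda>_. 1/2) z * (f z * f' z + f z * cnj (f' z))) \<in> trig_poly"
    using f f' by (intro trig_poly.add trig_poly_mult trig_poly_cnj trig_poly_const)
  then show "(\<lambda>z. g z * g' z) \<in> {\<lambda>z. Re (f z) | f. f \<in> trig_poly}"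
    unfolding f f' by (intro CollectI exI[of _ "\<lambda>z. (\<lambda>_. 1/2) z * (f z * f' z + f z * cnj (f' z))"] conjI ext)
      (auto simp: field_simps)
next
  fix c
  show "(\<lambda>_. c) \<in> {\<lambda>z. Re (f z) | f. f \<in> trig_poly}"
    by (intro CollectI exI[of _ "\<lambda>_. of_real c"]) (auto intro: trig_poly_const)
next
  fix x y :: "nat \<Rightarrow> complex"
  assume "x \<noteq> y"
  then obtain j where j: "x j \<noteq> y j" by auto
  have *: "(\<lambda>z. c * z j) \<in> trig_poly" for c
  proof -
    have "(\<Prod>i<Suc j. z i ^ (if i = j then 1 else 0) * cnj (z i) ^ 0) = z j" for z :: "nat \<Rightarrow> complex"
      by (simp add: if_distrib prod.If_cases cong: if_cong)
    then have "(\<lambda>z. c * z j) = (\<lambda>z. c * torus_monomial (\<lambda>i. if i = j then 1 else 0) (\<lambda>_. 0) (Suc j) z)"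
      by (simp add: torus_monomial_def)
    then show ?thesis by (simp only: trig_poly.monomial)
  qed
  \<comment> \<open>Multiplication by \<open>- \<i>\<close> turns the imaginary part into a real
    part, so real parts alone separate points.\<close>
  from j have "Re (1 * x j) \<noteq> Re (1 * y j) \<or> Re (- \<i> * x j) \<noteq> Re (- \<i> * y j)"
    by (auto simp: complex_eq_iff)
  then show "\<exists>f\<in>{\<lambda>z. Re (f z) | f. f \<in> trig_poly}. f x \<noteq> f y"
  proof
    assume "Re (1 * x j) \<noteq> Re (1 * y j)"
    then show ?thesis using *[of 1] by (intro bexI[of _ "\<lambda>z. Re (1 * z j)"] CollectI exI[of _ "\<lambda>z. 1 * z j"] conjI refl)
  next
    assume "Re (- \<i> * x j) \<noteq> Re (- \<i> * y j)"
    then show ?thesis using *[of "- \<i>"] by (intro bexI[of _ "\<lambda>z. Re (- \<i> * z j)"] CollectI exI[of _ "\<lambda>z. - \<i> * z j"] conjI refl)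
  qed
qed

text \<open>The torus is compact, so Stone-Weierstrass supplies trigonometric polynomials that are
  nearly 1 on a closed set and nearly 0 away from it. Equal integrals of monomials thus force equal
  masses of closed sets, and these form an intersection-stable generator.\<close>

lemma torus_measure_eq:
  fixes P Q :: "(nat \<Rightarrow> complex) measure"
  assumes P: "prob_space P" "sets P = sets borel" "AE z in P. \<forall>j. cmod (z j) = 1"
    and Q: "prob_space Q" "sets Q = sets borel" "AE z in Q. \<forall>j. cmod (z j) = 1"
    and eq: "\<And>a b L. integral\<^sup>L P (torus_monomial a b L) = integral\<^sup>L Q (torus_monomial a b L)"
  shows "P = Q"
proof -
  define S :: "(nat \<Rightarrow> complex) set" where "S = PiE UNIV (\<lambda>_. sphere 0 1)"
  define R where "R = {\<lambda>z. Re (f z) | f. f \<in> trig_poly}"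
  interpret S: function_ring_on R S
    unfolding S_def R_def by (rule function_ring_on_trig_poly)
  have closedS: "closed S" using S.compact by (rule compact_imp_closed)
  have meas: "f \<in> borel_measurable M" if "f \<in> trig_poly" "sets M = sets borel" for f M
    using borel_measurable_continuous_onI[OF continuous_trig_poly[OF that(1)]] that(2)
    by (simp cong: measurable_cong_sets)
  have AES: "AE z in M. z \<in> S" if "AE z in M. \<forall>j. cmod (z j) = 1" for M
    using that by (simp add: S_def PiE_UNIV_domain Pi_def)
  have int: "integrable M f" if M: "prob_space M" "sets M = sets borel" "AE z in M. \<forall>j. cmod (z j) = 1"
    and f: "f \<in> trig_poly" for M f
  proof -
    interpret prob_space M by fact
    have "bounded (f ` S)"
      using S.compact f by (intro compact_imp_bounded compact_continuous_image continuous_on_subset[OF continuous_trig_poly]) auto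
    then obtain B where "\<And>z. z \<in> S \<Longrightarrow> cmod (f z) \<le> B" by (auto simp: bounded_iff)
    then have "AE z in M. cmod (f z) \<le> B" using AES[OF M(3)] by auto
    then show ?thesis using meas[OF f M(2)] by (rule integrable_const_bound)
  qed
  have eq': "integral\<^sup>L P f = integral\<^sup>L Q f" if "f \<in> trig_poly" for f
    using that
  proof induction
    case (monomial c a b L)
    then show ?case using eq by simp
  next
    case (add f g)
    then show ?case
      using int[OF P, of f] int[OF P, of g] int[OF Q, of f] int[OF Q, of g] by simp
  qed
  \<comment> \<open>The inequality is stated for an arbitrary pair of measures, so that exchanging
    their roles gives equality.\<close>
  have le: "measure P C \<le> measure Q C"
    if P: "prob_space P" "sets P = sets borel" "AE z in P. \<forall>j. cmod (z j) = 1"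
      and Q: "prob_space Q" "sets Q = sets borel" "AE z in Q. \<forall>j. cmod (z j) = 1"
      and eq': "\<And>f. f \<in> trig_poly \<Longrightarrow> integral\<^sup>L P f = integral\<^sup>L Q f"
      and C: "closed C" for P Q :: "(nat \<Rightarrow> complex) measure" and C
  proof (cases "C \<inter> S = {}")
    case True
    interpret P: prob_space P by fact
    have "AE z in P. z \<notin> C" using AES[OF P(3)] True by auto
    then have "measure P C = 0"
      using P C by (subst P.prob_eq_0) auto
    then show ?thesis by simp
  next
    case False
    interpret P: prob_space P by fact
    interpret Q: prob_space Q by fact
    define C' where "C' = C \<inter> S"
    have C': "closed C'" "C' \<noteq> {}" "C' \<subseteq> S" using C closedS False by (auto simp: C'_def)
    \<comment> \<open>\<open>B n\<close> keeps a positive distance from \<open>C'\<close> and can be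
      separated from it by a polynomial, while the complements \<open>S - B n\<close> shrink to
      \<open>C'\<close>.\<close>
    define B where "B n = {x \<in> S. 1 / (real n + 1) \<le> infdist x C'}" for n
    have closedB: "closed (B n)" for n
      unfolding B_def Collect_conj_eq using closedS
      by (auto intro!: closed_Int closed_Collect_le continuous_intros)
    have main: "measure P C' \<le> measure Q (S - B n)" for n
    proof (rule field_le_epsilon)
      fix e' :: real assume "e' > 0"
      \<comment> \<open>The tolerance is paid twice, for being only nearly 1 on \<open>C'\<close>
        and only nearly 0 on \<open>B n\<close>; the separation lemma also requires it to be below
        1.\<close>
      define e where "e = min (e'/2) (1/2)"
      have e: "0 < e" "e < 1" "2 * e \<le> e'" using \<open>e' > 0\<close> by (auto simp: e_def)
      have "B n \<inter> C' = {}" by (auto simp: B_def infdist_zero)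
      moreover have "B n \<subseteq> S" by (auto simp: B_def)
      ultimately obtain f where f: "f \<in> R" "f ` S \<subseteq> {0..1}"
        "\<forall>x\<in>B n. f x < e" "\<forall>x\<in>C'. f x > 1 - e"
        using S.two[OF closedB[of n] _ C'(1) C'(3) _ e(1) e(2)] by blast
      from f(1) obtain g where g: "g \<in> trig_poly" and fg: "f = (\<lambda>z. Re (g z))"
        unfolding R_def by blast
      have g': "0 \<le> Re (g x) \<and> Re (g x) \<le> 1" if "x \<in> S" for x
        using f(2) that unfolding fg image_subset_iff by (meson atLeastAtMost_iff)
      have gB: "Re (g x) < e" if "x \<in> B n" for x using f(3) that unfolding fg by blast
      have gC: "Re (g x) > 1 - e" if "x \<in> C'" for x using f(4) that unfolding fg by blast
      have intP: "integrable P (\<lambda>x. Re (g x))" and intQ: "integrable Q (\<lambda>x. Re (g x))"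
        using int[OF P g] int[OF Q g] by auto
      have [simp]: "C' \<in> sets P" "S - B n \<in> sets Q" using P Q C' closedB closedS by auto
      have [simp]: "integrable P (indicat_real C')" "integrable Q (indicat_real (S - B n))"
        by (intro integrable_real_indicator; simp add: P.emeasure_eq_measure Q.emeasure_eq_measure)+
      have "(1 - e) * measure P C' = (\<integral>x. (1 - e) * indicator C' x \<partial>P)"
        by simp
      also have "\<dots> \<le> (\<integral>x. Re (g x) \<partial>P)"
      proof (intro integral_mono_AE intP)
        show "AE x in P. (1 - e) * indicator C' x \<le> Re (g x)"
          using AES[OF P(3)] by eventually_elim (use g' gC in \<open>auto simp: indicator_def less_imp_le\<close>)
      qed auto
      also have "\<dots> = (\<integral>x. Re (g x) \<partial>Q)"
        using eq'[OF g] int[OF P g] int[OF Q g] by simp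
      also have "\<dots> \<le> (\<integral>x. e + indicator (S - B n) x \<partial>Q)"
      proof (intro integral_mono_AE intQ)
        show "AE x in Q. Re (g x) \<le> e + indicator (S - B n) x"
          using AES[OF Q(3)]
        proof eventually_elim
          case (elim x)
          then show ?case using g'[of x] gB[of x] e by (auto simp: indicator_def)
        qed
      qed auto
      also have "\<dots> = e + measure Q (S - B n)"
        by (subst Bochner_Integration.integral_add) (auto simp: Q.prob_space)
      finally have "measure P C' - e * measure P C' \<le> e + measure Q (S - B n)" by (simp add: algebra_simps)
      moreover have "e * measure P C' \<le> e * 1" using e by (intro mult_left_mono) auto
      ultimately show "measure P C' \<le> measure Q (S - B n) + e'" using e by linarith
    qed
    have "(\<lambda>n. measure Q (S - B n)) \<longlonglongrightarrow> measure Q (\<Inter>n. S - B n)"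
    proof (intro Q.finite_Lim_measure_decseq)
      show "range (\<lambda>n. S - B n) \<subseteq> sets Q" using Q closedB closedS by auto
      show "decseq (\<lambda>n. S - B n)"
      proof (intro decseq_SucI)
        fix n
        have "1 / (real (Suc n) + 1) \<le> 1 / (real n + 1)" by (simp add: field_simps)
        then show "S - B (Suc n) \<subseteq> S - B n" unfolding B_def by force
      qed
    qed
    then have "measure P C' \<le> measure Q (\<Inter>n. S - B n)"
      using main by (intro LIMSEQ_le_const) auto
    also have "(\<Inter>n. S - B n) = C'"
    proof (intro equalityI subsetI)
      fix x assume x: "x \<in> (\<Inter>n. S - B n)"
      then have "\<And>n. infdist x C' < 1 / (real n + 1)" by (auto simp: B_def not_le)
      then have "infdist x C' = 0"
        using infdist_nonneg[of x C'] by (metis add.commute inverse_eq_divide less_asym not_less_iff_gr_or_eq of_nat_Suc order_le_less reals_Archimedean)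
      then show "x \<in> C'" using C' in_closed_iff_infdist_zero by blast
    next
      fix x assume "x \<in> C'"
      then show "x \<in> (\<Inter>n. S - B n)" using C' by (auto simp: B_def infdist_zero)
    qed
    also have "measure P C' = measure P C"
      using AES[OF P(3)] P C closedS by (intro measure_eq_AE) (auto simp: C'_def)
    also have "measure Q C' \<le> measure Q C"
      using Q C by (intro Q.finite_measure_mono) (auto simp: C'_def)
    finally show ?thesis .
  qed
  have eqC: "measure P C = measure Q C" if "closed C" for C
    using le[OF P Q eq' that] le[OF Q P eq'[symmetric] that] by (intro antisym) auto
  interpret P: prob_space P by fact
  interpret Q: prob_space Q by fact
  show ?thesis
  proof (rule measure_eqI_generator_eq[where E="Collect closed" and \<Omega>=UNIV and A="\<lambda>_. UNIV"])
    show "sets P = sigma_sets UNIV (Collect closed)" "sets Q = sigma_sets UNIV (Collect closed)"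
      using P Q by (simp_all add: borel_eq_closed)
    show "emeasure P X = emeasure Q X" if "X \<in> Collect closed" for X
      using eqC[of X] that by (simp add: P.emeasure_eq_measure Q.emeasure_eq_measure)
    show "Int_stable (Collect closed)" by (auto simp: Int_stable_def)
  qed (auto simp: P.emeasure_eq_measure)
qed

section \<open>Gaussian linear functionals\<close>

text \<open>The index type stays polymorphic: one instance, over \<open>nat \<times> 'g\<close>,
  carries the Bernoulli shift; another, over \<open>nat \<times> nat \<times> 'g option\<close>,
  holds the variables attached to vertices.\<close>

definition gauss :: "('i \<Rightarrow> real) measure" where
  "gauss = PiM UNIV (\<lambda>_. std_normal_distribution)"

lemma prob_space_std_normal: "prob_space std_normal_distribution"
  using real_dist_normal_dist by (simp add: real_distribution_def)

interpretation gauss: prob_space "gauss :: ('i \<Rightarrow> real) measure"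
  unfolding gauss_def by (intro prob_space_PiM prob_space_std_normal)

lemma space_gauss [simp]: "space gauss = UNIV"
  by (simp add: gauss_def space_PiM)

lemma sets_gauss [measurable_cong]: "sets gauss = sets (PiM UNIV (\<lambda>_. borel))"
  unfolding gauss_def by (intro sets_PiM_cong) auto

lemma distr_gauss_coordinate: "distr gauss borel (\<lambda>\<omega>. \<omega> p) = std_normal_distribution"
proof -
  have "distr gauss (std_normal_distribution) (\<lambda>\<omega>. \<omega> p) = std_normal_distribution"
    unfolding gauss_def by (intro distr_PiM_component prob_space_std_normal) auto
  also have "distr gauss std_normal_distribution (\<lambda>\<omega>. \<omega> p) = distr gauss borel (\<lambda>\<omega>. \<omega> p)"
    by (intro distr_cong) auto
  finally show ?thesis .
qed

lemma indep_gauss_coordinates: "gauss.indep_vars (\<lambda>_. borel) (\<lambda>p \<omega>. \<omega> p) UNIV"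
proof (subst gauss.indep_vars_iff_distr_eq_PiM)
  have "distr gauss (PiM UNIV (\<lambda>_. borel)) (\<lambda>x. \<lambda>i\<in>UNIV. x i) = distr gauss gauss (\<lambda>x. x)"
    by (intro distr_cong) (auto simp: sets_gauss)
  then show "distr gauss (PiM UNIV (\<lambda>_. borel)) (\<lambda>x. \<lambda>i\<in>UNIV. x i) =
     PiM UNIV (\<lambda>i. distr gauss borel (\<lambda>\<omega>. \<omega> i))"
    unfolding distr_gauss_coordinate by (simp add: gauss_def)
qed auto

lemma gauss_reindex_measurable [measurable]: "(\<lambda>\<omega>. \<omega> \<circ> \<iota>) \<in> gauss \<rightarrow>\<^sub>M gauss"
proof -
  have "(\<lambda>\<omega>. \<omega> \<circ> \<iota>) \<in> PiM UNIV (\<lambda>_. borel) \<rightarrow>\<^sub>M PiM UNIV (\<lambda>_. borel)"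
    by (intro measurable_PiM_single') auto
  then show ?thesis by (simp cong: measurable_cong_sets add: sets_gauss)
qed

text \<open>Reading i.i.d. variables through an injection gives i.i.d. variables again; every exact
  law in the random model comes from this.\<close>

lemma distr_gauss_reindex:
  assumes "inj \<iota>"
  shows "distr gauss gauss (\<lambda>\<omega>. \<omega> \<circ> \<iota>) = gauss"
proof -
  have "distr (PiM UNIV (\<lambda>_. std_normal_distribution)) (PiM UNIV (\<lambda>_. std_normal_distribution)) (\<lambda>\<omega>. \<lambda>n\<in>UNIV. \<omega> (\<iota> n))
     = PiM UNIV (\<lambda>_. std_normal_distribution)"
    using assms by (intro distr_PiM_reindex prob_space_std_normal) auto
  then show ?thesis by (simp add: gauss_def comp_def restrict_UNIV)
qed

lemma distributed_gauss_sum: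
  assumes "finite E" "p \<in> E" "a p \<noteq> 0"
  shows "distributed gauss lborel (\<lambda>\<omega>. \<Sum>p\<in>E. a p * \<omega> p) (normal_density 0 (sqrt (\<Sum>p\<in>E. (a p)\<^sup>2)))"
proof -
  \<comment> \<open>A normal density needs positive variance, so coordinates with zero coefficient
    are removed before independent normals are added.\<close>
  define E' where "E' = {p\<in>E. a p \<noteq> 0}"
  have E': "finite E'" "E' \<noteq> {}" using assms by (auto simp: E'_def)
  have "distributed gauss lborel (\<lambda>\<omega>. \<omega> p) std_normal_density" for p :: 'a
    unfolding distributed_def using distr_gauss_coordinate[of p]
    by (auto simp: distr_cong[of gauss gauss lborel borel, OF refl sets_lborel refl])
  then have 1: "distributed gauss lborel (\<lambda>\<omega>. 0 + a p * \<omega> p) (normal_density (0 + a p * 0) (\<bar>a p\<bar> * 1))" if "p \<in> E'" for p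
    using that by (intro gauss.normal_density_affine) (auto simp: E'_def)
  have 2: "gauss.indep_vars (\<lambda>_. borel) (\<lambda>p \<omega>. 0 + a p * \<omega> p) E'"
  proof -
    have "gauss.indep_vars (\<lambda>_. borel) (\<lambda>p \<omega>. (\<lambda>x. 0 + a p * x) (\<omega> p)) E'"
      by (intro gauss.indep_vars_compose2[OF gauss.indep_vars_subset[OF indep_gauss_coordinates]]) auto
    then show ?thesis by simp
  qed
  have "distributed gauss lborel (\<lambda>\<omega>. \<Sum>p\<in>E'. 0 + a p * \<omega> p)
     (normal_density (\<Sum>p\<in>E'. 0 + a p * 0) (sqrt (\<Sum>p\<in>E'. (\<bar>a p\<bar> * 1)\<^sup>2)))"
    by (rule gauss.sum_indep_normal[OF E' 2 _ 1]) (auto simp: E'_def)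
  also have "(\<lambda>\<omega>. \<Sum>p\<in>E'. 0 + a p * \<omega> p) = (\<lambda>\<omega>. \<Sum>p\<in>E. a p * \<omega> p)"
    using assms by (intro ext sum.mono_neutral_cong_left) (auto simp: E'_def)
  also have "(\<Sum>p\<in>E'. (\<bar>a p\<bar> * 1)\<^sup>2) = (\<Sum>p\<in>E. (a p)\<^sup>2)"
    using assms by (intro sum.mono_neutral_cong_left) (auto simp: E'_def)
  finally show ?thesis by simp
qed

lemma gauss_sum_char:
  assumes "finite E"
  shows "(\<integral>\<omega>. iexp (\<Sum>p\<in>E. a p * \<omega> p) \<partial>gauss) = complex_of_real (exp (- (\<Sum>p\<in>E. (a p)\<^sup>2) / 2))"
proof -
  have ind: "gauss.indep_vars (\<lambda>_. borel) (\<lambda>p \<omega>. iexp (a p * \<omega> p)) E"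
  proof -
    have "gauss.indep_vars (\<lambda>_. borel) (\<lambda>p \<omega>. (\<lambda>x. iexp (a p * x)) (\<omega> p)) E"
      by (intro gauss.indep_vars_compose2[OF gauss.indep_vars_subset[OF indep_gauss_coordinates]]) auto
    then show ?thesis by simp
  qed
  have one: "(\<integral>\<omega>. iexp (a p * \<omega> p) \<partial>gauss) = complex_of_real (exp (- (a p)\<^sup>2 / 2))" for p
  proof -
    have "(\<integral>\<omega>. iexp (a p * \<omega> p) \<partial>gauss) = (\<integral>x. iexp (a p * x) \<partial>distr gauss borel (\<lambda>\<omega>. \<omega> p))"
      by (subst integral_distr) auto
    also have "\<dots> = char std_normal_distribution (a p)"
      unfolding distr_gauss_coordinate char_def by simp
    finally show ?thesis by (simp add: char_std_normal_distribution)
  qed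
  have "(\<integral>\<omega>. iexp (\<Sum>p\<in>E. a p * \<omega> p) \<partial>gauss) = (\<integral>\<omega>. (\<Prod>p\<in>E. iexp (a p * \<omega> p)) \<partial>gauss)"
    by (simp add: sum_distrib_left exp_sum[OF assms])
  also have "\<dots> = (\<Prod>p\<in>E. \<integral>\<omega>. iexp (a p * \<omega> p) \<partial>gauss)"
    using assms ind
    by (rule gauss.indep_vars_lebesgue_integral) (auto intro!: gauss.integrable_const_bound[where B=1])
  also have "\<dots> = complex_of_real (exp (\<Sum>p\<in>E. - (a p)\<^sup>2 / 2))"
    unfolding one by (simp add: exp_sum[OF assms])
  also have "(\<Sum>p\<in>E. - (a p)\<^sup>2 / 2) = - (\<Sum>p\<in>E. (a p)\<^sup>2) / 2"
    by (simp add: sum_negf sum_divide_distrib)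
  finally show ?thesis .
qed

section \<open>Square-summable Gaussian series as limits in L1\<close>

lemma integrable_gauss_coordinate: "integrable gauss (\<lambda>\<omega>. \<omega> p)"
proof -
  have "integrable (distr gauss borel (\<lambda>\<omega>. \<omega> p)) (\<lambda>x. x)"
    using integrable_std_normal_distribution_moment[of 1] by (simp add: distr_gauss_coordinate)
  then show ?thesis by (subst (asm) integrable_distr_eq) auto
qed

text \<open>A centred normal variable of standard deviation s has first absolute moment
  \<open>sqrt (2 / pi) * s\<close>, and the factor below 1 is dropped. L1 distances of partial sums
  are thereby controlled by l2 distances of coefficients.\<close>

lemma gauss_sum_L1:
  assumes "finite E"
  shows "(\<integral>\<omega>. \<bar>\<Sum>p\<in>E. a p * \<omega> p\<bar> \<partial>gauss) \<le> sqrt (\<Sum>p\<in>E. (a p)\<^sup>2)"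
proof (cases "\<forall>p\<in>E. a p = 0")
  case True
  then show ?thesis by simp
next
  case False
  then obtain p where p: "p \<in> E" "a p \<noteq> 0" by auto
  define s where "s = sqrt (\<Sum>p\<in>E. (a p)\<^sup>2)"
  have "0 < (\<Sum>p\<in>E. (a p)\<^sup>2)"
    using p assms by (intro sum_pos2[of E p]) auto
  then have s: "s > 0" by (simp add: s_def)
  note D = distributed_gauss_sum[of E p a, OF assms p, folded s_def]
  have "(\<integral>\<omega>. \<bar>\<Sum>p\<in>E. a p * \<omega> p\<bar> \<partial>gauss) = (\<integral>x. normal_density 0 s x * \<bar>x\<bar> \<partial>lborel)"
    by (rule distributed_integral[OF D, symmetric]) auto
  also have "\<dots> = (\<integral>x. normal_density 0 s x * \<bar>x - 0\<bar> ^ (2 * 0 + 1) \<partial>lborel)" by simp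
  also have "\<dots> = sqrt (2 / pi) * s"
    using integral_normal_moment_abs_odd[OF s, of 0 0] by simp
  also have "\<dots> \<le> 1 * s"
    using s pi_gt3 by (intro mult_right_mono) (auto simp: field_simps)
  finally show ?thesis by (simp add: s_def)
qed

text \<open>The random variable \<open>X\<close> is the first Wiener chaos element with coefficients \<open>a\<close>.\<close>
definition gauss_lin :: "('i \<Rightarrow> real) \<Rightarrow> (('i \<Rightarrow> real) \<Rightarrow> real) \<Rightarrow> bool" where
  "gauss_lin a X \<longleftrightarrow> integrable gauss X \<and>
     (\<forall>e>0. \<exists>E\<^sub>0. finite E\<^sub>0 \<and> (\<forall>E. finite E \<longrightarrow> E\<^sub>0 \<subseteq> E \<longrightarrow> (\<integral>\<omega>. \<bar>X \<omega> - (\<Sum>p\<in>E. a p * \<omega> p)\<bar> \<partial>gauss) < e))"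

lemma gauss_linE:
  assumes "gauss_lin a X" "e > 0"
  obtains E\<^sub>0 where "finite E\<^sub>0"
    "\<And>E. finite E \<Longrightarrow> E\<^sub>0 \<subseteq> E \<Longrightarrow> (\<integral>\<omega>. \<bar>X \<omega> - (\<Sum>p\<in>E. a p * \<omega> p)\<bar> \<partial>gauss) < e"
proof -
  from assms have "\<exists>E\<^sub>0. finite E\<^sub>0 \<and> (\<forall>E. finite E \<longrightarrow> E\<^sub>0 \<subseteq> E \<longrightarrow>
      (\<integral>\<omega>. \<bar>X \<omega> - (\<Sum>p\<in>E. a p * \<omega> p)\<bar> \<partial>gauss) < e)"
    unfolding gauss_lin_def by (elim conjE allE impE)
  then show ?thesis by (elim exE conjE) (rule that, auto)
qed

lemma integrable_gauss_sum: "integrable gauss (\<lambda>\<omega>. \<Sum>p\<in>E. a p * \<omega> p)"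
  by (intro Bochner_Integration.integrable_sum integrable_mult_right integrable_gauss_coordinate)

lemma gauss_lin_unique:
  assumes "gauss_lin a X" "gauss_lin a Y"
  shows "AE \<omega> in gauss. X \<omega> = Y \<omega>"
proof -
  have iX: "integrable gauss X" "integrable gauss Y" using assms by (auto simp: gauss_lin_def)
  have "(\<integral>\<omega>. \<bar>X \<omega> - Y \<omega>\<bar> \<partial>gauss) \<le> 0 + e" if "e > 0" for e
  proof -
    have "e / 2 > 0" using that by simp
    obtain E1 where E1: "finite E1"
      "\<And>E. finite E \<Longrightarrow> E1 \<subseteq> E \<Longrightarrow> (\<integral>\<omega>. \<bar>X \<omega> - (\<Sum>p\<in>E. a p * \<omega> p)\<bar> \<partial>gauss) < e/2"
      by (rule gauss_linE[OF assms(1) \<open>e / 2 > 0\<close>]) blast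
    obtain E2 where E2: "finite E2"
      "\<And>E. finite E \<Longrightarrow> E2 \<subseteq> E \<Longrightarrow> (\<integral>\<omega>. \<bar>Y \<omega> - (\<Sum>p\<in>E. a p * \<omega> p)\<bar> \<partial>gauss) < e/2"
      by (rule gauss_linE[OF assms(2) \<open>e / 2 > 0\<close>]) blast
    let ?S = "\<lambda>\<omega>. \<Sum>p\<in>E1 \<union> E2. a p * \<omega> p"
    have "(\<integral>\<omega>. \<bar>X \<omega> - Y \<omega>\<bar> \<partial>gauss) \<le> (\<integral>\<omega>. \<bar>X \<omega> - ?S \<omega>\<bar> + \<bar>Y \<omega> - ?S \<omega>\<bar> \<partial>gauss)"
      using iX by (intro integral_mono integrable_abs Bochner_Integration.integrable_diff Bochner_Integration.integrable_add integrable_gauss_sum) auto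
    also have "\<dots> = (\<integral>\<omega>. \<bar>X \<omega> - ?S \<omega>\<bar> \<partial>gauss) + (\<integral>\<omega>. \<bar>Y \<omega> - ?S \<omega>\<bar> \<partial>gauss)"
      using iX by (intro Bochner_Integration.integral_add integrable_abs Bochner_Integration.integrable_diff integrable_gauss_sum)
    also have "\<dots> \<le> e" using E1(2)[of "E1 \<union> E2"] E2(2)[of "E1 \<union> E2"] E1(1) E2(1) by simp
    finally show ?thesis by simp
  qed
  then have "(\<integral>\<omega>. \<bar>X \<omega> - Y \<omega>\<bar> \<partial>gauss) \<le> 0" by (rule field_le_epsilon)
  then have "(\<integral>\<omega>. \<bar>X \<omega> - Y \<omega>\<bar> \<partial>gauss) = 0" by (intro antisym) auto
  then have "AE \<omega> in gauss. \<bar>X \<omega> - Y \<omega>\<bar> = 0"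
    using iX by (subst (asm) integral_nonneg_eq_0_iff_AE) auto
  then show ?thesis by auto
qed

lemma gauss_lin_add:
  assumes "gauss_lin a X" "gauss_lin b Y"
  shows "gauss_lin (\<lambda>p. a p + b p) (\<lambda>\<omega>. X \<omega> + Y \<omega>)"
  unfolding gauss_lin_def
proof (intro conjI allI impI)
  have iX: "integrable gauss X" "integrable gauss Y" using assms by (auto simp: gauss_lin_def)
  then show "integrable gauss (\<lambda>\<omega>. X \<omega> + Y \<omega>)" by auto
  fix e :: real assume e: "e > 0"
  have "e / 2 > 0" using e by simp
  obtain E1 where E1: "finite E1"
    "\<And>E. finite E \<Longrightarrow> E1 \<subseteq> E \<Longrightarrow> (\<integral>\<omega>. \<bar>X \<omega> - (\<Sum>p\<in>E. a p * \<omega> p)\<bar> \<partial>gauss) < e/2"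
    by (rule gauss_linE[OF assms(1) \<open>e / 2 > 0\<close>]) blast
  obtain E2 where E2: "finite E2"
    "\<And>E. finite E \<Longrightarrow> E2 \<subseteq> E \<Longrightarrow> (\<integral>\<omega>. \<bar>Y \<omega> - (\<Sum>p\<in>E. b p * \<omega> p)\<bar> \<partial>gauss) < e/2"
    by (rule gauss_linE[OF assms(2) \<open>e / 2 > 0\<close>]) blast
  show "\<exists>E\<^sub>0. finite E\<^sub>0 \<and> (\<forall>E. finite E \<longrightarrow> E\<^sub>0 \<subseteq> E \<longrightarrow>
      (\<integral>\<omega>. \<bar>X \<omega> + Y \<omega> - (\<Sum>p\<in>E. (a p + b p) * \<omega> p)\<bar> \<partial>gauss) < e)"
  proof (intro exI[of _ "E1 \<union> E2"] conjI allI impI)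
    fix F assume F: "finite F" "E1 \<union> E2 \<subseteq> F"
    have "(\<integral>\<omega>. \<bar>X \<omega> + Y \<omega> - (\<Sum>p\<in>F. (a p + b p) * \<omega> p)\<bar> \<partial>gauss)
       \<le> (\<integral>\<omega>. \<bar>X \<omega> - (\<Sum>p\<in>F. a p * \<omega> p)\<bar> + \<bar>Y \<omega> - (\<Sum>p\<in>F. b p * \<omega> p)\<bar> \<partial>gauss)"
      using iX by (intro integral_mono integrable_abs Bochner_Integration.integrable_diff Bochner_Integration.integrable_add integrable_gauss_sum)
        (auto simp: distrib_right sum.distrib)
    also have "\<dots> = (\<integral>\<omega>. \<bar>X \<omega> - (\<Sum>p\<in>F. a p * \<omega> p)\<bar> \<partial>gauss) + (\<integral>\<omega>. \<bar>Y \<omega> - (\<Sum>p\<in>F. b p * \<omega> p)\<bar> \<partial>gauss)"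
      using iX by (intro Bochner_Integration.integral_add integrable_abs Bochner_Integration.integrable_diff integrable_gauss_sum)
    also have "\<dots> < e" using E1(2)[of F] E2(2)[of F] F by simp
    finally show "(\<integral>\<omega>. \<bar>X \<omega> + Y \<omega> - (\<Sum>p\<in>F. (a p + b p) * \<omega> p)\<bar> \<partial>gauss) < e" .
  qed (use E1 E2 in auto)
qed

lemma gauss_lin_mult:
  assumes "gauss_lin a X"
  shows "gauss_lin (\<lambda>p. c * a p) (\<lambda>\<omega>. c * X \<omega>)"
  unfolding gauss_lin_def
proof (intro conjI allI impI)
  show "integrable gauss (\<lambda>\<omega>. c * X \<omega>)" using assms by (auto simp: gauss_lin_def)
  fix e :: real assume e: "e > 0"
  have "e / (\<bar>c\<bar> + 1) > 0" using e by simp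
  obtain E0 where E0: "finite E0"
    "\<And>E. finite E \<Longrightarrow> E0 \<subseteq> E \<Longrightarrow> (\<integral>\<omega>. \<bar>X \<omega> - (\<Sum>p\<in>E. a p * \<omega> p)\<bar> \<partial>gauss) < e / (\<bar>c\<bar> + 1)"
    by (rule gauss_linE[OF assms \<open>e / (\<bar>c\<bar> + 1) > 0\<close>]) blast
  show "\<exists>E\<^sub>0. finite E\<^sub>0 \<and> (\<forall>E. finite E \<longrightarrow> E\<^sub>0 \<subseteq> E \<longrightarrow>
      (\<integral>\<omega>. \<bar>c * X \<omega> - (\<Sum>p\<in>E. (c * a p) * \<omega> p)\<bar> \<partial>gauss) < e)"
  proof (intro exI[of _ E0] conjI allI impI)
    fix F assume F: "finite F" "E0 \<subseteq> F"
    have "(\<integral>\<omega>. \<bar>c * X \<omega> - (\<Sum>p\<in>F. (c * a p) * \<omega> p)\<bar> \<partial>gauss)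
      = (\<integral>\<omega>. \<bar>c\<bar> * \<bar>X \<omega> - (\<Sum>p\<in>F. a p * \<omega> p)\<bar> \<partial>gauss)"
      by (simp add: abs_mult[symmetric] right_diff_distrib sum_distrib_left mult.assoc)
    also have "\<dots> = \<bar>c\<bar> * (\<integral>\<omega>. \<bar>X \<omega> - (\<Sum>p\<in>F. a p * \<omega> p)\<bar> \<partial>gauss)" by simp
    also have "\<dots> \<le> \<bar>c\<bar> * (e / (\<bar>c\<bar> + 1))"
      using E0(2)[OF F] by (intro mult_left_mono) auto
    also have "\<dots> < e" using e by (simp add: field_simps)
    finally show "(\<integral>\<omega>. \<bar>c * X \<omega> - (\<Sum>p\<in>F. (c * a p) * \<omega> p)\<bar> \<partial>gauss) < e" .
  qed (use E0 in auto)
qed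

lemma gauss_lin_sum:
  assumes "finite J" "\<And>j. j \<in> J \<Longrightarrow> gauss_lin (a j) (X j)"
  shows "gauss_lin (\<lambda>p. \<Sum>j\<in>J. c j * a j p) (\<lambda>\<omega>. \<Sum>j\<in>J. c j * X j \<omega>)"
  using assms
proof (induction rule: finite_induct)
  case empty
  then show ?case by (auto simp: gauss_lin_def)
next
  case (insert j J)
  then show ?case by (simp add: gauss_lin_add gauss_lin_mult)
qed

text \<open>Since \<iota> preserves the Gaussian measure, L1 errors are unchanged, while
  coefficients are transported along \<iota> and extended by zero. Together with
  \<open>gauss_lin_unique\<close>, this reduces almost sure identities between shifted or relabelled
  functionals to identities between coefficients.\<close>

lemma gauss_lin_reindex:
  assumes \<iota>: "inj \<iota>" and "gauss_lin a X" and b: "\<And>p. b (\<iota> p) = a p" "\<And>q. q \<notin> range \<iota> \<Longrightarrow> b q = 0"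
  shows "gauss_lin b (\<lambda>\<omega>. X (\<omega> \<circ> \<iota>))"
  unfolding gauss_lin_def
proof (intro conjI allI impI)
  have X: "integrable gauss X" using assms by (auto simp: gauss_lin_def)
  have int: "(\<integral>\<omega>. f (\<omega> \<circ> \<iota>) \<partial>gauss) = (\<integral>\<omega>. f \<omega> \<partial>gauss)" if "f \<in> borel_measurable gauss" for f :: "_ \<Rightarrow> real"
    using integral_distr[OF gauss_reindex_measurable that, of \<iota>] distr_gauss_reindex[OF \<iota>] by simp
  show "integrable gauss (\<lambda>\<omega>. X (\<omega> \<circ> \<iota>))"
    using integrable_distr[of "\<lambda>\<omega>. \<omega> \<circ> \<iota>" gauss gauss X] X distr_gauss_reindex[OF \<iota>] by simp
  fix e :: real assume e: "e > 0"
  obtain E0 where E0: "finite E0"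
    "\<And>E. finite E \<Longrightarrow> E0 \<subseteq> E \<Longrightarrow> (\<integral>\<omega>. \<bar>X \<omega> - (\<Sum>p\<in>E. a p * \<omega> p)\<bar> \<partial>gauss) < e"
    by (rule gauss_linE[OF assms(2) e]) blast
  show "\<exists>E\<^sub>0. finite E\<^sub>0 \<and> (\<forall>E. finite E \<longrightarrow> E\<^sub>0 \<subseteq> E \<longrightarrow>
      (\<integral>\<omega>. \<bar>X (\<omega> \<circ> \<iota>) - (\<Sum>p\<in>E. b p * \<omega> p)\<bar> \<partial>gauss) < e)"
  proof (intro exI[of _ "\<iota> ` E0"] conjI allI impI)
    fix F assume F: "finite F" "\<iota> ` E0 \<subseteq> F"
    have F': "finite (\<iota> -` F)" "E0 \<subseteq> \<iota> -` F" using F \<iota> by (auto intro: finite_vimageI)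
    have "(\<Sum>q\<in>F. b q * \<omega> q) = (\<Sum>p\<in>\<iota> -` F. a p * (\<omega> \<circ> \<iota>) p)" for \<omega>
    proof -
      have "(\<Sum>q\<in>F. b q * \<omega> q) = (\<Sum>q\<in>\<iota> ` (\<iota> -` F). b q * \<omega> q)"
        using F b(2) by (intro sum.mono_neutral_right) auto
      also have "\<dots> = (\<Sum>p\<in>\<iota> -` F. a p * (\<omega> \<circ> \<iota>) p)"
        using \<iota> by (subst sum.reindex) (auto simp: b inj_on_def)
      finally show ?thesis .
    qed
    then have "(\<integral>\<omega>. \<bar>X (\<omega> \<circ> \<iota>) - (\<Sum>p\<in>F. b p * \<omega> p)\<bar> \<partial>gauss)
      = (\<integral>\<omega>. (\<lambda>\<omega>. \<bar>X \<omega> - (\<Sum>p\<in>\<iota> -` F. a p * \<omega> p)\<bar>) (\<omega> \<circ> \<iota>) \<partial>gauss)" by simp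
    also have "\<dots> = (\<integral>\<omega>. \<bar>X \<omega> - (\<Sum>p\<in>\<iota> -` F. a p * \<omega> p)\<bar> \<partial>gauss)"
      using X integrable_gauss_sum by (intro int borel_measurable_abs borel_measurable_diff borel_measurable_integrable)
    also have "\<dots> < e" using E0(2)[OF F'] .
    finally show "(\<integral>\<omega>. \<bar>X (\<omega> \<circ> \<iota>) - (\<Sum>p\<in>F. b p * \<omega> p)\<bar> \<partial>gauss) < e" .
  qed (use E0 in auto)
qed

lemma gauss_lin_char_approx:
  assumes "gauss_lin a X" "e > 0"
  shows "\<exists>E\<^sub>0. finite E\<^sub>0 \<and> (\<forall>E. finite E \<longrightarrow> E\<^sub>0 \<subseteq> E \<longrightarrow>
    cmod ((\<integral>\<omega>. iexp (X \<omega>) \<partial>gauss) - complex_of_real (exp (- (\<Sum>p\<in>E. (a p)\<^sup>2) / 2))) < e)"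
proof -
  have X: "integrable gauss X" using assms by (auto simp: gauss_lin_def)
  then have [measurable]: "X \<in> borel_measurable gauss" by auto
  obtain E0 where E0: "finite E0"
    "\<And>E. finite E \<Longrightarrow> E0 \<subseteq> E \<Longrightarrow> (\<integral>\<omega>. \<bar>X \<omega> - (\<Sum>p\<in>E. a p * \<omega> p)\<bar> \<partial>gauss) < e"
    by (rule gauss_linE[OF assms]) blast
  have "cmod ((\<integral>\<omega>. iexp (X \<omega>) \<partial>gauss) - complex_of_real (exp (- (\<Sum>p\<in>E. (a p)\<^sup>2) / 2))) < e"
    if E: "finite E" "E0 \<subseteq> E" for E
  proof -
    let ?S = "\<lambda>\<omega>. \<Sum>p\<in>E. a p * \<omega> p"
    have S: "integrable gauss ?S" by (rule integrable_gauss_sum)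
    then have [measurable]: "?S \<in> borel_measurable gauss" by auto
    \<comment> \<open>The exponential is 1-Lipschitz on the imaginary axis, so L1 closeness of
      functionals passes to their characteristic functions.\<close>
    have lip: "cmod (iexp x - iexp y) \<le> \<bar>x - y\<bar>" for x y :: real
    proof -
      have "iexp x - iexp y = iexp y * (iexp (x - y) - 1)"
        by (simp add: right_diff_distrib exp_add[symmetric])
      then have "cmod (iexp x - iexp y) = cmod (iexp (x - y) - 1)" by (simp add: norm_mult)
      also have "\<dots> \<le> \<bar>x - y\<bar>" using iexp_approx1[of "x - y" 0] by simp
      finally show ?thesis .
    qed
    have i1: "integrable gauss (\<lambda>\<omega>. iexp (X \<omega>))" "integrable gauss (\<lambda>\<omega>. iexp (?S \<omega>))"
      by (auto intro!: gauss.integrable_const_bound[where B=1])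
    have "cmod ((\<integral>\<omega>. iexp (X \<omega>) \<partial>gauss) - complex_of_real (exp (- (\<Sum>p\<in>E. (a p)\<^sup>2) / 2)))
       = cmod (\<integral>\<omega>. iexp (X \<omega>) - iexp (?S \<omega>) \<partial>gauss)"
      unfolding gauss_sum_char[OF E(1), symmetric]
      using Bochner_Integration.integral_diff[OF i1] by simp
    also have "\<dots> \<le> (\<integral>\<omega>. cmod (iexp (X \<omega>) - iexp (?S \<omega>)) \<partial>gauss)" by (rule integral_norm_bound)
    also have "\<dots> \<le> (\<integral>\<omega>. \<bar>X \<omega> - ?S \<omega>\<bar> \<partial>gauss)"
      using i1 X S lip by (intro integral_mono integrable_norm integrable_abs Bochner_Integration.integrable_diff)
    also have "\<dots> < e" using E0(2)[OF E] .
    finally show ?thesis .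
  qed
  then show ?thesis using E0(1) by blast
qed

text \<open>Further coordinates only add variance, so they only lower the Gaussian factor. An upper
  bound can thus be read off from a finite part of the coefficients, which makes the small-ball
  estimate finite-dimensional.\<close>

lemma gauss_lin_char_le:
  assumes "gauss_lin a X" "finite E1"
  shows "cmod (\<integral>\<omega>. iexp (X \<omega>) \<partial>gauss) \<le> exp (- (\<Sum>p\<in>E1. (a p)\<^sup>2) / 2)"
proof (rule field_le_epsilon)
  fix e :: real assume "e > 0"
  then obtain E0 where E0: "finite E0" "\<And>E. finite E \<Longrightarrow> E0 \<subseteq> E \<Longrightarrow>
    cmod ((\<integral>\<omega>. iexp (X \<omega>) \<partial>gauss) - complex_of_real (exp (- (\<Sum>p\<in>E. (a p)\<^sup>2) / 2))) < e"
    using gauss_lin_char_approx[OF assms(1), of e] by blast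
  let ?r = "exp (- (\<Sum>p\<in>E0 \<union> E1. (a p)\<^sup>2) / 2)"
  have "cmod (\<integral>\<omega>. iexp (X \<omega>) \<partial>gauss) \<le> cmod ((\<integral>\<omega>. iexp (X \<omega>) \<partial>gauss) - complex_of_real ?r) + cmod (complex_of_real ?r)"
    using norm_triangle_ineq[of "(\<integral>\<omega>. iexp (X \<omega>) \<partial>gauss) - complex_of_real ?r" "complex_of_real ?r"] by simp
  also have "\<dots> \<le> e + ?r" using E0(2)[of "E0 \<union> E1"] E0(1) assms(2) by simp
  also have "?r \<le> exp (- (\<Sum>p\<in>E1. (a p)\<^sup>2) / 2)"
    using E0(1) assms(2) by (auto intro!: sum_mono2)
  finally show "cmod (\<integral>\<omega>. iexp (X \<omega>) \<partial>gauss) \<le> exp (- (\<Sum>p\<in>E1. (a p)\<^sup>2) / 2) + e" by simp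
qed

lemma gauss_lin_char:
  assumes "gauss_lin a X" "((\<lambda>p. (a p)\<^sup>2) has_sum s) UNIV"
  shows "(\<integral>\<omega>. iexp (X \<omega>) \<partial>gauss) = complex_of_real (exp (- s / 2))"
proof (rule tendsto_unique)
  show "(finite_subsets_at_top (UNIV :: 'a set)) \<noteq> bot" by simp
  show "((\<lambda>E. complex_of_real (exp (- (\<Sum>p\<in>E. (a p)\<^sup>2) / 2))) \<longlongrightarrow> complex_of_real (exp (- s / 2))) (finite_subsets_at_top UNIV)"
    using assms(2) unfolding has_sum_def by (intro tendsto_intros) auto
  show "((\<lambda>E. complex_of_real (exp (- (\<Sum>p\<in>E. (a p)\<^sup>2) / 2))) \<longlongrightarrow> (\<integral>\<omega>. iexp (X \<omega>) \<partial>gauss)) (finite_subsets_at_top UNIV)"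
  proof (rule tendstoI)
    fix e :: real assume "e > 0"
    then obtain E\<^sub>0 where "finite E\<^sub>0" "\<forall>E. finite E \<longrightarrow> E\<^sub>0 \<subseteq> E \<longrightarrow>
        cmod ((\<integral>\<omega>. iexp (X \<omega>) \<partial>gauss) - complex_of_real (exp (- (\<Sum>p\<in>E. (a p)\<^sup>2) / 2))) < e"
      using gauss_lin_char_approx[OF assms(1), of e] by blast
    then show "\<forall>\<^sub>F E in finite_subsets_at_top UNIV.
      dist (complex_of_real (exp (- (\<Sum>p\<in>E. (a p)\<^sup>2) / 2))) (\<integral>\<omega>. iexp (X \<omega>) \<partial>gauss) < e"
      unfolding eventually_finite_subsets_at_top dist_norm
      by (intro exI[of _ E\<^sub>0]) (simp add: norm_minus_commute)
  qed
qed

text \<open>Partial sums over finite sets with small l2 tail are Cauchy in L1. An almost surely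
  convergent subsequence defines the limit, and Fatou's lemma turns the Cauchy estimate into one
  against every large finite set, as \<open>gauss_lin\<close> requires.\<close>

lemma gauss_lin_exists:
  fixes a :: "'i \<Rightarrow> real"
  assumes s: "((\<lambda>p. (a p)\<^sup>2) has_sum s) UNIV"
  shows "\<exists>X. gauss_lin a X"
proof -
  have le: "(\<Sum>p\<in>F. (a p)\<^sup>2) \<le> s" if "finite F" for F
    by (rule finite_sum_le_has_sum[OF s that]) auto
  have "\<exists>E. finite E \<and> s - (\<Sum>p\<in>E. (a p)\<^sup>2) < e" if e: "e > 0" for e
  proof -
    obtain E where "finite E" "dist (\<Sum>p\<in>E. (a p)\<^sup>2) s < e"
      using tendstoD[OF s[unfolded has_sum_def] e] unfolding eventually_finite_subsets_at_top by auto
    then show ?thesis by (intro exI[of _ E]) (auto simp: dist_real_def)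
  qed
  then have "\<exists>E. finite E \<and> s - (\<Sum>p\<in>E. (a p)\<^sup>2) < 1 / (real n + 1)" for n by auto
  then obtain E where E: "\<And>n. finite (E n)" "\<And>n. s - (\<Sum>p\<in>E n. (a p)\<^sup>2) < 1 / (real n + 1)" by metis
  define S where "S F \<omega> = (\<Sum>p\<in>F. a p * \<omega> p)" for F and \<omega> :: "'i \<Rightarrow> real"
  have S_int: "integrable gauss (S F)" for F unfolding S_def by (rule integrable_gauss_sum)
  have [measurable]: "S F \<in> borel_measurable gauss" for F using S_int by auto
  have close: "(\<integral>\<omega>. \<bar>S F \<omega> - S F' \<omega>\<bar> \<partial>gauss) \<le> sqrt (2 * e)"
    if F: "finite F" "finite F'" "s - (\<Sum>p\<in>F. (a p)\<^sup>2) \<le> e" "s - (\<Sum>p\<in>F'. (a p)\<^sup>2) \<le> e" for F F' e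
  proof -
    let ?b = "\<lambda>p. (if p \<in> F then a p else 0) - (if p \<in> F' then a p else 0)"
    have "S F \<omega> - S F' \<omega> = (\<Sum>p\<in>F \<union> F'. ?b p * \<omega> p)" for \<omega>
    proof -
      have "S F \<omega> = (\<Sum>p\<in>F \<union> F'. (if p \<in> F then a p else 0) * \<omega> p)"
        unfolding S_def using F by (intro sum.mono_neutral_cong_left) auto
      moreover have "S F' \<omega> = (\<Sum>p\<in>F \<union> F'. (if p \<in> F' then a p else 0) * \<omega> p)"
        unfolding S_def using F by (intro sum.mono_neutral_cong_left) auto
      ultimately show ?thesis by (simp add: left_diff_distrib sum_subtractf)
    qed
    then have "(\<integral>\<omega>. \<bar>S F \<omega> - S F' \<omega>\<bar> \<partial>gauss) \<le> sqrt (\<Sum>p\<in>F \<union> F'. (?b p)\<^sup>2)"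
      using gauss_sum_L1[of "F \<union> F'" ?b] F by simp
    also have "(\<Sum>p\<in>F \<union> F'. (?b p)\<^sup>2) \<le> 2 * e"
    proof -
      \<comment> \<open>Coefficients cancel on the intersection of F and \<open>F'\<close> and
        survive on the symmetric difference; writing their squares in this form compares the sum
        with the two tails.\<close>
      have "(\<Sum>p\<in>F \<union> F'. (?b p)\<^sup>2) \<le> (\<Sum>p\<in>F \<union> F'. (2 * (a p)\<^sup>2 - (if p \<in> F then (a p)\<^sup>2 else 0) - (if p \<in> F' then (a p)\<^sup>2 else 0)))"
        by (intro sum_mono) (auto simp: power2_eq_square)
      also have "\<dots> = 2 * (\<Sum>p\<in>F \<union> F'. (a p)\<^sup>2) - (\<Sum>p\<in>F. (a p)\<^sup>2) - (\<Sum>p\<in>F'. (a p)\<^sup>2)"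
      proof -
        have "(\<Sum>p\<in>F \<union> F'. if p \<in> F then (a p)\<^sup>2 else 0) = (\<Sum>p\<in>F. (a p)\<^sup>2)"
          "(\<Sum>p\<in>F \<union> F'. if p \<in> F' then (a p)\<^sup>2 else 0) = (\<Sum>p\<in>F'. (a p)\<^sup>2)"
          using F by (auto intro!: sum.mono_neutral_cong_right)
        then show ?thesis by (simp add: sum_subtractf sum_distrib_left)
      qed
      finally show ?thesis using F(3,4) le[of "F \<union> F'"] F(1,2) by auto
    qed
    finally show ?thesis by simp
  qed
  obtain r where r: "strict_mono r" "AE \<omega> in gauss. Cauchy (\<lambda>i. S (E (r i)) \<omega>)"
  proof (rule cauchy_L1_AE_cauchy_subseq[of gauss "\<lambda>n. S (E n)"])
    fix e :: real assume e: "e > 0"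
    obtain N where N: "2 / e\<^sup>2 < real N" using reals_Archimedean2 by blast
    have "(\<integral>\<omega>. norm (S (E i) \<omega> - S (E j) \<omega>) \<partial>gauss) < e" if "i \<ge> N" "j \<ge> N" for i j
    proof -
      have *: "s - (\<Sum>p\<in>E i. (a p)\<^sup>2) \<le> 1 / (real N + 1)" if "N \<le> i" for i
      proof -
        have "1 / (real i + 1) \<le> 1 / (real N + 1)" using that by (intro divide_left_mono) auto
        then show ?thesis using E(2)[of i] by linarith
      qed
      have "(\<integral>\<omega>. norm (S (E i) \<omega> - S (E j) \<omega>) \<partial>gauss) \<le> sqrt (2 * (1 / (real N + 1)))"
        using close[OF E(1)[of i] E(1)[of j] *[OF that(1)] *[OF that(2)]] by simp
      also have "\<dots> < sqrt (e\<^sup>2)"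
      proof -
        have "2 < real N * e\<^sup>2" using N e by (simp add: field_simps)
        also have "\<dots> \<le> (real N + 1) * e\<^sup>2" by (simp add: distrib_right)
        finally have "2 * (1 / (real N + 1)) < e\<^sup>2" by (simp add: field_simps)
        then show ?thesis by (rule real_sqrt_less_mono)
      qed
      finally show ?thesis using e by simp
    qed
    then show "\<exists>N. \<forall>i\<ge>N. \<forall>j\<ge>N. (\<integral>\<omega>. norm (S (E i) \<omega> - S (E j) \<omega>) \<partial>gauss) < e" by blast
  qed (use S_int in auto)
  define X where "X \<omega> = lim (\<lambda>i. S (E (r i)) \<omega>)" for \<omega>
  have [measurable]: "X \<in> borel_measurable gauss" unfolding X_def by measurable
  have lim: "AE \<omega> in gauss. (\<lambda>i. S (E (r i)) \<omega>) \<longlonglongrightarrow> X \<omega>"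
    using r(2) by eventually_elim (auto simp: X_def Cauchy_convergent_iff convergent_LIMSEQ_iff)
  have XS: "(\<integral>\<^sup>+\<omega>. ennreal \<bar>X \<omega> - S F \<omega>\<bar> \<partial>gauss) \<le> ennreal (sqrt (2 * e))"
    if F: "finite F" "s - (\<Sum>p\<in>F. (a p)\<^sup>2) \<le> e" "e > 0" for F e
  proof -
    have "(\<integral>\<^sup>+\<omega>. ennreal \<bar>X \<omega> - S F \<omega>\<bar> \<partial>gauss) = (\<integral>\<^sup>+\<omega>. liminf (\<lambda>i. ennreal \<bar>S (E (r i)) \<omega> - S F \<omega>\<bar>) \<partial>gauss)"
    proof (intro nn_integral_cong_AE)
      show "AE \<omega> in gauss. ennreal \<bar>X \<omega> - S F \<omega>\<bar> = liminf (\<lambda>i. ennreal \<bar>S (E (r i)) \<omega> - S F \<omega>\<bar>)"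
        using lim
      proof eventually_elim
        case (elim \<omega>)
        then have "(\<lambda>i. ennreal \<bar>S (E (r i)) \<omega> - S F \<omega>\<bar>) \<longlonglongrightarrow> ennreal \<bar>X \<omega> - S F \<omega>\<bar>"
          by (intro tendsto_intros)
        then show ?case by (rule lim_imp_Liminf[OF sequentially_bot, symmetric])
      qed
    qed
    also have "\<dots> \<le> liminf (\<lambda>i. \<integral>\<^sup>+\<omega>. ennreal \<bar>S (E (r i)) \<omega> - S F \<omega>\<bar> \<partial>gauss)"
      by (intro nn_integral_liminf) auto
    also have "\<dots> \<le> limsup (\<lambda>i. \<integral>\<^sup>+\<omega>. ennreal \<bar>S (E (r i)) \<omega> - S F \<omega>\<bar> \<partial>gauss)"
      by (intro Liminf_le_Limsup) auto
    also have "\<dots> \<le> ennreal (sqrt (2 * e))"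
    proof (intro Limsup_bounded)
      obtain N where N: "1 / e < real N" using reals_Archimedean2 by blast
      show "\<forall>\<^sub>F i in sequentially. (\<integral>\<^sup>+\<omega>. ennreal \<bar>S (E (r i)) \<omega> - S F \<omega>\<bar> \<partial>gauss) \<le> ennreal (sqrt (2 * e))"
        using eventually_ge_at_top[of N]
      proof eventually_elim
        case (elim i)
        have "N \<le> r i" using elim seq_suble[OF r(1), of i] by linarith
        then have "1 / e \<le> real (r i) + 1" using N by linarith
        then have "1 / (real (r i) + 1) \<le> e" using F(3) by (simp add: field_simps)
        then have "s - (\<Sum>p\<in>E (r i). (a p)\<^sup>2) \<le> e" using E(2)[of "r i"] by linarith
        then have "(\<integral>\<omega>. \<bar>S (E (r i)) \<omega> - S F \<omega>\<bar> \<partial>gauss) \<le> sqrt (2 * e)"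
          using close E(1) F by blast
        moreover have "(\<integral>\<^sup>+\<omega>. ennreal \<bar>S (E (r i)) \<omega> - S F \<omega>\<bar> \<partial>gauss) = ennreal (\<integral>\<omega>. \<bar>S (E (r i)) \<omega> - S F \<omega>\<bar> \<partial>gauss)"
          using S_int by (intro nn_integral_eq_integral) auto
        ultimately show ?case by (simp add: ennreal_leI)
      qed
    qed
    finally show ?thesis .
  qed
  have XSi: "integrable gauss (\<lambda>\<omega>. X \<omega> - S F \<omega>)" "(\<integral>\<omega>. \<bar>X \<omega> - S F \<omega>\<bar> \<partial>gauss) \<le> sqrt (2 * e)"
    if F: "finite F" "s - (\<Sum>p\<in>F. (a p)\<^sup>2) \<le> e" "e > 0" for F e
  proof -
    show i: "integrable gauss (\<lambda>\<omega>. X \<omega> - S F \<omega>)"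
      using XS[OF F] by (intro integrableI_bounded) (auto simp: less_top[symmetric] top_unique)
    have "(\<integral>\<^sup>+\<omega>. ennreal \<bar>X \<omega> - S F \<omega>\<bar> \<partial>gauss) = ennreal (\<integral>\<omega>. \<bar>X \<omega> - S F \<omega>\<bar> \<partial>gauss)"
      using i by (intro nn_integral_eq_integral) auto
    then show "(\<integral>\<omega>. \<bar>X \<omega> - S F \<omega>\<bar> \<partial>gauss) \<le> sqrt (2 * e)" using XS[OF F] F(3) by simp
  qed
  have "gauss_lin a X"
    unfolding gauss_lin_def
  proof (intro conjI allI impI)
    have "integrable gauss (\<lambda>\<omega>. X \<omega> - S {} \<omega>)"
      by (rule XSi(1)[of _ "\<bar>s\<bar> + 1"]) auto
    then show "integrable gauss X" by (simp add: S_def)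
    fix e :: real assume e: "e > 0"
    \<comment> \<open>A tail of at most \<open>e^2 / 8\<close> gives an L1 error of at most
      \<open>sqrt (2 * (e^2 / 8))\<close>, which is e/2 and hence strictly below e.\<close>
    then have "0 < e\<^sup>2 / 8" by simp
    then obtain N where N: "1 / (e\<^sup>2 / 8) < real N" using reals_Archimedean2 by blast
    show "\<exists>E\<^sub>0. finite E\<^sub>0 \<and> (\<forall>E. finite E \<longrightarrow> E\<^sub>0 \<subseteq> E \<longrightarrow> (\<integral>\<omega>. \<bar>X \<omega> - (\<Sum>p\<in>E. a p * \<omega> p)\<bar> \<partial>gauss) < e)"
    proof (intro exI[of _ "E N"] conjI allI impI)
      fix F assume F: "finite F" "E N \<subseteq> F"
      have "(\<Sum>p\<in>E N. (a p)\<^sup>2) \<le> (\<Sum>p\<in>F. (a p)\<^sup>2)" using F by (intro sum_mono2) auto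
      moreover have "1 / (real N + 1) \<le> e\<^sup>2 / 8"
      proof -
        have "1 / (e\<^sup>2 / 8) \<le> real N + 1" using N by linarith
        then show ?thesis using \<open>0 < e\<^sup>2 / 8\<close> by (simp add: field_simps)
      qed
      ultimately have "s - (\<Sum>p\<in>F. (a p)\<^sup>2) \<le> e\<^sup>2 / 8" using E(2)[of N] by linarith
      then have "(\<integral>\<omega>. \<bar>X \<omega> - S F \<omega>\<bar> \<partial>gauss) \<le> sqrt (2 * (e\<^sup>2 / 8))"
        using F \<open>0 < e\<^sup>2 / 8\<close> by (intro XSi(2)) auto
      also have "2 * (e\<^sup>2 / 8) = (e / 2)\<^sup>2" by (simp add: power2_eq_square)
      also have "sqrt ((e / 2)\<^sup>2) < e" using e by simp
      finally show "(\<integral>\<omega>. \<bar>X \<omega> - (\<Sum>p\<in>F. a p * \<omega> p)\<bar> \<partial>gauss) < e" by (simp add: S_def)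
    qed (use E in auto)
  qed
  then show ?thesis by blast
qed

section \<open>The Gaussian action as a factor of a Gaussian Bernoulli shift\<close>

text \<open>Modulo null sets a standard Borel coordinate is a Borel function of the \<open>u j\<close>, which rebuilds
  points from their \<open>u\<close>-coordinates; equal Fourier coefficients force \<open>u\<close> and \<open>U\<close> to have the same
  law, so that the same function carries \<open>N\<close> to \<open>M\<close>.\<close>
lemma reconstruction_map:
  fixes M :: "'x measure" and u :: "nat \<Rightarrow> 'x \<Rightarrow> complex" and U :: "'w \<Rightarrow> nat \<Rightarrow> complex"
  assumes M: "prob_space M" and N: "prob_space N"
    and B: "B \<in> sets (borel :: real measure)" and f: "bij_betw f (space M) B"
      "f \<in> M \<rightarrow>\<^sub>M restrict_space borel B" "the_inv_into (space M) f \<in> restrict_space borel B \<rightarrow>\<^sub>M M"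
    and gen: "\<And>q::rat. \<exists>C\<in>sigma_sets (space M) {u j -` V \<inter> space M | j V. V \<in> sets borel}.
        emeasure M (symdiff {x\<in>space M. f x \<le> of_rat q} C) = 0"
    and u [measurable]: "\<And>j. u j \<in> borel_measurable M" and u1: "\<And>j. AE x in M. cmod (u j x) = 1"
    and U [measurable]: "\<And>j. (\<lambda>\<omega>. U \<omega> j) \<in> borel_measurable N" and U1: "\<And>j. AE \<omega> in N. cmod (U \<omega> j) = 1"
    and eq: "\<And>a b L. (\<integral>x. torus_monomial a b L (\<lambda>j. u j x) \<partial>M) = (\<integral>\<omega>. torus_monomial a b L (U \<omega>) \<partial>N)"
  shows "\<exists>F. F \<in> borel \<rightarrow>\<^sub>M M \<and> (AE x in M. F (\<lambda>j. u j x) = x) \<and>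
    distr N M (\<lambda>\<omega>. F (U \<omega>)) = M \<and> (\<forall>j. AE \<omega> in N. u j (F (U \<omega>)) = U \<omega> j)"
proof -
  interpret M: prob_space M by fact
  interpret N: prob_space N by fact
  define uu where "uu x = (\<lambda>j. u j x)" for x
  have uu [measurable]: "uu \<in> borel_measurable M"
    unfolding uu_def by (intro measurable_coordinatewise_then_product u)
  have U' [measurable]: "U \<in> borel_measurable N"
    by (intro measurable_coordinatewise_then_product U)
  \<comment> \<open>Up to a null set, each rational cut of the real coordinate f is decided by the
    sequence of values \<open>u j\<close>, that is, by a Borel subset of the sequence space.\<close>
  have "\<exists>C\<in>sets borel. emeasure M (symdiff {x\<in>space M. f x \<le> of_rat q} (uu -` C \<inter> space M)) = 0" for q
  proof -
    obtain C where C: "C \<in> sigma_sets (space M) {u j -` V \<inter> space M | j V. V \<in> sets borel}"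
      "emeasure M (symdiff {x\<in>space M. f x \<le> of_rat q} C) = 0" using gen by blast
    have "u j -` V \<inter> space M \<in> sets (vimage_algebra (space M) uu borel)" if "V \<in> sets borel" for j V
    proof -
      have "(\<lambda>z :: nat \<Rightarrow> complex. z j) -` V \<inter> space borel \<in> sets borel"
        using that borel_measurable_continuous_onI[OF continuous_on_product_coordinates]
        by (rule measurable_sets[rotated])
      then have "uu -` ((\<lambda>z. z j) -` V \<inter> space borel) \<inter> space M \<in> sets (vimage_algebra (space M) uu borel)"
        by (rule in_vimage_algebra)
      then show ?thesis by (simp add: uu_def vimage_def)
    qed
    then have "sigma_sets (space (vimage_algebra (space M) uu borel)) {u j -` V \<inter> space M | j V. V \<in> sets borel}
        \<subseteq> sets (vimage_algebra (space M) uu borel)"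
      by (intro sets.sigma_sets_subset) auto
    then have "C \<in> sets (vimage_algebra (space M) uu borel)" using C(1) by auto
    then show ?thesis using C(2) by (auto simp: sets_vimage_algebra2)
  qed
  then obtain C where C [measurable]: "\<And>q. C q \<in> sets borel"
    and C0: "\<And>q. emeasure M (symdiff {x\<in>space M. f x \<le> of_rat q} (uu -` C q \<inter> space M)) = 0" by metis
  have fB: "f x \<in> B" if "x \<in> space M" for x using f(1) that by (auto simp: bij_betw_def)
  have [measurable]: "f \<in> borel_measurable M"
    using f(2) by (simp add: measurable_restrict_space2_iff)
  have AE_C: "AE x in M. \<forall>q. f x \<le> of_rat q \<longleftrightarrow> uu x \<in> C q"
  proof (subst AE_all_countable, intro allI)
    fix q
    have "symdiff {x\<in>space M. f x \<le> of_rat q} (uu -` C q \<inter> space M) \<in> sets M"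
      unfolding symdiff_def by measurable
    then have "symdiff {x\<in>space M. f x \<le> of_rat q} (uu -` C q \<inter> space M) \<in> null_sets M"
      using C0 by auto
    then show "AE x in M. f x \<le> of_rat q \<longleftrightarrow> uu x \<in> C q"
      by (rule AE_I') (auto simp: symdiff_def)
  qed
  \<comment> \<open>The infimum of the rationals whose cut contains z recovers f. Where the cuts are
    inconsistent, which happens only on a null set, the value is arbitrary, an infinite infimum
    becoming 0.\<close>
  define F0 where "F0 z = real_of_ereal (INF q. if z \<in> C q then ereal (of_rat q) else \<infinity>)" for z
  have F0 [measurable]: "F0 \<in> borel_measurable borel"
    unfolding F0_def by measurable
  have F0f: "AE x in M. F0 (uu x) = f x"
    using AE_C
  proof eventually_elim
    case (elim x)
    have "(INF q. if uu x \<in> C q then ereal (of_rat q) else \<infinity>) = ereal (f x)"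
    proof (rule INF_eqI)
      fix q :: rat
      show "ereal (f x) \<le> (if uu x \<in> C q then ereal (of_rat q) else \<infinity>)"
        using elim by auto
    next
      fix y assume y: "\<And>q::rat. q \<in> UNIV \<Longrightarrow> y \<le> (if uu x \<in> C q then ereal (of_rat q) else \<infinity>)"
      show "y \<le> ereal (f x)"
      proof (rule ccontr)
        assume "\<not> y \<le> ereal (f x)"
        then obtain r where r: "ereal (f x) < ereal r" "ereal r < y"
          using ereal_dense2[of "ereal (f x)" y] by (auto simp: not_le)
        then obtain q where q: "f x < of_rat q" "of_rat q < r" using of_rat_dense[of "f x" r] by auto
        then have "uu x \<in> C q" using elim less_imp_le[OF q(1)] by blast
        then have "y \<le> ereal (of_rat q)" using y[of q] by simp
        then have "ereal r < ereal (of_rat q)" using r(2) by (rule less_le_trans[rotated])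
        then show False using q(2) by simp
      qed
    qed
    then show ?case by (simp add: F0_def)
  qed
  obtain x0 where x0: "x0 \<in> space M" using M.not_empty by blast
  \<comment> \<open>Values outside B have no preimage under f; sending them to a fixed point
    \<open>x0\<close> makes F a measurable map into M.\<close>
  define F where "F z = (if F0 z \<in> B then the_inv_into (space M) f (F0 z) else x0)" for z
  have F [measurable]: "F \<in> borel \<rightarrow>\<^sub>M M"
    unfolding F_def
  proof (subst measurable_If_restrict_space_iff)
    show "{x \<in> space borel. F0 x \<in> B} \<in> sets borel" using B by measurable
    have "F0 \<in> restrict_space borel {x. F0 x \<in> B} \<rightarrow>\<^sub>M restrict_space borel B"
      by (intro measurable_restrict_space3 F0) auto
    then have "(\<lambda>z. the_inv_into (space M) f (F0 z)) \<in> restrict_space borel {x. F0 x \<in> B} \<rightarrow>\<^sub>M M"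
      using f(3) by (rule measurable_compose)
    then show "(\<lambda>z. the_inv_into (space M) f (F0 z)) \<in> restrict_space borel {x. F0 x \<in> B} \<rightarrow>\<^sub>M M \<and>
      (\<lambda>z. x0) \<in> restrict_space borel {x. F0 x \<notin> B} \<rightarrow>\<^sub>M M" using x0 by simp
  qed
  have Fuu: "AE x in M. F (uu x) = x"
    using F0f AE_space
  proof eventually_elim
    case (elim x)
    then show ?case using f(1) by (auto simp: F_def fB bij_betw_def the_inv_into_f_f)
  qed
  have law: "distr M borel uu = distr N borel U"
  proof (rule torus_measure_eq)
    show "prob_space (distr M borel uu)" "prob_space (distr N borel U)"
      by (auto intro!: M.prob_space_distr N.prob_space_distr)
    have meas: "{z \<in> space borel. \<forall>j. cmod (z j :: complex) = 1} \<in> sets (borel :: (nat \<Rightarrow> complex) measure)"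
    proof -
      have [measurable]: "(\<lambda>z :: nat \<Rightarrow> complex. z j) \<in> borel_measurable borel" for j
        by (rule borel_measurable_continuous_onI[OF continuous_on_product_coordinates])
      show ?thesis by measurable
    qed
    show "AE z in distr M borel uu. \<forall>j. cmod (z j) = 1"
      using u1 by (subst AE_distr_iff[OF uu meas]) (simp add: uu_def AE_all_countable)
    show "AE z in distr N borel U. \<forall>j. cmod (z j) = 1"
      using U1 by (subst AE_distr_iff[OF U' meas]) (simp add: AE_all_countable)
    fix a b L
    have [measurable]: "torus_monomial a b L \<in> borel_measurable borel"
      by (rule borel_measurable_continuous_onI[OF continuous_torus_monomial])
    show "integral\<^sup>L (distr M borel uu) (torus_monomial a b L) = integral\<^sup>L (distr N borel U) (torus_monomial a b L)"
      using eq[of a b L] by (simp add: integral_distr) (simp add: uu_def)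
  qed simp_all
  have "distr N M (\<lambda>\<omega>. F (U \<omega>)) = distr (distr N borel U) M F"
    by (subst distr_distr) (auto simp: comp_def)
  also have "\<dots> = distr (distr M borel uu) M F" by (simp only: law)
  also have "\<dots> = distr M M (\<lambda>x. F (uu x))"
    by (subst distr_distr) (auto simp: comp_def)
  also have "\<dots> = distr M M (\<lambda>x. x)"
    using Fuu by (intro distr_cong_AE) auto
  finally have "distr N M (\<lambda>\<omega>. F (U \<omega>)) = M" by simp
  moreover have "AE \<omega> in N. u j (F (U \<omega>)) = U \<omega> j" for j
  proof -
    have "AE x in M. u j (F (uu x)) = uu x j"
      using Fuu by eventually_elim (simp add: uu_def)
    moreover have [measurable]: "(\<lambda>z :: nat \<Rightarrow> complex. z j) \<in> borel_measurable borel"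
      by (rule borel_measurable_continuous_onI[OF continuous_on_product_coordinates])
    have "{z \<in> space borel. u j (F z) = z j} \<in> sets borel" by measurable
    ultimately have "AE z in distr M borel uu. u j (F z) = z j"
      by (subst AE_distr_iff) auto
    then have "AE z in distr N borel U. u j (F z) = z j" by (simp only: law)
    then show ?thesis by (rule AE_distrD[rotated]) simp
  qed
  ultimately show ?thesis using F Fuu unfolding uu_def by blast
qed

section \<open>Left translation of coordinates and the factor map\<close>

text \<open>Elements off the carrier stay in place, which makes this a bijection of the whole index
  type and so a symmetry of the Gaussian measure.\<close>

definition left_shift :: "'g monoid \<Rightarrow> 'g \<Rightarrow> nat \<times> 'g \<Rightarrow> nat \<times> 'g" where
  "left_shift G s = (\<lambda>(n, h). (n, if h \<in> carrier G then s \<otimes>\<^bsub>G\<^esub> h else h))"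

lemma bij_left_shift:
  assumes "group G" "s \<in> carrier G"
  shows "bij (left_shift G s)"
proof -
  interpret group G by fact
  show ?thesis
  proof (rule bijI)
    show "inj (left_shift G s)"
      using assms(2) by (auto simp: inj_on_def left_shift_def split: if_splits)
    show "surj (left_shift G s)"
    proof (rule surjI)
      fix p show "left_shift G s (left_shift G (inv\<^bsub>G\<^esub> s) p) = p"
        using assms(2) by (cases p) (auto simp: left_shift_def m_assoc[symmetric])
    qed
  qed
qed

text \<open>Modulus one makes conjugation the inverse, so a monomial in the \<open>u (e j)\<close>
  is the value of \<open>u\<close> at an integer combination of the \<open>e j\<close>.
  Multiplicativity holds almost surely for each pair of vectors and is invoked only finitely often
  here.\<close>

lemma unimodular_hom_combination:
  fixes u :: "'h::real_vector \<Rightarrow> 'x \<Rightarrow> complex"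
  assumes u1: "\<And>\<xi>. AE x in M. cmod (u \<xi> x) = 1"
    and hom: "\<And>\<xi> \<eta>. AE x in M. u (\<xi> + \<eta>) x = u \<xi> x * u \<eta> x"
  shows "AE x in M. torus_monomial a b L (\<lambda>j. u (e j) x) = u (\<Sum>j<L. (real (a j) - real (b j)) *\<^sub>R e j) x"
proof -
  have zero: "AE x in M. u 0 x = 1"
    using hom[of 0 0] u1[of 0] by eventually_elim auto
  have neg: "AE x in M. u (- \<xi>) x = cnj (u \<xi> x)" for \<xi>
    using hom[of \<xi> "- \<xi>"] u1[of \<xi>] zero
  proof eventually_elim
    case (elim x)
    then have "u \<xi> x * u (- \<xi>) x = u \<xi> x * cnj (u \<xi> x)" using complex_norm_square[of "u \<xi> x"] by simp
    then show ?case using elim by auto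
  qed
  have pow: "AE x in M. u (real n *\<^sub>R \<xi>) x = u \<xi> x ^ n" for n \<xi>
  proof (induction n)
    case (Suc n)
    then show ?case using hom[of \<xi> "real n *\<^sub>R \<xi>"]
      by eventually_elim (simp add: scaleR_add_left)
  qed (use zero in simp)
  show ?thesis
  proof (induction L)
    case 0
    then show ?case using zero by (simp add: torus_monomial_def)
  next
    case (Suc L)
    let ?S = "\<Sum>j<L. (real (a j) - real (b j)) *\<^sub>R e j"
    show ?case
      using Suc.IH pow[of "a L" "e L"] pow[of "b L" "- e L"] neg[of "e L"]
        hom[of "real (a L) *\<^sub>R e L" "real (b L) *\<^sub>R (- e L)"]
        hom[of ?S "real (a L) *\<^sub>R e L + real (b L) *\<^sub>R (- e L)"]
    proof eventually_elim
      case (elim x)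
      then show ?case
        by (simp add: torus_monomial_def scaleR_diff_left)
    qed
  qed
qed

text \<open>On integer combinations of vectors, \<open>u\<close> and the exponentials of the
  Gaussian functionals have equal means, so \<open>reconstruction_map\<close> applies to any
  countable family. The last property expresses that \<Theta> sees only coordinates over the group,
  all coefficients off the carrier being zero.\<close>

lemma gaussian_factor_map:
  fixes G :: "'g monoid" and \<rho> :: "'g \<Rightarrow> 'h::real_inner \<Rightarrow> 'h" and MX :: "'x measure" and \<xi> :: 'h
  assumes G: "group G" "countable (carrier G)" and rep: "orth_rep G \<rho>" and reg: "reg_subrep G \<rho>"
    and gauss: "gaussian_action G \<rho> MX TX"
  obtains u :: "'x \<Rightarrow> complex" and a :: "nat \<times> 'g \<Rightarrow> real" and W \<Theta> where
    "u \<in> borel_measurable MX" "gauss_lin a W"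
    "((\<lambda>p. (a p)\<^sup>2) has_sum (2 * pi * (norm \<xi>)\<^sup>2)) UNIV" "\<And>n h. h \<notin> carrier G \<Longrightarrow> a (n, h) = 0"
    "\<Theta> \<in> gauss \<rightarrow>\<^sub>M MX" "distr gauss MX \<Theta> = MX"
    "AE \<omega> in gauss. u (\<Theta> \<omega>) = iexp (W \<omega>)"
    "\<And>s. s \<in> carrier G \<Longrightarrow> AE \<omega> in gauss. \<Theta> (\<omega> \<circ> left_shift G s) = TX (inv\<^bsub>G\<^esub> s) (\<Theta> \<omega>)"
    "\<And>\<iota> \<iota>' :: nat \<times> 'g \<Rightarrow> nat \<times> nat \<times> 'g option. inj \<iota> \<Longrightarrow> inj \<iota>' \<Longrightarrow>
       (\<And>n h. h \<in> carrier G \<Longrightarrow> \<iota> (n, h) = \<iota>' (n, h)) \<Longrightarrow> AE \<omega> in gauss. \<Theta> (\<omega> \<circ> \<iota>) = \<Theta> (\<omega> \<circ> \<iota>')"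
proof -
  interpret G: group G by fact
  from gauss have pmp: "pmp_action G MX TX" and std: "standard_prob_space MX" by (auto simp: gaussian_action_def)
  from std interpret MX: prob_space MX by (simp add: standard_prob_space_def)
  from gauss obtain u :: "'h \<Rightarrow> 'x \<Rightarrow> complex" where
    um [measurable]: "\<And>\<xi>. u \<xi> \<in> borel_measurable MX" and u1: "\<And>\<xi>. AE x in MX. cmod (u \<xi> x) = 1"
    and hom: "\<And>\<xi>1 \<xi>2. AE x in MX. u (\<xi>1 + \<xi>2) x = u \<xi>1 x * u \<xi>2 x"
    and char: "\<And>\<xi>. integral\<^sup>L MX (u \<xi>) = complex_of_real (exp (- pi * (norm \<xi>)\<^sup>2))"
    and equi: "\<And>g \<xi>. g \<in> carrier G \<Longrightarrow> AE x in MX. u \<xi> (TX (inv\<^bsub>G\<^esub> g) x) = u (\<rho> g \<xi>) x"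
    and gen: "\<And>A. A \<in> sets MX \<Longrightarrow> \<exists>B\<in>sigma_sets (space MX) {u \<xi> -` U \<inter> space MX | \<xi> U. U \<in> sets borel}.
            emeasure MX (symdiff A B) = 0"
    unfolding gaussian_action_def by blast
  from std obtain B f where B: "B \<in> sets (borel :: real measure)" and f: "bij_betw f (space MX) B"
      "f \<in> MX \<rightarrow>\<^sub>M restrict_space borel B" "the_inv_into (space MX) f \<in> restrict_space borel B \<rightarrow>\<^sub>M MX"
    unfolding standard_prob_space_def standard_borel_def by blast
  have [measurable]: "f \<in> borel_measurable MX"
    using f(2) by (simp add: measurable_restrict_space2_iff)
  define R where "R q D C \<longleftrightarrow> countable D \<and>
      C \<in> sigma_sets (space MX) {u \<xi> -` V \<inter> space MX | \<xi> V. \<xi> \<in> D \<and> V \<in> sets borel} \<and>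
      emeasure MX (symdiff {x\<in>space MX. f x \<le> of_rat q} C) = 0" for q D C
  have "\<exists>D C. R q D C" for q
  proof -
    have "{x\<in>space MX. f x \<le> of_rat q} \<in> sets MX" by measurable
    then obtain C where C: "C \<in> sigma_sets (space MX) {u \<xi> -` U \<inter> space MX | \<xi> U. U \<in> sets borel}"
      "emeasure MX (symdiff {x\<in>space MX. f x \<le> of_rat q} C) = 0" using gen by blast
    \<comment> \<open>A member of a generated \<sigma>-algebra uses only countably many generators,
      so countably many vectors decide each rational cut although \<open>u\<close> is indexed by the
      whole Hilbert space.\<close>
    from sigma_sets_countable_generators[OF C(1)] obtain \<G> where \<G>:
      "\<G> \<subseteq> {u \<xi> -` U \<inter> space MX | \<xi> U. U \<in> sets borel}" "countable \<G>" "C \<in> sigma_sets (space MX) \<G>" by blast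
    then have "\<forall>g\<in>\<G>. \<exists>\<xi>. \<exists>V\<in>sets borel. g = u \<xi> -` V \<inter> space MX" by blast
    then obtain k where k: "\<And>g. g \<in> \<G> \<Longrightarrow> \<exists>V\<in>sets borel. g = u (k g) -` V \<inter> space MX" by metis
    have "\<G> \<subseteq> {u \<xi> -` V \<inter> space MX | \<xi> V. \<xi> \<in> k ` \<G> \<and> V \<in> sets borel}"
    proof
      fix g assume "g \<in> \<G>"
      with k[OF this] show "g \<in> {u \<xi> -` V \<inter> space MX | \<xi> V. \<xi> \<in> k ` \<G> \<and> V \<in> sets borel}"
        by (elim bexE) (intro CollectI exI conjI; assumption?; rule imageI)
    qed
    then have "C \<in> sigma_sets (space MX) {u \<xi> -` V \<inter> space MX | \<xi> V. \<xi> \<in> k ` \<G> \<and> V \<in> sets borel}"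
      using \<G>(3) by (rule sigma_sets_mono'[THEN subsetD])
    then show ?thesis using \<G>(2) C(2) unfolding R_def
      by (intro exI[of _ "k ` \<G>"] exI[of _ C] conjI countable_image)
  qed
  then obtain D C where R: "\<And>q. R q (D q) (C q)" by metis
  have D: "\<And>q. countable (D q)"
    and DC: "\<And>q. C q \<in> sigma_sets (space MX) {u \<xi> -` V \<inter> space MX | \<xi> V. \<xi> \<in> D q \<and> V \<in> sets borel}"
    and Dnull: "\<And>q. emeasure MX (symdiff {x\<in>space MX. f x \<le> of_rat q} (C q)) = 0"
    using R unfolding R_def by blast+
  \<comment> \<open>Closing the countable family under \<rho> lets a shifted point and its image
    under \<open>TX\<close> be compared coordinate by coordinate.\<close>
  define E where "E = (\<Union>g\<in>carrier G. \<rho> g ` insert \<xi> (\<Union>q. D q))"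
  have "countable E" unfolding E_def using G D by (intro countable_UN countable_image) auto
  have \<rho>1: "\<rho> \<one>\<^bsub>G\<^esub> = id" and \<rho>mult: "\<And>g h. g \<in> carrier G \<Longrightarrow> h \<in> carrier G \<Longrightarrow> \<rho> (g \<otimes>\<^bsub>G\<^esub> h) = \<rho> g \<circ> \<rho> h"
    using rep by (auto simp: orth_rep_def)
  have EI: "insert \<xi> (\<Union>q. D q) \<subseteq> E"
    unfolding E_def using \<rho>1 by (force intro!: bexI[of _ "\<one>\<^bsub>G\<^esub>"])
  have E\<rho>: "\<rho> g \<eta> \<in> E" if "g \<in> carrier G" "\<eta> \<in> E" for g \<eta>
  proof -
    from that(2) obtain h \<zeta> where h: "h \<in> carrier G" "\<zeta> \<in> insert \<xi> (\<Union>q. D q)" "\<eta> = \<rho> h \<zeta>"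
      unfolding E_def by blast
    have "\<rho> g \<eta> = \<rho> (g \<otimes>\<^bsub>G\<^esub> h) \<zeta>" using \<rho>mult[OF that(1) h(1)] h(3) by simp
    moreover have "g \<otimes>\<^bsub>G\<^esub> h \<in> carrier G" using that(1) h(1) by simp
    ultimately show ?thesis unfolding E_def using h(2) by blast
  qed
  define e where "e = from_nat_into E"
  have e: "range e = E" unfolding e_def using EI \<open>countable E\<close> by (intro range_from_nat_into) auto
  from reg obtain V :: "'h \<Rightarrow> nat \<times> 'g \<Rightarrow> real" where
    Vadd: "\<And>\<xi> \<eta> p. V (\<xi> + \<eta>) p = V \<xi> p + V \<eta> p" and Vscale: "\<And>c \<xi> p. V (c *\<^sub>R \<xi>) p = c * V \<xi> p"
    and V0: "\<And>\<xi> n h. h \<notin> carrier G \<Longrightarrow> V \<xi> (n, h) = 0"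
    and Vnorm: "\<And>\<xi>. ((\<lambda>p. (V \<xi> p)\<^sup>2) has_sum (norm \<xi>)\<^sup>2) UNIV"
    and Vequi: "\<And>g \<xi> n h. g \<in> carrier G \<Longrightarrow> h \<in> carrier G \<Longrightarrow> V (\<rho> g \<xi>) (n, h) = V \<xi> (n, inv\<^bsub>G\<^esub> g \<otimes>\<^bsub>G\<^esub> h)"
    unfolding reg_subrep_def by blast
  \<comment> \<open>The mean of \<open>iexp\<close> of a Gaussian functional is the exponential of
    minus half the squared l2 norm of its coefficients; the factor \<open>sqrt (2 * pi)\<close>
    turns this into the prescribed \<open>exp (- pi * (norm \<xi>)^2)\<close>.\<close>
  define a where "a \<xi> p = sqrt (2 * pi) * V \<xi> p" for \<xi> p
  have anorm: "((\<lambda>p. (a \<xi> p)\<^sup>2) has_sum (2 * pi * (norm \<xi>)\<^sup>2)) UNIV" for \<xi>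
    using has_sum_cmult_right[OF Vnorm[of \<xi>], of "2 * pi"] by (simp add: a_def power_mult_distrib)
  have "\<exists>X. gauss_lin (a \<xi>) X" for \<xi> using gauss_lin_exists[OF anorm] .
  then obtain W where W: "\<And>\<xi>. gauss_lin (a \<xi>) (W \<xi>)" by metis
  have [measurable]: "W \<xi> \<in> borel_measurable gauss" for \<xi> using W[of \<xi>] by (auto simp: gauss_lin_def)
  have V_sum: "V (\<Sum>j<L. c j *\<^sub>R e j) p = (\<Sum>j<L. c j * V (e j) p)" for c p and L :: nat
  proof (induction L)
    case 0
    then show ?case using Vscale[of 0 0 p] by simp
  qed (simp add: Vadd Vscale)
  define U where "U \<omega> j = iexp (W (e j) \<omega>)" for \<omega> j
  have "\<exists>F. F \<in> borel \<rightarrow>\<^sub>M MX \<and> (AE x in MX. F (\<lambda>j. u (e j) x) = x) \<and>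
    distr gauss MX (\<lambda>\<omega>. F (U \<omega>)) = MX \<and> (\<forall>j. AE \<omega> in gauss. u (e j) (F (U \<omega>)) = U \<omega> j)"
  proof (rule reconstruction_map)
    fix q
    have "{u \<xi> -` V \<inter> space MX | \<xi> V. \<xi> \<in> D q \<and> V \<in> sets borel} \<subseteq> {u (e j) -` V \<inter> space MX | j V. V \<in> sets borel}"
      using EI unfolding e[symmetric] by blast
    then have "C q \<in> sigma_sets (space MX) {u (e j) -` V \<inter> space MX | j V. V \<in> sets borel}"
      using DC[of q] by (rule sigma_sets_mono'[THEN subsetD])
    then show "\<exists>C\<in>sigma_sets (space MX) {u (e j) -` V \<inter> space MX | j V. V \<in> sets borel}.
        emeasure MX (symdiff {x\<in>space MX. f x \<le> of_rat q} C) = 0" using Dnull by blast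
  next
    fix a' b :: "nat \<Rightarrow> nat" and L :: nat
    let ?c = "\<lambda>j. real (a' j) - real (b j)"
    let ?\<xi> = "\<Sum>j<L. ?c j *\<^sub>R e j"
    have "(\<integral>x. torus_monomial a' b L (\<lambda>j. u (e j) x) \<partial>MX) = (\<integral>x. u ?\<xi> x \<partial>MX)"
    proof (rule integral_cong_AE)
      have "torus_monomial a' b L \<in> borel_measurable borel"
        by (rule borel_measurable_continuous_onI[OF continuous_torus_monomial])
      moreover have "(\<lambda>x j. u (e j) x) \<in> borel_measurable MX"
        by (intro measurable_coordinatewise_then_product um)
      ultimately show "(\<lambda>x. torus_monomial a' b L (\<lambda>j. u (e j) x)) \<in> borel_measurable MX"
        by (rule measurable_compose[rotated])
    qed (use unimodular_hom_combination[OF u1 hom] in auto)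
    also have "\<dots> = complex_of_real (exp (- (2 * pi * (norm ?\<xi>)\<^sup>2) / 2))" by (simp add: char)
    also have "\<dots> = (\<integral>\<omega>. iexp (\<Sum>j<L. ?c j * W (e j) \<omega>) \<partial>gauss)"
    proof (rule gauss_lin_char[symmetric])
      have "gauss_lin (\<lambda>p. \<Sum>j<L. ?c j * a (e j) p) (\<lambda>\<omega>. \<Sum>j<L. ?c j * W (e j) \<omega>)"
        by (intro gauss_lin_sum W) auto
      also have "(\<lambda>p. \<Sum>j<L. ?c j * a (e j) p) = a ?\<xi>"
        by (auto simp: a_def V_sum sum_distrib_left mult_ac)
      finally show "gauss_lin (a ?\<xi>) (\<lambda>\<omega>. \<Sum>j<L. ?c j * W (e j) \<omega>)" .
    qed (rule anorm)
    also have "\<dots> = (\<integral>\<omega>. torus_monomial a' b L (U \<omega>) \<partial>gauss)"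
    proof (rule Bochner_Integration.integral_cong[OF refl])
      fix \<omega>
      have "iexp (\<Sum>j<L. ?c j * W (e j) \<omega>) = (\<Prod>j<L. iexp (?c j * W (e j) \<omega>))"
        by (simp add: sum_distrib_left exp_sum)
      also have "\<dots> = (\<Prod>j<L. U \<omega> j ^ a' j * cnj (U \<omega> j) ^ b j)"
      proof (intro prod.cong refl)
        fix j
        have "cnj (U \<omega> j) = exp (- (\<i> * complex_of_real (W (e j) \<omega>)))"
          by (simp add: U_def exp_cnj)
        then show "iexp (?c j * W (e j) \<omega>) = U \<omega> j ^ a' j * cnj (U \<omega> j) ^ b j"
          by (simp add: U_def exp_of_nat_mult[symmetric] exp_add[symmetric] algebra_simps)
      qed
      finally show "iexp (\<Sum>j<L. ?c j * W (e j) \<omega>) = torus_monomial a' b L (U \<omega>)"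
        by (simp add: torus_monomial_def)
    qed
    finally show "(\<integral>x. torus_monomial a' b L (\<lambda>j. u (e j) x) \<partial>MX) = (\<integral>\<omega>. torus_monomial a' b L (U \<omega>) \<partial>gauss)" .
  next
    show "(\<lambda>\<omega>. U \<omega> j) \<in> borel_measurable gauss" for j unfolding U_def by measurable
    show "AE \<omega> in gauss. cmod (U \<omega> j) = 1" for j by (simp add: U_def)
  qed (use MX.prob_space_axioms gauss.prob_space_axioms B f u1 um in auto)
  then obtain F where F [measurable]: "F \<in> borel \<rightarrow>\<^sub>M MX" and FX: "AE x in MX. F (\<lambda>j. u (e j) x) = x"
    and dF: "distr gauss MX (\<lambda>\<omega>. F (U \<omega>)) = MX" and uF: "\<And>j. AE \<omega> in gauss. u (e j) (F (U \<omega>)) = U \<omega> j" by blast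
  define \<Theta> where "\<Theta> \<omega> = F (U \<omega>)" for \<omega>
  have [measurable]: "U \<in> borel_measurable gauss"
    by (intro measurable_coordinatewise_then_product) (simp add: U_def)
  have \<Theta> [measurable]: "\<Theta> \<in> gauss \<rightarrow>\<^sub>M MX" unfolding \<Theta>_def by measurable
  have d\<Theta>: "distr gauss MX \<Theta> = MX" using dF by (simp add: \<Theta>_def[abs_def])
  have AE\<Theta>: "AE \<omega> in gauss. P (\<Theta> \<omega>)" if "AE x in MX. P x" for P
    by (rule AE_distrD[OF \<Theta>], unfold d\<Theta>) (rule that)
  have u\<Theta>: "AE \<omega> in gauss. u \<eta> (\<Theta> \<omega>) = iexp (W \<eta> \<omega>)" if "\<eta> \<in> E" for \<eta>
  proof -
    obtain j where "\<eta> = e j" using \<open>\<eta> \<in> E\<close> e by auto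
    then show ?thesis using uF[of j] by (simp add: \<Theta>_def U_def)
  qed
  have shift: "AE \<omega> in gauss. \<Theta> (\<omega> \<circ> left_shift G s) = TX (inv\<^bsub>G\<^esub> s) (\<Theta> \<omega>)" if s: "s \<in> carrier G" for s
  proof -
    have bij: "bij (left_shift G s)" using bij_left_shift[OF G(1) s] .
    then have d: "distr gauss gauss (\<lambda>\<omega>. \<omega> \<circ> left_shift G s) = gauss"
      by (intro distr_gauss_reindex) (auto simp: bij_def)
    have AEs: "AE \<omega> in gauss. P (\<omega> \<circ> left_shift G s)" if "AE \<omega> in gauss. P \<omega>" for P
      by (rule AE_distrD[OF gauss_reindex_measurable], unfold d) (rule that)
    \<comment> \<open>The intertwining property of V says that translating coefficients amounts to
      applying \<open>\<rho> s\<close>, and equal coefficients give almost surely equal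
      functionals.\<close>
    have Ws: "AE \<omega> in gauss. W \<eta> (\<omega> \<circ> left_shift G s) = W (\<rho> s \<eta>) \<omega>" for \<eta>
    proof (rule gauss_lin_unique[OF gauss_lin_reindex W])
      show "inj (left_shift G s)" using bij by (simp add: bij_def)
      show "gauss_lin (a \<eta>) (W \<eta>)" by (rule W)
      fix p :: "nat \<times> 'g"
      obtain n h where p: "p = (n, h)" by (cases p)
      show "a (\<rho> s \<eta>) (left_shift G s p) = a \<eta> p"
        using s by (auto simp: p left_shift_def a_def V0 Vequi G.m_assoc[symmetric])
    qed (use bij in \<open>auto simp: bij_def\<close>)
    have TXm: "TX (inv\<^bsub>G\<^esub> s) \<in> MX \<rightarrow>\<^sub>M MX" "distr MX MX (TX (inv\<^bsub>G\<^esub> s)) = MX"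
      using pmp s by (auto simp: pmp_action_def)
    have AET: "AE x in MX. P (TX (inv\<^bsub>G\<^esub> s) x)" if "AE x in MX. P x" for P
      by (rule AE_distrD[OF TXm(1)], unfold TXm(2)) (rule that)
    have 1: "AE \<omega> in gauss. \<forall>j. u (e j) (\<Theta> (\<omega> \<circ> left_shift G s)) = u (e j) (TX (inv\<^bsub>G\<^esub> s) (\<Theta> \<omega>))"
    proof (subst AE_all_countable, intro allI)
      fix j
      have ej: "e j \<in> E" "\<rho> s (e j) \<in> E" using e E\<rho>[OF s] by auto
      show "AE \<omega> in gauss. u (e j) (\<Theta> (\<omega> \<circ> left_shift G s)) = u (e j) (TX (inv\<^bsub>G\<^esub> s) (\<Theta> \<omega>))"
        using AEs[OF u\<Theta>[OF ej(1)]] u\<Theta>[OF ej(2)] Ws[of "e j"] AE\<Theta>[OF equi[OF s, of "e j"]]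
        by eventually_elim simp
    qed
    \<comment> \<open>Both points are recovered by F from their u-coordinates, which agree.\<close>
    show ?thesis using 1 AEs[OF AE\<Theta>[OF FX]] AE\<Theta>[OF AET[OF FX]]
    proof eventually_elim
      case (elim \<omega>)
      have "(\<lambda>j. u (e j) (\<Theta> (\<omega> \<circ> left_shift G s))) = (\<lambda>j. u (e j) (TX (inv\<^bsub>G\<^esub> s) (\<Theta> \<omega>)))"
        using elim(1) by auto
      from trans[OF trans[OF elim(2)[symmetric] arg_cong[OF this, of F]] elim(3)] show ?case .
    qed
  qed
  show ?thesis
  proof (rule that)
    show "u \<xi> \<in> borel_measurable MX" by (rule um)
    show "gauss_lin (a \<xi>) (W \<xi>)" by (rule W)
    show "((\<lambda>p. (a \<xi> p)\<^sup>2) has_sum (2 * pi * (norm \<xi>)\<^sup>2)) UNIV" by (rule anorm)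
    show "a \<xi> (n, h) = 0" if "h \<notin> carrier G" for n h using that by (simp add: a_def V0)
    show "\<Theta> \<in> gauss \<rightarrow>\<^sub>M MX" by (rule \<Theta>)
    show "distr gauss MX \<Theta> = MX" by (rule d\<Theta>)
    have "\<xi> \<in> E" using EI by simp
    then show "AE \<omega> in gauss. u \<xi> (\<Theta> \<omega>) = iexp (W \<xi> \<omega>)" by (rule u\<Theta>)
    show "AE \<omega> in gauss. \<Theta> (\<omega> \<circ> left_shift G s) = TX (inv\<^bsub>G\<^esub> s) (\<Theta> \<omega>)" if "s \<in> carrier G" for s
      using that by (rule shift)
    fix \<iota> \<iota>' :: "nat \<times> 'g \<Rightarrow> nat \<times> nat \<times> 'g option"
    assume inj: "inj \<iota>" "inj \<iota>'" and eq: "\<And>n h. h \<in> carrier G \<Longrightarrow> \<iota> (n, h) = \<iota>' (n, h)"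
    have "AE \<omega> in gauss. W \<eta> (\<omega> \<circ> \<iota>) = W \<eta> (\<omega> \<circ> \<iota>')" for \<eta>
    proof -
      \<comment> \<open>Coefficients are pushed forward along \<iota> from the carrier only. As
        \<open>\<iota>'\<close> agrees with \<iota> there and the other coefficients vanish, b is
        the push-forward along both maps.\<close>
      define b where "b q = (if \<exists>n h. h \<in> carrier G \<and> q = \<iota> (n, h) then a \<eta> (inv_into UNIV \<iota> q) else 0)" for q
      have off: "a \<eta> (n, h) = 0" if "h \<notin> carrier G" for n h using that by (simp add: a_def V0)
      have b1: "b (\<iota> p) = a \<eta> p" for p
        using inj(1) off by (cases p) (auto simp: b_def inj_eq)
      have b2: "b (\<iota>' p) = a \<eta> p" for p
      proof (cases p)
        case (Pair n h)
        show ?thesis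
        proof (cases "h \<in> carrier G")
          case True
          then show ?thesis using b1[of p] eq Pair by simp
        next
          case False
          have "\<not> (\<exists>n' h'. h' \<in> carrier G \<and> \<iota>' p = \<iota> (n', h'))"
            using False eq inj(2) Pair by (auto simp: inj_eq)
          then have "b (\<iota>' p) = 0" unfolding b_def by (rule if_not_P)
          then show ?thesis using off False Pair by simp
        qed
      qed
      have z: "b q = 0" if "q \<notin> range \<iota>" for q using that by (auto simp: b_def)
      have z': "b q = 0" if "q \<notin> range \<iota>'" for q using that eq by (auto simp: b_def)
      show ?thesis
        by (rule gauss_lin_unique[OF gauss_lin_reindex[OF inj(1) W b1 z] gauss_lin_reindex[OF inj(2) W b2 z']])
    qed
    then have "AE \<omega> in gauss. \<forall>j. W (e j) (\<omega> \<circ> \<iota>) = W (e j) (\<omega> \<circ> \<iota>')"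
      by (simp add: AE_all_countable)
    then show "AE \<omega> in gauss. \<Theta> (\<omega> \<circ> \<iota>) = \<Theta> (\<omega> \<circ> \<iota>')"
    proof eventually_elim
      case (elim \<omega>)
      then have "U (\<omega> \<circ> \<iota>) = U (\<omega> \<circ> \<iota>')" by (simp add: U_def fun_eq_iff)
      then show ?case by (simp add: \<Theta>_def)
    qed
  qed
qed

section \<open>A small-ball estimate on the torus\<close>

text \<open>Distinct integer parts let the sum be compared with the geometric series of ratio 1/2,
  since \<open>exp (- 1)\<close> is at most 1/2.\<close>

lemma sum_exp_neg_floor_le:
  fixes f :: "'a \<Rightarrow> real"
  assumes "finite A" "\<And>x. x \<in> A \<Longrightarrow> 0 \<le> f x" "inj_on (\<lambda>x. nat \<lfloor>f x\<rfloor>) A"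
  shows "(\<Sum>x\<in>A. exp (- f x)) \<le> 2"
proof -
  have e2: "exp (- 1 :: real) \<le> 1 / 2"
    using exp_ge_add_one_self[of "1::real"] by (simp add: exp_minus field_simps)
  have "(\<Sum>x\<in>A. exp (- f x)) \<le> (\<Sum>x\<in>A. exp (- 1) ^ nat \<lfloor>f x\<rfloor>)"
  proof (rule sum_mono)
    fix x assume "x \<in> A"
    then have "real (nat \<lfloor>f x\<rfloor>) \<le> f x" using assms(2)[of x] by (simp add: of_nat_nat)
    then show "exp (- f x) \<le> exp (- 1) ^ nat \<lfloor>f x\<rfloor>"
      by (simp add: exp_of_nat_mult[symmetric])
  qed
  also have "\<dots> = (\<Sum>n\<in>(\<lambda>x. nat \<lfloor>f x\<rfloor>) ` A. exp (- 1) ^ n)"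
    by (simp add: sum.reindex[OF assms(3)])
  also have "\<dots> \<le> (\<Sum>n\<in>(\<lambda>x. nat \<lfloor>f x\<rfloor>) ` A. (1 / 2) ^ n)"
    using e2 by (intro sum_mono power_mono) auto
  also have "\<dots> \<le> (\<Sum>n. (1 / 2 :: real) ^ n)"
    using assms(1) by (intro sum_le_suminf) auto
  also have "\<dots> = 2" by (subst suminf_geometric) auto
  finally show ?thesis .
qed

lemma sum_exp_neg_abs_le: "(\<Sum>m<N::nat. exp (- \<bar>s + real m\<bar>)) \<le> 4"
proof -
  let ?A = "{m. m < N \<and> 0 \<le> s + real m}" and ?B = "{m. m < N \<and> s + real m < 0}"
  have "(\<Sum>m<N. exp (- \<bar>s + real m\<bar>)) = (\<Sum>m\<in>?A. exp (- \<bar>s + real m\<bar>)) + (\<Sum>m\<in>?B. exp (- \<bar>s + real m\<bar>))"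
    by (subst sum.union_disjoint[symmetric]) (auto intro!: sum.cong)
  also have "(\<Sum>m\<in>?A. exp (- \<bar>s + real m\<bar>)) = (\<Sum>m\<in>?A. exp (- (s + real m)))"
    by (intro sum.cong) auto
  also have "\<dots> \<le> 2"
  proof (rule sum_exp_neg_floor_le)
    have "\<lfloor>s + real m\<rfloor> = \<lfloor>s\<rfloor> + int m" for m using floor_add_int[of s "int m"] by simp
    moreover have "0 \<le> \<lfloor>s + real m\<rfloor>" if "m \<in> ?A" for m using that by (simp only: zero_le_floor mem_Collect_eq)
    ultimately show "inj_on (\<lambda>m. nat \<lfloor>s + real m\<rfloor>) ?A"
      unfolding inj_on_def by (simp add: eq_nat_nat_iff)
  qed auto
  also have "(\<Sum>m\<in>?B. exp (- \<bar>s + real m\<bar>)) = (\<Sum>m\<in>?B. exp (- (- s - real m)))"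
    by (intro sum.cong) auto
  also have "\<dots> \<le> 2"
  proof (rule sum_exp_neg_floor_le)
    have "\<lfloor>- s - real m\<rfloor> = \<lfloor>- s\<rfloor> - int m" for m using floor_diff_of_int[of "- s" "int m"] by simp
    moreover have "0 \<le> \<lfloor>- s - real m\<rfloor>" if "m \<in> ?B" for m
      using that unfolding zero_le_floor mem_Collect_eq by linarith
    ultimately show "inj_on (\<lambda>m. nat \<lfloor>- s - real m\<rfloor>) ?B"
      unfolding inj_on_def by (simp add: eq_nat_nat_iff)
  qed auto
  finally show ?thesis by simp
qed

text \<open>The factor 4 bounds a two-sided sum of decaying exponentials along a progression of step
  1; the exponential factor is the price of dominating a Gaussian by such an exponential.\<close>

definition gauss_sum_const :: "real \<Rightarrow> real" where
  "gauss_sum_const \<delta> = 4 * exp (1 / (2 * \<delta>\<^sup>2))"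

text \<open>Nonnegativity of \<open>(\<delta> * y - 1 / \<delta>)^2\<close> dominates the Gaussian
  by an exponential in \<open>y = \<bar>s / t + m\<bar>\<close>. The bound is uniform in the shift s
  and the length N, so it can be applied while other variables are held fixed.\<close>

lemma sum_exp_neg_square_le:
  assumes "\<delta> > 0" "\<bar>t\<bar> \<ge> \<delta>"
  shows "(\<Sum>m<N::nat. exp (- (s + real m * t)\<^sup>2 / 2)) \<le> gauss_sum_const \<delta>"
proof -
  have t: "t \<noteq> 0" using assms by auto
  have "exp (- (s + real m * t)\<^sup>2 / 2) \<le> exp (1 / (2 * \<delta>\<^sup>2)) * exp (- \<bar>s / t + real m\<bar>)" for m
  proof -
    let ?y = "\<bar>s / t + real m\<bar>"
    have "\<delta>\<^sup>2 \<le> t\<^sup>2" using assms power_mono[of \<delta> "\<bar>t\<bar>" 2] by simp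
    then have "\<delta>\<^sup>2 * ?y\<^sup>2 \<le> t\<^sup>2 * ?y\<^sup>2" by (intro mult_right_mono) auto
    also have "t\<^sup>2 * ?y\<^sup>2 = (s + real m * t)\<^sup>2"
      using t by (simp add: power_mult_distrib[symmetric] distrib_left mult.commute)
    finally have 1: "\<delta>\<^sup>2 * ?y\<^sup>2 \<le> (s + real m * t)\<^sup>2" .
    have "0 \<le> (\<delta> * ?y - 1 / \<delta>)\<^sup>2" by simp
    also have "\<dots> = \<delta>\<^sup>2 * ?y\<^sup>2 - 2 * ?y + 1 / \<delta>\<^sup>2"
      using assms(1) by (simp add: power2_diff power_mult_distrib power_divide)
    finally have "- (s + real m * t)\<^sup>2 / 2 \<le> 1 / (2 * \<delta>\<^sup>2) + - ?y" using 1 by (simp add: field_simps)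
    then show ?thesis by (simp add: exp_add[symmetric])
  qed
  then have "(\<Sum>m<N. exp (- (s + real m * t)\<^sup>2 / 2)) \<le> (\<Sum>m<N. exp (1 / (2 * \<delta>\<^sup>2)) * exp (- \<bar>s / t + real m\<bar>))"
    by (intro sum_mono)
  also have "\<dots> = exp (1 / (2 * \<delta>\<^sup>2)) * (\<Sum>m<N. exp (- \<bar>s / t + real m\<bar>))" by (simp add: sum_distrib_left)
  also have "\<dots> \<le> exp (1 / (2 * \<delta>\<^sup>2)) * 4" by (intro mult_left_mono sum_exp_neg_abs_le) auto
  finally show ?thesis by (simp add: gauss_sum_const_def mult.commute)
qed

text \<open>The pair \<open>g l\<close> occurs in the square with j = l and in none with larger j.
  Summing it out with the others fixed is a one-dimensional problem: one entry of the pair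
  contributes \<open>gauss_sum_const \<delta>\<close>, the other a factor N, in place of the trivial
  N^2.\<close>

lemma triangular_exp_sum_le:
  fixes t :: "nat \<Rightarrow> nat \<Rightarrow> real" and N :: nat
  defines "n \<equiv> (\<lambda>g::nat\<times>nat. real (fst g) - real (snd g))"
  assumes "\<delta> > 0" "\<And>j. j < k \<Longrightarrow> \<bar>t j j\<bar> \<ge> \<delta>" "l \<le> k"
  shows "(\<Sum>g\<in>PiE {l..<k} (\<lambda>_. {..<N} \<times> {..<N}). exp (- (\<Sum>j\<in>{l..<k}. (\<Sum>i\<in>{j..<k}. n (g i) * t i j)\<^sup>2) / 2))
     \<le> (real N * gauss_sum_const \<delta>) ^ (k - l)"
  using assms(4)
proof (induction l rule: inc_induct)
  case base
  then show ?case by simp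
next
  case (step l)
  let ?B = "\<lambda>_::nat. {..<N} \<times> {..<N}"
  let ?Q = "\<lambda>l g. \<Sum>j\<in>{l..<k}. (\<Sum>i\<in>{j..<k}. n (g i) * t i j)\<^sup>2"
  have ins: "{l..<k} = insert l {Suc l..<k}" using step by auto
  have Q: "?Q l (g(l := y)) = (n y * t l l + (\<Sum>i\<in>{Suc l..<k}. n (g i) * t i l))\<^sup>2 + ?Q (Suc l) g" for g y
  proof -
    have "?Q l (g(l := y)) = (\<Sum>i\<in>{l..<k}. n ((g(l := y)) i) * t i l)\<^sup>2 + ?Q (Suc l) (g(l := y))"
      by (subst (1) ins) simp
    also have "(\<Sum>i\<in>{l..<k}. n ((g(l := y)) i) * t i l) = n y * t l l + (\<Sum>i\<in>{Suc l..<k}. n (g i) * t i l)"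
      by (subst ins) simp
    also have "?Q (Suc l) (g(l := y)) = ?Q (Suc l) g"
      by (intro sum.cong refl arg_cong[where f="\<lambda>x. x\<^sup>2"]) auto
    finally show ?thesis .
  qed
  \<comment> \<open>With the second entry \<open>m'\<close> fixed, the first one runs through an
    arithmetic progression whose step \<open>t l l\<close> is at least \<delta> in modulus.\<close>
  have one: "(\<Sum>y\<in>{..<N} \<times> {..<N}. exp (- (n y * t l l + s)\<^sup>2 / 2)) \<le> real N * gauss_sum_const \<delta>" for s
  proof -
    have "(\<Sum>y\<in>{..<N} \<times> {..<N}. exp (- (n y * t l l + s)\<^sup>2 / 2))
       = (\<Sum>m'<N. \<Sum>m<N. exp (- ((s - real m' * t l l) + real m * t l l)\<^sup>2 / 2))"
      by (subst sum.swap, subst sum.cartesian_product, intro sum.cong) (auto simp: n_def algebra_simps)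
    also have "\<dots> \<le> (\<Sum>m'<N. gauss_sum_const \<delta>)"
      using assms(2,3) step by (intro sum_mono sum_exp_neg_square_le) auto
    finally show ?thesis by simp
  qed
  have "(\<Sum>g\<in>PiE {l..<k} ?B. exp (- ?Q l g / 2)) = (\<Sum>(y, g)\<in>({..<N} \<times> {..<N}) \<times> PiE {Suc l..<k} ?B. exp (- ?Q l (g(l := y)) / 2))"
    unfolding ins PiE_insert_eq
    using inj_combinator[of l "{Suc l..<k}" ?B]
    by (subst sum.reindex) (auto simp: case_prod_beta' ins[symmetric])
  also have "\<dots> = (\<Sum>g\<in>PiE {Suc l..<k} ?B. \<Sum>y\<in>{..<N} \<times> {..<N}. exp (- ?Q l (g(l := y)) / 2))"
    by (subst sum.swap, subst sum.cartesian_product) simp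
  also have "\<dots> = (\<Sum>g\<in>PiE {Suc l..<k} ?B. exp (- ?Q (Suc l) g / 2) *
      (\<Sum>y\<in>{..<N} \<times> {..<N}. exp (- (n y * t l l + (\<Sum>i\<in>{Suc l..<k}. n (g i) * t i l))\<^sup>2 / 2)))"
    unfolding Q by (simp add: sum_distrib_left exp_add[symmetric] add_divide_distrib diff_divide_distrib minus_diff_commute)
  also have "\<dots> \<le> (\<Sum>g\<in>PiE {Suc l..<k} ?B. exp (- ?Q (Suc l) g / 2) * (real N * gauss_sum_const \<delta>))"
    by (intro sum_mono mult_left_mono one) auto
  also have "\<dots> = (\<Sum>g\<in>PiE {Suc l..<k} ?B. exp (- ?Q (Suc l) g / 2)) * (real N * gauss_sum_const \<delta>)"
    by (simp add: sum_distrib_right)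
  also have "\<dots> \<le> (real N * gauss_sum_const \<delta>) ^ (k - Suc l) * (real N * gauss_sum_const \<delta>)"
    using step.IH by (intro mult_right_mono) (auto simp: gauss_sum_const_def)
  also have "\<dots> = (real N * gauss_sum_const \<delta>) ^ (k - l)"
    using step by (simp add: power_Suc2[symmetric] Suc_diff_Suc del: power_Suc)
  finally show ?case .
qed

section \<open>Gram-Schmidt over a finite set of coordinates\<close>

definition ip :: "'i set \<Rightarrow> ('i \<Rightarrow> real) \<Rightarrow> ('i \<Rightarrow> real) \<Rightarrow> real" where
  "ip J x y = (\<Sum>p\<in>J. x p * y p)"

lemma ip_sum_left: "ip J (\<lambda>p. \<Sum>i\<in>I. c i * x i p) y = (\<Sum>i\<in>I. c i * ip J (x i) y)"
proof -
  have "ip J (\<lambda>p. \<Sum>i\<in>I. c i * x i p) y = (\<Sum>p\<in>J. \<Sum>i\<in>I. c i * (x i p * y p))"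
    by (simp add: ip_def sum_distrib_right mult.assoc)
  also have "\<dots> = (\<Sum>i\<in>I. c i * ip J (x i) y)"
    by (subst sum.swap) (simp add: ip_def sum_distrib_left)
  finally show ?thesis .
qed

lemma ip_commute: "ip J x y = ip J y x"
  by (simp add: ip_def mult.commute)

lemma ip_diff_left: "ip J (\<lambda>p. x p - y p) z = ip J x z - ip J y z"
  by (simp add: ip_def left_diff_distrib sum_subtractf)

lemma ip_nonneg: "0 \<le> ip J x x"
  by (simp add: ip_def sum_nonneg)

lemma ip_projection:
  fixes k :: nat
  assumes orth: "\<And>i j. i < k \<Longrightarrow> j < k \<Longrightarrow> ip J (e i) (e j) = of_bool (i = j)"
  defines "w \<equiv> \<lambda>x p. x p - (\<Sum>j<k. ip J x (e j) * e j p)"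
  shows "j < k \<Longrightarrow> ip J (w x) (e j) = 0"
    and "ip J (w x) (w x) = ip J x x - (\<Sum>j<k. (ip J x (e j))\<^sup>2)"
    and "ip J x (w x) = ip J (w x) (w x)"
proof -
  show 1: "ip J (w x) (e j) = 0" if "j < k" for j
  proof -
    have "(\<Sum>i<k. ip J x (e i) * ip J (e i) (e j)) = (\<Sum>i<k. if i = j then ip J x (e j) else 0)"
      using that orth by (intro sum.cong) auto
    also have "\<dots> = ip J x (e j)" using that by (subst sum.delta) auto
    finally show ?thesis unfolding w_def ip_diff_left ip_sum_left by simp
  qed
  have 2: "ip J (w x) y = ip J x y - (\<Sum>j<k. ip J x (e j) * ip J (e j) y)" for y
    by (simp add: w_def ip_diff_left ip_sum_left)
  have 3: "ip J (e j) (w x) = 0" if "j < k" for j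
    using 1[OF that] ip_commute[of J "e j" "w x"] by simp
  have 4: "ip J (w x) (w x) = ip J x (w x)"
    by (subst 2) (simp add: 3)
  then show "ip J x (w x) = ip J (w x) (w x)" by simp
  have "ip J x (w x) = ip J x x - (\<Sum>j<k. ip J x (e j) * ip J (e j) x)"
    by (subst ip_commute) (rule 2)
  also have "(\<Sum>j<k. ip J x (e j) * ip J (e j) x) = (\<Sum>j<k. (ip J x (e j))\<^sup>2)"
    by (subst ip_commute) (simp add: power2_eq_square)
  finally show "ip J (w x) (w x) = ip J x x - (\<Sum>j<k. (ip J x (e j))\<^sup>2)"
    using 4 by simp
qed

lemma ip_bessel:
  fixes k :: nat
  assumes "\<And>i j. i < k \<Longrightarrow> j < k \<Longrightarrow> ip J (e i) (e j) = of_bool (i = j)"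
  shows "(\<Sum>j<k. (ip J x (e j))\<^sup>2) \<le> ip J x x"
proof -
  let ?w = "\<lambda>p. x p - (\<Sum>j<k. ip J x (e j) * e j p)"
  have "ip J ?w ?w = ip J x x - (\<Sum>j<k. (ip J x (e j))\<^sup>2)"
    by (intro ip_projection(2) assms)
  then show ?thesis using ip_nonneg[of J ?w] by linarith
qed

text \<open>Vectors that stay close to the image of an operator of norm \<open>L\<close> cannot concentrate near a
  subspace of small dimension; so Gram-Schmidt can pick a positive proportion of them greedily with
  large new components.\<close>
lemma greedy_orthonormal:
  fixes b b0 :: "'v \<Rightarrow> 'i \<Rightarrow> real"
  assumes V: "finite V" "V \<noteq> {}" and \<beta>: "\<beta> > 0"
    and op: "\<And>e. (\<Sum>v\<in>V. (ip J (b0 v) e)\<^sup>2) \<le> L * ip J e e"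
    and r: "\<And>v. v \<in> V \<Longrightarrow> ip J (\<lambda>p. b v p - b0 v p) (\<lambda>p. b v p - b0 v p) \<le> \<beta> / 8"
    and b: "\<And>v. v \<in> V \<Longrightarrow> \<beta> \<le> ip J (b v) (b v)"
    and L: "L \<ge> 0" and k: "16 * L * real k \<le> \<beta> * real (card V)"
  shows "\<exists>v e. (\<forall>i<k. v i \<in> V) \<and> (\<forall>i<k. \<forall>j<k. ip J (e i) (e j) = of_bool (i = j)) \<and>
    (\<forall>i<k. \<forall>j<k. i < j \<longrightarrow> ip J (b (v i)) (e j) = 0) \<and> (\<forall>i<k. sqrt (\<beta> / 2) \<le> ip J (b (v i)) (e i))"
proof -
  \<comment> \<open>The induction carries one more clause: whatever is orthogonal to all
    \<open>e j\<close> is orthogonal to each chosen \<open>b (v i)\<close>. This expresses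
    membership in the span by duality and makes every later direction orthogonal to the earlier
    vectors.\<close>
  have "\<exists>v e. (\<forall>i<k. v i \<in> V) \<and> (\<forall>i<k. \<forall>j<k. ip J (e i) (e j) = of_bool (i = j)) \<and>
    (\<forall>i<k. \<forall>x. (\<forall>j<k. ip J x (e j) = 0) \<longrightarrow> ip J (b (v i)) x = 0) \<and>
    (\<forall>i<k. \<forall>j<k. i < j \<longrightarrow> ip J (b (v i)) (e j) = 0) \<and> (\<forall>i<k. sqrt (\<beta> / 2) \<le> ip J (b (v i)) (e i))"
    using k
  proof (induction k)
    case 0
    then show ?case by simp
  next
    case (Suc k)
    have k: "16 * L * real k \<le> \<beta> * real (card V)"
    proof -
      have "16 * L * real k \<le> 16 * L * real (Suc k)" using L by (intro mult_left_mono) auto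
      then show ?thesis using Suc.prems by linarith
    qed
    from Suc.IH[OF k] obtain v e where ve: "(\<forall>i<k. v i \<in> V) \<and>
      (\<forall>i<k. \<forall>j<k. ip J (e i) (e j) = of_bool (i = j)) \<and>
      (\<forall>i<k. \<forall>x. (\<forall>j<k. ip J x (e j) = 0) \<longrightarrow> ip J (b (v i)) x = 0) \<and>
      (\<forall>i<k. \<forall>j<k. i < j \<longrightarrow> ip J (b (v i)) (e j) = 0) \<and> (\<forall>i<k. sqrt (\<beta> / 2) \<le> ip J (b (v i)) (e i))"
      by (elim exE) (rule that)
    note ve1 = ve[THEN conjunct1] and ve2 = ve[THEN conjunct2, THEN conjunct1]
      and ve3 = ve[THEN conjunct2, THEN conjunct2, THEN conjunct1]
      and ve4 = ve[THEN conjunct2, THEN conjunct2, THEN conjunct2, THEN conjunct1]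
      and ve5 = ve[THEN conjunct2, THEN conjunct2, THEN conjunct2, THEN conjunct2]
    have v: "\<And>i. i < k \<Longrightarrow> v i \<in> V" and orth: "\<And>i j. i < k \<Longrightarrow> j < k \<Longrightarrow> ip J (e i) (e j) = of_bool (i = j)"
      and span: "\<And>i x. i < k \<Longrightarrow> (\<And>j. j < k \<Longrightarrow> ip J x (e j) = 0) \<Longrightarrow> ip J (b (v i)) x = 0"
      and tri: "\<And>i j. i < k \<Longrightarrow> j < k \<Longrightarrow> i < j \<Longrightarrow> ip J (b (v i)) (e j) = 0"
      and diag: "\<And>i. i < k \<Longrightarrow> sqrt (\<beta> / 2) \<le> ip J (b (v i)) (e i)"
      using ve1 ve2 ve4 ve5 by (simp, simp, (simp add: ve3), simp, simp)
    \<comment> \<open>Averaging: the squared projections of all \<open>b0\<close> vectors onto k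
      orthonormal directions add up to at most L * k, so by the bound on k they cannot all exceed
      \<beta>/16.\<close>
    have "\<exists>u\<in>V. (\<Sum>j<k. (ip J (b0 u) (e j))\<^sup>2) \<le> \<beta> / 16"
    proof (rule ccontr)
      assume "\<not> ?thesis"
      then have "(\<Sum>u\<in>V. \<beta> / 16) < (\<Sum>u\<in>V. \<Sum>j<k. (ip J (b0 u) (e j))\<^sup>2)"
        using V by (intro sum_strict_mono) (auto simp: not_le)
      also have "\<dots> = (\<Sum>j<k. \<Sum>u\<in>V. (ip J (b0 u) (e j))\<^sup>2)" by (rule sum.swap)
      also have "\<dots> \<le> (\<Sum>j<k. L * ip J (e j) (e j))" by (intro sum_mono op)
      also have "\<dots> = L * real k" using orth by simp
      finally show False using k by (simp add: mult_ac)
    qed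
    then obtain u where u: "u \<in> V" "(\<Sum>j<k. (ip J (b0 u) (e j))\<^sup>2) \<le> \<beta> / 16" by blast
    let ?r = "\<lambda>p. b u p - b0 u p"
    \<comment> \<open>The squared projection of b is at most twice that of \<open>b0\<close> plus
      twice that of the remainder, and 2 * \<beta>/16 + 2 * \<beta>/8 stays below \<beta>/2.\<close>
    have "(\<Sum>j<k. (ip J (b u) (e j))\<^sup>2) \<le> (\<Sum>j<k. 2 * (ip J (b0 u) (e j))\<^sup>2 + 2 * (ip J ?r (e j))\<^sup>2)"
    proof (rule sum_mono)
      fix j
      have "ip J (b u) (e j) = ip J (b0 u) (e j) + ip J ?r (e j)" by (simp add: ip_diff_left)
      then show "(ip J (b u) (e j))\<^sup>2 \<le> 2 * (ip J (b0 u) (e j))\<^sup>2 + 2 * (ip J ?r (e j))\<^sup>2"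
        using sum_squares_bound[of "ip J (b0 u) (e j)" "ip J ?r (e j)"] by (simp add: power2_sum)
    qed
    also have "\<dots> = 2 * (\<Sum>j<k. (ip J (b0 u) (e j))\<^sup>2) + 2 * (\<Sum>j<k. (ip J ?r (e j))\<^sup>2)"
      by (simp add: sum.distrib sum_distrib_left)
    also have "\<dots> \<le> 2 * (\<beta> / 16) + 2 * (\<beta> / 8)"
    proof -
      have "(\<Sum>j<k. (ip J ?r (e j))\<^sup>2) \<le> ip J ?r ?r" by (intro ip_bessel orth)
      then show ?thesis using u(2) r[OF u(1)] by linarith
    qed
    finally have small: "(\<Sum>j<k. (ip J (b u) (e j))\<^sup>2) \<le> \<beta> / 2" using \<beta> by simp
    define w where "w p = b u p - (\<Sum>j<k. ip J (b u) (e j) * e j p)" for p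
    have w_orth: "ip J w (e j) = 0" if "j < k" for j
      unfolding w_def by (intro ip_projection(1) orth that)
    have ww: "ip J w w = ip J (b u) (b u) - (\<Sum>j<k. (ip J (b u) (e j))\<^sup>2)"
      unfolding w_def by (intro ip_projection(2) orth)
    have bw: "ip J (b u) w = ip J w w"
      unfolding w_def by (intro ip_projection(3) orth)
    have ww_ge: "\<beta> / 2 \<le> ip J w w" using ww small b[OF u(1)] by linarith
    \<comment> \<open>At least \<beta>/2 of the squared norm remains orthogonal to the earlier
      directions; the normalised residual becomes the new one.\<close>
    define s where "s = sqrt (ip J w w)"
    have s: "s > 0" "s * s = ip J w w" "sqrt (\<beta> / 2) \<le> s"
      using ww_ge \<beta> by (auto simp: s_def)
    define f where "f p = w p / s" for p
    have ipf: "ip J x f = ip J x w / s" for x by (simp add: f_def ip_def sum_divide_distrib)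
    have ff: "ip J f f = 1" using s(1) by (simp add: ipf ip_commute[of J f w] s(2)[symmetric])
    have fe: "ip J f (e j) = 0" "ip J (e j) f = 0" if "j < k" for j
      using w_orth[OF that] by (auto simp: ipf ip_commute[of J f "e j"] ip_commute[of J "e j" w])
    have bf: "ip J (b u) f = s" using s(1) by (simp add: ipf bw s(2)[symmetric])
    have bif: "ip J (b (v i)) f = 0" if "i < k" for i
      using span[OF that, of f] fe by simp
    have bux: "ip J (b u) x = 0" if "\<And>j. j < Suc k \<Longrightarrow> ip J x ((e(k := f)) j) = 0" for x
    proof -
      have e0: "ip J x (e j) = 0" if "j < k" for j using that \<open>\<And>j. j < Suc k \<Longrightarrow> _\<close>[of j] by simp
      have "ip J x f = 0" using that[of k] by simp
      then have "ip J w x = 0" using s by (simp add: ipf ip_commute[of J x w])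
      moreover have "ip J w x = ip J (b u) x - (\<Sum>j<k. ip J (b u) (e j) * ip J (e j) x)"
        by (simp add: w_def[abs_def] ip_diff_left ip_sum_left)
      ultimately show ?thesis using e0 by (simp add: ip_commute[of J "e _" x])
    qed
    show ?case
    proof (intro exI[of _ "v(k := u)"] exI[of _ "e(k := f)"] conjI allI impI)
      fix i assume i: "i < Suc k"
      show "(v(k := u)) i \<in> V" using v u i by auto
      show "sqrt (\<beta> / 2) \<le> ip J (b ((v(k := u)) i)) ((e(k := f)) i)" using diag bf s(3) i by auto
      {
        fix j assume j: "j < Suc k"
        show "ip J ((e(k := f)) i) ((e(k := f)) j) = of_bool (i = j)"
          using orth ff fe i j by auto
        assume "i < j"
        then show "ip J (b ((v(k := u)) i)) ((e(k := f)) j) = 0" using tri bif i j by auto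
      }
      fix x assume x: "\<forall>j<Suc k. ip J x ((e(k := f)) j) = 0"
      show "ip J (b ((v(k := u)) i)) x = 0"
      proof (cases "i = k")
        case True
        then show ?thesis using bux x by simp
      next
        case False
        then have "i < k" using i by simp
        moreover have "ip J x (e j) = 0" if "j < k" for j using x that by (auto dest: spec[of _ j])
        ultimately show ?thesis using span False by simp
      qed
    qed
  qed
  then show ?thesis by blast
qed

section \<open>Dirichlet kernels and the small-ball bound\<close>

text \<open>Within distance 1/N of 1, the m-th power drifts from 1 by at most m/N, and these drifts
  add up to at most N/2.\<close>

lemma norm_geometric_sum_ge:
  fixes w :: complex
  assumes "cmod w \<le> 1" "cmod (w - 1) \<le> 1 / real N" "N > 0"
  shows "real N / 2 \<le> cmod (\<Sum>m<N. w ^ m)"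
proof -
  have 1: "cmod (w ^ m - 1) \<le> real m * (1 / real N)" for m
  proof -
    have "cmod (w ^ m - 1) \<le> real m * cmod (w - 1)"
      using norm_power_diff[of w 1 m] assms(1) by simp
    also have "\<dots> \<le> real m * (1 / real N)" using assms(2) by (intro mult_left_mono) auto
    finally show ?thesis .
  qed
  have "cmod ((\<Sum>m<N. w ^ m) - of_nat N) = cmod (\<Sum>m<N. w ^ m - 1)" by (simp add: sum_subtractf)
  also have "\<dots> \<le> (\<Sum>m<N. real m * (1 / real N))" by (intro sum_norm_le 1)
  also have "\<dots> = (\<Sum>m<N. real m) / real N" by (simp add: sum_divide_distrib)
  also have "\<dots> \<le> real N / 2"
  proof -
    have "2 * (\<Sum>m<N. real m) \<le> real N * real N" by (induction N) (auto simp: algebra_simps)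
    then show ?thesis using assms(3) by (simp add: field_simps)
  qed
  finally have "cmod (of_nat N) - cmod (\<Sum>m<N. w ^ m) \<le> real N / 2"
    using norm_triangle_ineq2[of "of_nat N" "\<Sum>m<N. w ^ m"] by (simp add: norm_minus_commute)
  then show ?thesis by simp
qed

text \<open>Expanding the squared Dirichlet kernels reduces the small-ball probability to values of the
  characteristic function, which the triangular shape of the coefficients controls.\<close>
lemma gauss_torus_small_ball:
  fixes b :: "nat \<Rightarrow> 'i \<Rightarrow> real" and W :: "nat \<Rightarrow> ('i \<Rightarrow> real) \<Rightarrow> real" and c :: "nat \<Rightarrow> complex"
  assumes J: "finite J" and lin: "\<And>i. i < k \<Longrightarrow> gauss_lin (b i) (W i)"
    and orth: "\<And>i j. i < k \<Longrightarrow> j < k \<Longrightarrow> ip J (e i) (e j) = of_bool (i = j)"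
    and tri: "\<And>i j. i < k \<Longrightarrow> j < k \<Longrightarrow> i < j \<Longrightarrow> ip J (b i) (e j) = 0"
    and diag: "\<And>i. i < k \<Longrightarrow> \<delta> \<le> ip J (b i) (e i)" and \<delta>: "\<delta> > 0" and N: "N > 0"
    and c: "\<And>i. i < k \<Longrightarrow> cmod (c i) \<le> 1"
  shows "measure gauss {\<omega>. \<forall>i<k. cmod (iexp (W i \<omega>) - c i) \<le> 1 / real N} \<le> (4 * gauss_sum_const \<delta> / real N) ^ k"
proof -
  have [measurable]: "i < k \<Longrightarrow> W i \<in> borel_measurable gauss" for i using lin[of i] by (auto simp: gauss_lin_def)
  define n where "n = (\<lambda>g::nat\<times>nat. real (fst g) - real (snd g))"
  define z where "z i \<omega> = iexp (W i \<omega>) * cnj (c i)" for i \<omega>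
  \<comment> \<open>The squared kernel stands in for the indicator of an arc around
    \<open>c i\<close>: it is at least N^2 / 4 there, and it is a trigonometric polynomial in
    \<open>W i\<close>, so its mean is computable.\<close>
  define f where "f i \<omega> = (cmod (\<Sum>m<N. z i \<omega> ^ m))\<^sup>2" for i \<omega>
  define E where "E = {\<omega>. \<forall>i<k. cmod (iexp (W i \<omega>) - c i) \<le> 1 / real N}"
  have fm: "(\<lambda>\<omega>. \<Prod>i<k. f i \<omega>) \<in> borel_measurable gauss"
    unfolding f_def z_def by (intro borel_measurable_prod) auto
  have Em: "E \<in> sets gauss"
  proof -
    have "{\<omega> \<in> space gauss. cmod (iexp (W i \<omega>) - c i) \<le> 1 / real N} \<in> sets gauss" if "i < k" for i
      using that by measurable
    then have "{\<omega> \<in> space gauss. \<forall>i\<in>{..<k}. cmod (iexp (W i \<omega>) - c i) \<le> 1 / real N} \<in> sets gauss"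
      by (intro sets.sets_Collect_finite_All) auto
    then show ?thesis by (simp add: E_def lessThan_iff Ball_def)
  qed
  have zle: "cmod (z i \<omega>) \<le> 1" if "i < k" for i \<omega> using c[OF that] by (simp add: z_def norm_mult)
  have fle: "f i \<omega> \<le> (real N)\<^sup>2" if "i < k" for i \<omega>
  proof -
    have "cmod (\<Sum>m<N. z i \<omega> ^ m) \<le> (\<Sum>m<N. 1)"
      using zle[OF that] by (intro sum_norm_le) (auto simp: norm_power intro!: power_le_one)
    then show ?thesis unfolding f_def by (intro power_mono) auto
  qed
  have fge: "(real N)\<^sup>2 / 4 \<le> f i \<omega>" if "\<omega> \<in> E" "i < k" for i \<omega>
  proof -
    have "cmod (z i \<omega> - 1) = cmod (iexp (W i \<omega>) * cnj (c i) - iexp (W i \<omega>) * cnj (iexp (W i \<omega>)))"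
      by (simp add: z_def exp_cnj exp_add[symmetric])
    also have "\<dots> = cmod (cnj (c i - iexp (W i \<omega>)))"
      by (simp add: right_diff_distrib[symmetric] norm_mult)
    also have "\<dots> \<le> 1 / real N" using that by (simp add: E_def norm_minus_commute del: complex_cnj_diff)
    finally have "real N / 2 \<le> cmod (\<Sum>m<N. z i \<omega> ^ m)"
      using norm_geometric_sum_ge[OF zle[OF that(2)]] N by blast
    then have "(real N / 2)\<^sup>2 \<le> f i \<omega>" unfolding f_def by (intro power_mono) auto
    then show ?thesis by (simp add: power_divide)
  qed
  have f0: "0 \<le> f i \<omega>" for i \<omega> by (simp add: f_def)
  have intf: "integrable gauss (\<lambda>\<omega>. \<Prod>i<k. f i \<omega>)"
  proof (rule gauss.integrable_const_bound)
    show "AE \<omega> in gauss. norm (\<Prod>i<k. f i \<omega>) \<le> ((real N)\<^sup>2) ^ k"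
    proof (rule AE_I2)
      fix \<omega>
      have "(\<Prod>i<k. f i \<omega>) \<le> (\<Prod>i<k. (real N)\<^sup>2)" by (intro prod_mono) (auto simp: f0 fle)
      then show "norm (\<Prod>i<k. f i \<omega>) \<le> ((real N)\<^sup>2) ^ k" by (simp add: prod_nonneg f0)
    qed
  qed (rule fm)
  have "((real N)\<^sup>2 / 4) ^ k * measure gauss E = (\<integral>\<omega>. ((real N)\<^sup>2 / 4) ^ k * indicator E \<omega> \<partial>gauss)"
    using Em by simp
  also have "\<dots> \<le> (\<integral>\<omega>. (\<Prod>i<k. f i \<omega>) \<partial>gauss)"
  proof (rule integral_mono)
    show "integrable gauss (\<lambda>\<omega>. ((real N)\<^sup>2 / 4) ^ k * indicator E \<omega>)"
      using Em by (intro integrable_mult_right integrable_real_indicator) (auto simp: gauss.emeasure_eq_measure)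
    fix \<omega>
    show "((real N)\<^sup>2 / 4) ^ k * indicator E \<omega> \<le> (\<Prod>i<k. f i \<omega>)"
    proof (cases "\<omega> \<in> E")
      case True
      have "(\<Prod>i<k. (real N)\<^sup>2 / 4) \<le> (\<Prod>i<k. f i \<omega>)" by (intro prod_mono conjI fge[OF True]) auto
      then show ?thesis using True by simp
    next
      case False
      then show ?thesis by (simp add: prod_nonneg f0)
    qed
  qed (rule intf)
  also have "\<dots> \<le> (real N * gauss_sum_const \<delta>) ^ k"
  proof -
    let ?P = "PiE {..<k} (\<lambda>_. {..<N} \<times> {..<N})"
    have expand: "complex_of_real (\<Prod>i<k. f i \<omega>) =
      (\<Sum>g\<in>?P. (\<Prod>i<k. cnj (c i) ^ fst (g i) * c i ^ snd (g i)) * iexp (\<Sum>i<k. n (g i) * W i \<omega>))" for \<omega>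
    proof -
      have "complex_of_real (f i \<omega>) = (\<Sum>y\<in>{..<N} \<times> {..<N}. (cnj (c i) ^ fst y * c i ^ snd y) * iexp (n y * W i \<omega>))" for i
      proof -
        have "complex_of_real (f i \<omega>) = (\<Sum>m<N. z i \<omega> ^ m) * cnj (\<Sum>m<N. z i \<omega> ^ m)"
          unfolding f_def by (rule complex_norm_square)
        also have "\<dots> = (\<Sum>y\<in>{..<N} \<times> {..<N}. z i \<omega> ^ fst y * cnj (z i \<omega>) ^ snd y)"
          by (simp add: sum_product sum.cartesian_product case_prod_beta')
        also have "\<dots> = (\<Sum>y\<in>{..<N} \<times> {..<N}. (cnj (c i) ^ fst y * c i ^ snd y) * iexp (n y * W i \<omega>))"
        proof (intro sum.cong refl)
          fix y :: "nat \<times> nat"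
          have "iexp (n y * W i \<omega>) = iexp (W i \<omega>) ^ fst y * cnj (iexp (W i \<omega>)) ^ snd y"
            by (simp add: n_def exp_cnj exp_of_nat_mult[symmetric] exp_add[symmetric] algebra_simps)
          then show "z i \<omega> ^ fst y * cnj (z i \<omega>) ^ snd y = (cnj (c i) ^ fst y * c i ^ snd y) * iexp (n y * W i \<omega>)"
            by (simp add: z_def power_mult_distrib mult_ac)
        qed
        finally show ?thesis .
      qed
      then have "complex_of_real (\<Prod>i<k. f i \<omega>) =
         (\<Prod>i<k. \<Sum>y\<in>{..<N} \<times> {..<N}. (cnj (c i) ^ fst y * c i ^ snd y) * iexp (n y * W i \<omega>))"
        by simp
      also have "\<dots> = (\<Sum>g\<in>?P. \<Prod>i<k. (cnj (c i) ^ fst (g i) * c i ^ snd (g i)) * iexp (n (g i) * W i \<omega>))"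
        by (rule prod_sum_PiE) auto
      finally show ?thesis by (simp add: prod.distrib sum_distrib_left exp_sum)
    qed
    have fin: "finite ?P" by (intro finite_PiE) auto
    have int1: "integrable gauss (\<lambda>\<omega>. iexp (\<Sum>i<k. n (g i) * W i \<omega>))" for g
      by (rule gauss.integrable_const_bound[where B=1]) auto
    have "complex_of_real (\<integral>\<omega>. (\<Prod>i<k. f i \<omega>) \<partial>gauss) = (\<integral>\<omega>. complex_of_real (\<Prod>i<k. f i \<omega>) \<partial>gauss)"
      by (rule integral_complex_of_real[symmetric])
    also have "\<dots> = (\<Sum>g\<in>?P. (\<Prod>i<k. cnj (c i) ^ fst (g i) * c i ^ snd (g i)) * (\<integral>\<omega>. iexp (\<Sum>i<k. n (g i) * W i \<omega>) \<partial>gauss))"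
      unfolding expand using int1 by (subst Bochner_Integration.integral_sum) auto
    finally have eq: "complex_of_real (\<integral>\<omega>. (\<Prod>i<k. f i \<omega>) \<partial>gauss) =
      (\<Sum>g\<in>?P. (\<Prod>i<k. cnj (c i) ^ fst (g i) * c i ^ snd (g i)) * (\<integral>\<omega>. iexp (\<Sum>i<k. n (g i) * W i \<omega>) \<partial>gauss))" .
    have "(\<integral>\<omega>. (\<Prod>i<k. f i \<omega>) \<partial>gauss) \<le> cmod (complex_of_real (\<integral>\<omega>. (\<Prod>i<k. f i \<omega>) \<partial>gauss))"
      unfolding norm_of_real by (rule abs_ge_self)
    also have "\<dots> = cmod (\<Sum>g\<in>?P. (\<Prod>i<k. cnj (c i) ^ fst (g i) * c i ^ snd (g i)) * (\<integral>\<omega>. iexp (\<Sum>i<k. n (g i) * W i \<omega>) \<partial>gauss))"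
      unfolding eq ..
    also have "\<dots> \<le> (\<Sum>g\<in>?P. exp (- (\<Sum>j\<in>{0..<k}. (\<Sum>i\<in>{j..<k}. n (g i) * ip J (b i) (e j))\<^sup>2) / 2))"
    proof (rule sum_norm_le)
      fix g
      have a1: "cmod (\<Prod>i<k. cnj (c i) ^ fst (g i) * c i ^ snd (g i)) \<le> 1"
        unfolding prod_norm[symmetric] using c by (intro prod_le_1) (auto simp: norm_mult norm_power intro!: mult_le_one power_le_one)
      have a2: "cmod (\<integral>\<omega>. iexp (\<Sum>i<k. n (g i) * W i \<omega>) \<partial>gauss)
        \<le> exp (- (\<Sum>p\<in>J. (\<Sum>i<k. n (g i) * b i p)\<^sup>2) / 2)"
        using lin by (intro gauss_lin_char_le J gauss_lin_sum) auto
      \<comment> \<open>Bessel's inequality bounds the squared norm from below by the coordinates in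
        the orthonormal system, and the triangular shape removes the terms with i < j.\<close>
      have a3: "(\<Sum>j\<in>{0..<k}. (\<Sum>i\<in>{j..<k}. n (g i) * ip J (b i) (e j))\<^sup>2) \<le> (\<Sum>p\<in>J. (\<Sum>i<k. n (g i) * b i p)\<^sup>2)"
      proof -
        have "(\<Sum>i\<in>{j..<k}. n (g i) * ip J (b i) (e j)) = ip J (\<lambda>p. \<Sum>i<k. n (g i) * b i p) (e j)" if "j < k" for j
          unfolding ip_sum_left using tri that by (intro sum.mono_neutral_left) auto
        then have "(\<Sum>j\<in>{0..<k}. (\<Sum>i\<in>{j..<k}. n (g i) * ip J (b i) (e j))\<^sup>2) = (\<Sum>j<k. (ip J (\<lambda>p. \<Sum>i<k. n (g i) * b i p) (e j))\<^sup>2)"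
          by (intro sum.cong) auto
        also have "\<dots> \<le> ip J (\<lambda>p. \<Sum>i<k. n (g i) * b i p) (\<lambda>p. \<Sum>i<k. n (g i) * b i p)"
          by (intro ip_bessel orth)
        finally show ?thesis by (simp add: ip_def power2_eq_square)
      qed
      have "cmod (\<integral>\<omega>. iexp (\<Sum>i<k. n (g i) * W i \<omega>) \<partial>gauss)
        \<le> exp (- (\<Sum>j\<in>{0..<k}. (\<Sum>i\<in>{j..<k}. n (g i) * ip J (b i) (e j))\<^sup>2) / 2)"
        by (rule order_trans[OF a2]) (use a3 in simp)
      with mult_mono[OF a1 this] show "cmod ((\<Prod>i<k. cnj (c i) ^ fst (g i) * c i ^ snd (g i)) * (\<integral>\<omega>. iexp (\<Sum>i<k. n (g i) * W i \<omega>) \<partial>gauss))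
        \<le> exp (- (\<Sum>j\<in>{0..<k}. (\<Sum>i\<in>{j..<k}. n (g i) * ip J (b i) (e j))\<^sup>2) / 2)"
        by (simp add: norm_mult)
    qed
    also have "\<dots> \<le> (real N * gauss_sum_const \<delta>) ^ (k - 0)"
    proof -
      have P: "?P = PiE {0..<k} (\<lambda>_. {..<N} \<times> {..<N})" by (simp add: lessThan_atLeast0)
      have d: "\<delta> \<le> \<bar>(\<lambda>i j. ip J (b i) (e j)) j j\<bar>" if "j < k" for j using diag[OF that] by simp
      show ?thesis unfolding P n_def
        using triangular_exp_sum_le[of \<delta> k "\<lambda>i j. ip J (b i) (e j)" 0 N, OF \<delta> d le0] by blast
    qed
    finally show ?thesis by simp
  qed
  \<comment> \<open>Each of the k factors gains N^2 / 4 on the event but costs only N times a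
    constant in the mean, leaving a quotient of order 1/N.\<close>
  finally have "measure gauss E \<le> (real N * gauss_sum_const \<delta>) ^ k / ((real N)\<^sup>2 / 4) ^ k"
    using N by (simp add: pos_le_divide_eq mult.commute)
  also have "\<dots> = (4 * gauss_sum_const \<delta> / real N) ^ k"
    unfolding power_divide[symmetric] using N by (simp add: power2_eq_square mult.commute)
  finally show ?thesis by (simp add: E_def)
qed

section \<open>Sofic homomorphisms and labellings by points\<close>

lemma part_algI:
  assumes "A \<subseteq> \<Union>R" "\<And>B. B \<in> R \<Longrightarrow> B \<inter> A \<noteq> {} \<Longrightarrow> B \<subseteq> A"
  shows "A \<in> part_alg R"
proof -
  have "A = \<Union>{B\<in>R. B \<subseteq> A}" using assms by blast
  then show ?thesis unfolding part_alg_def by blast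
qed

lemma part_alg_cases:
  assumes "disjoint R" "A \<in> part_alg R" "B \<in> R" "B \<inter> A \<noteq> {}"
  shows "B \<subseteq> A"
proof -
  obtain Q where Q: "A = \<Union>Q" "Q \<subseteq> R" using assms(2) by (auto simp: part_alg_def)
  then obtain C where C: "C \<in> Q" "B \<inter> C \<noteq> {}" using assms(4) by auto
  then have "B = C" using assms(1,3) Q(2) unfolding disjoint_def by blast
  then show ?thesis using C(1) Q(1) by blast
qed

lemma part_alg_subset: "A \<in> part_alg R \<Longrightarrow> A \<subseteq> \<Union>R"
  by (auto simp: part_alg_def)

lemma part_alg_Un: "A \<in> part_alg R \<Longrightarrow> B \<in> part_alg R \<Longrightarrow> A \<union> B \<in> part_alg R"
proof -
  assume "A \<in> part_alg R" "B \<in> part_alg R"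
  then obtain Q Q' where "A = \<Union>Q" "Q \<subseteq> R" "B = \<Union>Q'" "Q' \<subseteq> R" by (auto simp: part_alg_def)
  then have "A \<union> B = \<Union>(Q \<union> Q')" "Q \<union> Q' \<subseteq> R" by auto
  then show ?thesis unfolding part_alg_def by blast
qed

lemma part_alg_Diff:
  assumes "disjoint R" "A \<in> part_alg R"
  shows "\<Union>R - A \<in> part_alg R"
proof (rule part_algI)
  fix B assume "B \<in> R" "B \<inter> (\<Union>R - A) \<noteq> {}"
  then show "B \<subseteq> \<Union>R - A" using part_alg_cases[OF assms, of B] by blast
qed blast

lemma part_alg_UN: "Q \<subseteq> R \<Longrightarrow> \<Union>Q \<in> part_alg R"
  by (auto simp: part_alg_def)

lemma finite_part_alg: "finite R \<Longrightarrow> finite (part_alg R)"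
proof -
  assume "finite R"
  moreover have "part_alg R = Union ` Pow R" by (auto simp: part_alg_def)
  ultimately show ?thesis by simp
qed

lemma part_alg_mono:
  assumes "\<And>A. A \<in> P \<Longrightarrow> A \<in> part_alg R" "A \<in> part_alg P" "disjoint R"
  shows "A \<in> part_alg R"
proof (rule part_algI)
  obtain Q where Q: "A = \<Union>Q" "Q \<subseteq> P" using assms(2) by (auto simp: part_alg_def)
  show "A \<subseteq> \<Union>R" using Q assms(1) part_alg_subset by blast
  fix B assume B: "B \<in> R" "B \<inter> A \<noteq> {}"
  then obtain C where C: "C \<in> Q" "B \<inter> C \<noteq> {}" using Q by blast
  then have "C \<in> part_alg R" using Q(2) assms(1) by blast
  from part_alg_cases[OF assms(3) this B(1) C(2)] have "B \<subseteq> C" .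
  then show "B \<subseteq> A" using C(1) Q(1) by blast
qed

lemma fin_meas_partitionD:
  assumes "fin_meas_partition M P"
  shows "finite P" "P \<subseteq> sets M" "{} \<notin> P" "\<Union>P = space M" "disjoint P"
  using assms by (auto simp: fin_meas_partition_def)

text \<open>Cutting by a finite-valued label makes it constant on cells; this serves both the labels
  on Y and the torus cells of \<open>u\<close>.\<close>

lemma fin_meas_partition_common_refinement:
  fixes \<kappa> :: "'x \<Rightarrow> 'b"
  assumes P: "fin_meas_partition M P" and \<kappa>: "\<kappa> \<in> M \<rightarrow>\<^sub>M count_space UNIV" and fin: "finite (\<kappa> ` space M)"
  defines "R \<equiv> (\<lambda>(A, l). A \<inter> \<kappa> -` {l}) ` (P \<times> \<kappa> ` space M) - {{}}"
  shows "fin_meas_partition M R" "refines R P" "\<And>A x x'. A \<in> R \<Longrightarrow> x \<in> A \<Longrightarrow> x' \<in> A \<Longrightarrow> \<kappa> x = \<kappa> x'"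
proof -
  note PD = fin_meas_partitionD[OF P]
  show "refines R P" by (auto simp: R_def refines_def)
  show "\<And>A x x'. A \<in> R \<Longrightarrow> x \<in> A \<Longrightarrow> x' \<in> A \<Longrightarrow> \<kappa> x = \<kappa> x'" by (auto simp: R_def)
  show "fin_meas_partition M R"
    unfolding fin_meas_partition_def
  proof (intro conjI)
    show "finite R" unfolding R_def using PD(1) fin by auto
    show "{} \<notin> R" by (auto simp: R_def)
    show "R \<subseteq> sets M"
    proof
      fix B assume "B \<in> R"
      then obtain A l where B: "B = A \<inter> \<kappa> -` {l}" "A \<in> P" by (auto simp: R_def)
      then have A: "A \<in> sets M" using PD(2) by auto
      have "\<kappa> -` {l} \<inter> space M \<in> sets M" using \<kappa> by (rule measurable_sets) simp
      moreover have "B = A \<inter> (\<kappa> -` {l} \<inter> space M)" using B sets.sets_into_space[OF A] by auto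
      ultimately show "B \<in> sets M" using A by simp
    qed
    show "\<Union>R = space M"
    proof
      show "\<Union>R \<subseteq> space M" using PD(4) by (auto simp: R_def)
      show "space M \<subseteq> \<Union>R"
      proof
        fix x assume x: "x \<in> space M"
        then obtain A where A: "A \<in> P" "x \<in> A" using PD(4) by auto
        have "(A, \<kappa> x) \<in> P \<times> \<kappa> ` space M" using A x by simp
        then have "(\<lambda>(A, l). A \<inter> \<kappa> -` {l}) (A, \<kappa> x) \<in> (\<lambda>(A, l). A \<inter> \<kappa> -` {l}) ` (P \<times> \<kappa> ` space M)"
          by (rule imageI)
        then have "A \<inter> \<kappa> -` {\<kappa> x} \<in> R" unfolding R_def using A by auto
        then show "x \<in> \<Union>R" using A by blast
      qed
    qed
    show "disjoint R"
    proof (rule disjointI)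
      fix B B' assume "B \<in> R" "B' \<in> R" "B \<noteq> B'"
      then obtain A l A' l' where *: "B = A \<inter> \<kappa> -` {l}" "A \<in> P" "B' = A' \<inter> \<kappa> -` {l'}" "A' \<in> P"
        unfolding R_def by (elim DiffE imageE SigmaE) simp
      show "B \<inter> B' = {}"
      proof (rule ccontr)
        assume "B \<inter> B' \<noteq> {}"
        then obtain x where x: "x \<in> B" "x \<in> B'" by blast
        then have "A = A'" using * PD(5) unfolding disjoint_def by blast
        moreover have "l = l'" using x * by simp
        ultimately show False using * \<open>B \<noteq> B'\<close> by simp
      qed
    qed
  qed
qed

section \<open>Join algebras, homomorphisms and labellings by points\<close>

locale pmp_system = group G + prob_space M for G :: "'g monoid" and M :: "'x measure" +
  fixes T :: "'g \<Rightarrow> 'x \<Rightarrow> 'x"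
  assumes pmp: "pmp_action G M T"
begin

lemma T_measurable [measurable]: "g \<in> carrier G \<Longrightarrow> T g \<in> M \<rightarrow>\<^sub>M M"
  using pmp by (auto simp: pmp_action_def)

lemma T_distr: "g \<in> carrier G \<Longrightarrow> distr M M (T g) = M"
  using pmp by (auto simp: pmp_action_def)

lemma T_space: "g \<in> carrier G \<Longrightarrow> x \<in> space M \<Longrightarrow> T g x \<in> space M"
  using measurable_space[OF T_measurable] .

lemma T_one: "x \<in> space M \<Longrightarrow> T \<one>\<^bsub>G\<^esub> x = x"
  using pmp by (auto simp: pmp_action_def)

lemma T_inv: "g \<in> carrier G \<Longrightarrow> x \<in> space M \<Longrightarrow> T (inv\<^bsub>G\<^esub> g) (T g x) = x"
  and T_inv': "g \<in> carrier G \<Longrightarrow> x \<in> space M \<Longrightarrow> T g (T (inv\<^bsub>G\<^esub> g) x) = x"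
proof -
  assume g: "g \<in> carrier G" and x: "x \<in> space M"
  have mult: "\<And>a b. a \<in> carrier G \<Longrightarrow> b \<in> carrier G \<Longrightarrow> T (a \<otimes>\<^bsub>G\<^esub> b) x = T a (T b x)"
    using pmp x by (auto simp: pmp_action_def)
  show "T (inv\<^bsub>G\<^esub> g) (T g x) = x" "T g (T (inv\<^bsub>G\<^esub> g) x) = x"
    using mult[of "inv\<^bsub>G\<^esub> g" g] mult[of g "inv\<^bsub>G\<^esub> g"] g x T_one[OF x] by simp_all
qed

text \<open>The entropy is defined with images of sets; as preimages under the inverse element they
  are measurable and can be tested pointwise.\<close>

lemma T_image: "g \<in> carrier G \<Longrightarrow> A \<subseteq> space M \<Longrightarrow> T g ` A = T (inv\<^bsub>G\<^esub> g) -` A \<inter> space M"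
proof (intro equalityI subsetI)
  fix x assume *: "g \<in> carrier G" "A \<subseteq> space M" "x \<in> T (inv\<^bsub>G\<^esub> g) -` A \<inter> space M"
  then have "x = T g (T (inv\<^bsub>G\<^esub> g) x)" by (simp add: T_inv')
  then show "x \<in> T g ` A" using * by blast
qed (auto simp: T_inv T_space)

lemma T_image_iff: "g \<in> carrier G \<Longrightarrow> A \<subseteq> space M \<Longrightarrow> x \<in> space M \<Longrightarrow> x \<in> T g ` A \<longleftrightarrow> T (inv\<^bsub>G\<^esub> g) x \<in> A"
  by (simp add: T_image)

lemma T_image_sets: "g \<in> carrier G \<Longrightarrow> A \<in> sets M \<Longrightarrow> T g ` A \<in> sets M"
  by (subst T_image) (auto dest: sets.sets_into_space intro!: measurable_sets[OF T_measurable])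

context
  fixes P F
  assumes P: "fin_meas_partition M P" and F: "finite F" "F \<subseteq> carrier G" "\<one>\<^bsub>G\<^esub> \<in> F"
begin

lemma P_subset: "A \<in> P \<Longrightarrow> A \<subseteq> space M"
  using fin_meas_partitionD(4)[OF P] by blast

lemma P_unique: "A \<in> P \<Longrightarrow> B \<in> P \<Longrightarrow> x \<in> A \<Longrightarrow> x \<in> B \<Longrightarrow> A = B"
  using fin_meas_partitionD(5)[OF P] unfolding disjoint_def by blast

lemma part_joinD:
  assumes "B \<in> part_join M T P F"
  shows "\<exists>c. (\<forall>s\<in>F. c s \<in> P) \<and> (\<forall>x. x \<in> B \<longleftrightarrow> x \<in> space M \<and> (\<forall>s\<in>F. T (inv\<^bsub>G\<^esub> s) x \<in> c s))"
proof -
  obtain c where c: "B = space M \<inter> (\<Inter>s\<in>F. T s ` c s)" "\<forall>s\<in>F. c s \<in> P"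
    using assms unfolding part_join_def by blast
  have "x \<in> B \<longleftrightarrow> x \<in> space M \<and> (\<forall>s\<in>F. T (inv\<^bsub>G\<^esub> s) x \<in> c s)" for x
    unfolding c(1) using T_image_iff[OF subsetD[OF F(2)] P_subset] c(2) by blast
  then show ?thesis using c(2) by blast
qed

lemma part_join_cover:
  assumes "x \<in> space M"
  shows "\<exists>B\<in>part_join M T P F. x \<in> B"
proof -
  have "\<forall>s\<in>F. \<exists>A\<in>P. T (inv\<^bsub>G\<^esub> s) x \<in> A"
  proof
    fix s assume "s \<in> F"
    then have "T (inv\<^bsub>G\<^esub> s) x \<in> space M" using F assms by (intro T_space) auto
    then show "\<exists>A\<in>P. T (inv\<^bsub>G\<^esub> s) x \<in> A" using fin_meas_partitionD(4)[OF P] by blast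
  qed
  then obtain c where c: "\<And>s. s \<in> F \<Longrightarrow> c s \<in> P" "\<And>s. s \<in> F \<Longrightarrow> T (inv\<^bsub>G\<^esub> s) x \<in> c s" by metis
  have "x \<in> space M \<inter> (\<Inter>s\<in>F. T s ` c s)"
    using c T_image_iff[OF subsetD[OF F(2)] P_subset] assms by blast
  moreover from this have "space M \<inter> (\<Inter>s\<in>F. T s ` c s) \<in> part_join M T P F"
    unfolding part_join_def using c(1) by blast
  ultimately show ?thesis by blast
qed

lemma part_join_unique:
  assumes B: "B \<in> part_join M T P F" and C: "C \<in> part_join M T P F" and x: "x \<in> B" "x \<in> C"
  shows "B = C"
proof -
  obtain c where c: "\<And>s. s \<in> F \<Longrightarrow> c s \<in> P" "\<And>x. x \<in> B \<longleftrightarrow> x \<in> space M \<and> (\<forall>s\<in>F. T (inv\<^bsub>G\<^esub> s) x \<in> c s)"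
    using part_joinD[OF B] by blast
  obtain c' where c': "\<And>s. s \<in> F \<Longrightarrow> c' s \<in> P" "\<And>x. x \<in> C \<longleftrightarrow> x \<in> space M \<and> (\<forall>s\<in>F. T (inv\<^bsub>G\<^esub> s) x \<in> c' s)"
    using part_joinD[OF C] by blast
  have "c s = c' s" if "s \<in> F" for s
    using P_unique[OF c(1)[OF that] c'(1)[OF that]] c(2)[of x] c'(2)[of x] x that by blast
  then have "\<And>y. y \<in> B \<longleftrightarrow> y \<in> C" using c(2) c'(2) by auto
  then show ?thesis by blast
qed

lemma fin_meas_partition_part_join: "fin_meas_partition M (part_join M T P F)"
  unfolding fin_meas_partition_def
proof (intro conjI)
  have "part_join M T P F \<subseteq> (\<lambda>c. space M \<inter> (\<Inter>s\<in>F. T s ` c s)) ` PiE F (\<lambda>_. P)"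
  proof
    fix B assume "B \<in> part_join M T P F"
    then obtain c where c: "B = space M \<inter> (\<Inter>s\<in>F. T s ` c s)" "\<forall>s\<in>F. c s \<in> P"
      unfolding part_join_def by blast
    have "B = (\<lambda>c. space M \<inter> (\<Inter>s\<in>F. T s ` c s)) (restrict c F)" using c(1) by simp
    moreover have "restrict c F \<in> PiE F (\<lambda>_. P)" using c(2) by simp
    ultimately show "B \<in> (\<lambda>c. space M \<inter> (\<Inter>s\<in>F. T s ` c s)) ` PiE F (\<lambda>_. P)" by (rule image_eqI)
  qed
  then show "finite (part_join M T P F)"
    by (rule finite_subset) (intro finite_imageI finite_PiE F(1) fin_meas_partitionD(1)[OF P])
  show "{} \<notin> part_join M T P F" by (simp add: part_join_def)
  show "part_join M T P F \<subseteq> sets M"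
  proof
    fix B assume "B \<in> part_join M T P F"
    then obtain c where c: "B = space M \<inter> (\<Inter>s\<in>F. T s ` c s)" "\<forall>s\<in>F. c s \<in> P"
      unfolding part_join_def by blast
    have "T s ` c s \<in> sets M" if "s \<in> F" for s
      using c(2) that F(2) fin_meas_partitionD(2)[OF P] by (intro T_image_sets) auto
    then show "B \<in> sets M" unfolding c(1) using F by (intro sets.Int sets.finite_INT) auto
  qed
  show "\<Union>(part_join M T P F) = space M"
    using part_join_cover part_joinD by blast
  show "disjoint (part_join M T P F)"
    using part_join_unique unfolding disjoint_def by blast
qed

text \<open>An atom of the join fixes, for each s in F, the cell of the point moved by the inverse
  of s, so it lies inside the image of A or misses it.\<close>

lemma image_part_alg_part_join:
  assumes "A \<in> P" "s \<in> F"
  shows "T s ` A \<in> part_alg (part_join M T P F)"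
proof (rule part_algI)
  have s: "s \<in> carrier G" using F assms(2) by auto
  have TA: "T s ` A \<subseteq> space M" using T_space[OF s] P_subset[OF assms(1)] by blast
  then show "T s ` A \<subseteq> \<Union>(part_join M T P F)"
    using fin_meas_partitionD(4)[OF fin_meas_partition_part_join] by simp
  fix B assume B: "B \<in> part_join M T P F" "B \<inter> T s ` A \<noteq> {}"
  obtain c where c: "\<And>s. s \<in> F \<Longrightarrow> c s \<in> P" "\<And>x. x \<in> B \<longleftrightarrow> x \<in> space M \<and> (\<forall>s\<in>F. T (inv\<^bsub>G\<^esub> s) x \<in> c s)"
    using part_joinD[OF B(1)] by blast
  obtain x where x: "x \<in> B" "x \<in> T s ` A" using B(2) by blast
  then have "T (inv\<^bsub>G\<^esub> s) x \<in> A" using T_image_iff[OF s P_subset[OF assms(1)]] TA by blast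
  then have "A = c s" using P_unique[OF assms(1) c(1)[OF assms(2)]] c(2)[of x] x(1) assms(2) by blast
  then show "B \<subseteq> T s ` A"
    using c(2) assms(2) T_image_iff[OF s P_subset[OF assms(1)]] by blast
qed

lemma T_one_image: "A \<subseteq> space M \<Longrightarrow> T \<one>\<^bsub>G\<^esub> ` A = A"
proof -
  assume A: "A \<subseteq> space M"
  then have "T \<one>\<^bsub>G\<^esub> ` A = (\<lambda>x. x) ` A" using T_one by (intro image_cong) auto
  then show ?thesis by simp
qed

lemma part_alg_subset_part_join: "A \<in> part_alg P \<Longrightarrow> A \<in> part_alg (part_join M T P F)"
proof (rule part_alg_mono[of P])
  fix B assume "B \<in> P"
  then show "B \<in> part_alg (part_join M T P F)"
    using image_part_alg_part_join[of B "\<one>\<^bsub>G\<^esub>"] T_one_image[OF P_subset] F by simp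
qed (use fin_meas_partitionD(5)[OF fin_meas_partition_part_join] in simp_all)

text \<open>The empty value off the join algebra is the one prescribed by \<open>bool_hom\<close>,
  so that a homomorphism is determined by its values on the algebra.\<close>

definition point_hom :: "nat \<Rightarrow> (nat \<Rightarrow> 'x) \<Rightarrow> 'x set \<Rightarrow> nat set" where
  "point_hom d y A = (if A \<in> part_alg (part_join M T P F) then {v. v < d \<and> y v \<in> A} else {})"

text \<open>At a vertex v, membership in the image of A under \<open>T s\<close> concerns
  \<open>y v\<close> moved by the inverse of s, while membership in the permuted vertex set concerns
  the point at the preimage of v. The sofic conditions thus become two statistics of the labelling:
  an equivariance defect and the frequencies of atoms.\<close>

lemma point_hom_sofic:
  assumes y: "\<And>v. v < d \<Longrightarrow> y v \<in> space M"
    and \<tau>: "\<And>s. s \<in> F \<Longrightarrow> \<tau> s permutes {..<d}"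
    and 1: "\<And>s. s \<in> F \<Longrightarrow> (\<Sum>A\<in>P. real (card {v. v < d \<and> (T (inv\<^bsub>G\<^esub> s) (y v) \<in> A) \<noteq> (y (inv_into UNIV (\<tau> s) v) \<in> A)}) / real d) < \<delta>"
    and 2: "(\<Sum>A\<in>part_join M T P F. \<bar>real (card {v. v < d \<and> y v \<in> A}) / real d - measure M A\<bar>) < \<delta>"
  shows "point_hom d y \<in> sofic_homs M T d \<tau> P F \<delta>"
proof -
  let ?R = "part_join M T P F"
  note R = fin_meas_partitionD[OF fin_meas_partition_part_join]
  have "bool_hom M ?R d (point_hom d y)"
    unfolding bool_hom_def
  proof (intro conjI ballI allI impI)
    fix A assume "A \<notin> part_alg ?R" then show "point_hom d y A = {}" by (simp add: point_hom_def)
  next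
    have "space M \<in> part_alg ?R" using part_alg_UN[of ?R ?R] R(4) by simp
    then show "point_hom d y (space M) = {..<d}" using y by (auto simp: point_hom_def)
  next
    fix A assume A: "A \<in> part_alg ?R"
    show "point_hom d y A \<subseteq> {..<d}" by (auto simp: point_hom_def)
    have "space M - A \<in> part_alg ?R" using part_alg_Diff[OF R(5) A] R(4) by simp
    then show "point_hom d y (space M - A) = {..<d} - point_hom d y A"
      using A y by (auto simp: point_hom_def)
    fix B assume "B \<in> part_alg ?R"
    then show "point_hom d y (A \<union> B) = point_hom d y A \<union> point_hom d y B"
      using A part_alg_Un[OF A] by (auto simp: point_hom_def)
  qed
  moreover have "(\<Sum>A\<in>P. real (card (symdiff (point_hom d y (T s ` A)) (\<tau> s ` point_hom d y A))) / real d) < \<delta>"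
    if s: "s \<in> F" for s
  proof -
    have sG: "s \<in> carrier G" using s F by auto
    have "symdiff (point_hom d y (T s ` A)) (\<tau> s ` point_hom d y A) =
      {v. v < d \<and> (T (inv\<^bsub>G\<^esub> s) (y v) \<in> A) \<noteq> (y (inv_into UNIV (\<tau> s) v) \<in> A)}" if A: "A \<in> P" for A
    proof -
      have "point_hom d y (T s ` A) = {v. v < d \<and> T (inv\<^bsub>G\<^esub> s) (y v) \<in> A}"
        using image_part_alg_part_join[OF A s] T_image_iff[OF sG P_subset[OF A]] y by (auto simp: point_hom_def)
      moreover have "\<tau> s ` point_hom d y A = {v. v < d \<and> y (inv_into UNIV (\<tau> s) v) \<in> A}"
      proof -
        have "A \<in> part_alg ?R" using part_alg_subset_part_join[OF part_alg_UN[of "{A}" P]] A by simp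
        then have "\<tau> s ` point_hom d y A = \<tau> s ` {v. v < d \<and> y v \<in> A}" by (simp add: point_hom_def)
        also have "\<dots> = {v. v < d \<and> y (inv_into UNIV (\<tau> s) v) \<in> A}"
        proof (intro equalityI subsetI)
          fix v assume "v \<in> \<tau> s ` {v. v < d \<and> y v \<in> A}"
          then obtain w where "w < d" "y w \<in> A" "v = \<tau> s w" by auto
          then show "v \<in> {v. v < d \<and> y (inv_into UNIV (\<tau> s) v) \<in> A}"
            using permutes_in_image[OF \<tau>[OF s], of w] permutes_inverses(2)[OF \<tau>[OF s], of w] by simp
        next
          fix v assume v: "v \<in> {v. v < d \<and> y (inv_into UNIV (\<tau> s) v) \<in> A}"
          have "inv_into UNIV (\<tau> s) v < d"
            using permutes_in_image[OF permutes_inv[OF \<tau>[OF s]], of v] v by simp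
          moreover have "v = \<tau> s (inv_into UNIV (\<tau> s) v)" using permutes_inverses(1)[OF \<tau>[OF s], of v] by simp
          ultimately show "v \<in> \<tau> s ` {v. v < d \<and> y v \<in> A}" using v by blast
        qed
        finally show ?thesis .
      qed
      ultimately show ?thesis by (auto simp: symdiff_def)
    qed
    then show ?thesis using 1[OF s] by simp
  qed
  moreover have "point_hom d y A = {v. v < d \<and> y v \<in> A}" if "A \<in> ?R" for A
    using part_alg_UN[of "{A}" ?R] that by (simp add: point_hom_def)
  ultimately show ?thesis using 2 by (simp add: sofic_homs_def)
qed

text \<open>A Boolean homomorphism sends the atoms to disjoint vertex sets covering all vertices.
  Atoms are nonempty, so any point of the atom over v can serve as \<open>y v\<close>.\<close>

lemma sofic_hom_points:
  assumes \<phi>: "bool_hom M (part_join M T P F) d \<phi>"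
  shows "\<exists>y. (\<forall>v<d. y v \<in> space M) \<and> (\<forall>A\<in>part_alg (part_join M T P F). \<phi> A = {v. v < d \<and> y v \<in> A})"
proof -
  let ?R = "part_join M T P F"
  note R = fin_meas_partitionD[OF fin_meas_partition_part_join]
  have sub: "\<And>A. A \<in> part_alg ?R \<Longrightarrow> \<phi> A \<subseteq> {..<d}" and sp: "\<phi> (space M) = {..<d}"
    and un: "\<And>A B. A \<in> part_alg ?R \<Longrightarrow> B \<in> part_alg ?R \<Longrightarrow> \<phi> (A \<union> B) = \<phi> A \<union> \<phi> B"
    and co: "\<And>A. A \<in> part_alg ?R \<Longrightarrow> \<phi> (space M - A) = {..<d} - \<phi> A"
    using \<phi> by (simp_all add: bool_hom_def)
  have spR: "space M \<in> part_alg ?R" using part_alg_UN[of ?R ?R] R(4) by simp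
  have emp: "\<phi> {} = {}" using co[OF spR] sp by simp
  have atom: "B \<in> ?R \<Longrightarrow> B \<in> part_alg ?R" for B using part_alg_UN[of "{B}" ?R] by simp
  have UN: "\<phi> (\<Union>Q) = (\<Union>B\<in>Q. \<phi> B)" if "Q \<subseteq> ?R" for Q
  proof -
    have "finite Q" using that R(1) finite_subset by blast
    then show ?thesis using that
    proof (induction Q rule: finite_induct)
      case (insert B Q)
      then show ?case using un[OF atom part_alg_UN, of B Q] by simp
    qed (simp add: emp)
  qed
  have "\<exists>B. B \<in> ?R \<and> v \<in> \<phi> B" if "v < d" for v
    using UN[of ?R] R(4) sp that by auto
  then obtain B where B: "\<And>v. v < d \<Longrightarrow> B v \<in> ?R" "\<And>v. v < d \<Longrightarrow> v \<in> \<phi> (B v)" by metis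
  have uniq: "C = B v" if "v < d" "C \<in> ?R" "v \<in> \<phi> C" for v C
  proof (rule ccontr)
    assume "C \<noteq> B v"
    then have "C \<subseteq> space M - B v"
      using part_join_unique[OF that(2) B(1)[OF that(1)]] R(4) that(2) by blast
    then have eq: "C \<union> (space M - B v) = space M - B v" by blast
    have "space M - B v \<in> part_alg ?R" using part_alg_Diff[OF R(5) atom[OF B(1)[OF that(1)]]] R(4) by simp
    then have "\<phi> C \<subseteq> \<phi> (space M - B v)" using un[OF atom[OF that(2)], of "space M - B v"] unfolding eq by blast
    then show False using co[OF atom[OF B(1)[OF that(1)]]] B(2)[OF that(1)] that(3) by blast
  qed
  have "\<exists>x. x \<in> B v" if "v < d" for v using B(1)[OF that] R(3) by (metis ex_in_conv)
  then obtain y where y: "\<And>v. v < d \<Longrightarrow> y v \<in> B v" by metis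
  have "y v \<in> space M" if "v < d" for v using y[OF that] B(1)[OF that] R(4) by blast
  moreover have "\<phi> A = {v. v < d \<and> y v \<in> A}" if A: "A \<in> part_alg ?R" for A
  proof (intro equalityI subsetI)
    obtain Q where Q: "A = \<Union>Q" "Q \<subseteq> ?R" using A by (auto simp: part_alg_def)
    fix v
    show "v \<in> {v. v < d \<and> y v \<in> A}" if v: "v \<in> \<phi> A"
    proof -
      have "v < d" using v sub[OF A] by auto
      obtain C where "C \<in> Q" "v \<in> \<phi> C" using v UN[OF Q(2)] Q(1) by auto
      then have "B v \<in> Q" using uniq[OF \<open>v < d\<close>] Q(2) by auto
      then show ?thesis using \<open>v < d\<close> y Q(1) by blast
    qed
    show "v \<in> \<phi> A" if v: "v \<in> {v. v < d \<and> y v \<in> A}"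
    proof -
      obtain C where C: "C \<in> Q" "y v \<in> C" using v Q(1) by auto
      then have "C = B v" using part_join_unique[of C "B v" "y v"] v B(1) y Q(2) by blast
      then show ?thesis using C UN[OF Q(2)] Q(1) B(2) v by auto
    qed
  qed
  ultimately show ?thesis by blast
qed

lemma part_alg_frequency_error:
  assumes A: "A \<in> part_alg (part_join M T P F)"
    and y: "(\<Sum>B\<in>part_join M T P F. \<bar>real (card {v. v < d \<and> y v \<in> B}) / real d - measure M B\<bar>) < \<delta>"
  shows "\<bar>real (card {v. v < d \<and> y v \<in> A}) / real d - measure M A\<bar> < \<delta>"
proof -
  let ?R = "part_join M T P F"
  note R = fin_meas_partitionD[OF fin_meas_partition_part_join]
  obtain Q where Q: "A = \<Union>Q" "Q \<subseteq> ?R" using A by (auto simp: part_alg_def)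
  have finQ: "finite Q" using Q(2) R(1) finite_subset by blast
  have "{v. v < d \<and> y v \<in> A} = (\<Union>B\<in>Q. {v. v < d \<and> y v \<in> B})" using Q(1) by auto
  then have "card {v. v < d \<and> y v \<in> A} = (\<Sum>B\<in>Q. card {v. v < d \<and> y v \<in> B})"
    unfolding \<open>{v. v < d \<and> y v \<in> A} = _\<close>
  proof (intro card_UN_disjoint finQ ballI impI)
    fix B C assume "B \<in> Q" "C \<in> Q" "B \<noteq> C"
    then show "{v. v < d \<and> y v \<in> B} \<inter> {v. v < d \<and> y v \<in> C} = {}"
      using part_join_unique[OF subsetD[OF Q(2)] subsetD[OF Q(2)]] by blast
  qed simp
  moreover have "measure M A = (\<Sum>B\<in>Q. measure M B)"
    unfolding Q(1) using R(2,5) Q(2) finQ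
    by (intro measure_Union') (auto simp: fmeasurable_eq_sets disjoint_def pairwise_def disjnt_def)
  ultimately have "real (card {v. v < d \<and> y v \<in> A}) / real d - measure M A =
     (\<Sum>B\<in>Q. real (card {v. v < d \<and> y v \<in> B}) / real d - measure M B)"
    by (simp add: sum_subtractf sum_divide_distrib)
  then have "\<bar>real (card {v. v < d \<and> y v \<in> A}) / real d - measure M A\<bar> \<le>
     (\<Sum>B\<in>Q. \<bar>real (card {v. v < d \<and> y v \<in> B}) / real d - measure M B\<bar>)"
    by (simp add: sum_abs)
  also have "\<dots> \<le> (\<Sum>B\<in>?R. \<bar>real (card {v. v < d \<and> y v \<in> B}) / real d - measure M B\<bar>)"
    using Q(2) R(1) by (intro sum_mono2) auto
  finally show ?thesis using y by linarith
qed

text \<open>Finiteness matters because \<open>card\<close> of an infinite set is 0, which would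
  destroy lower bounds for \<open>restr_count\<close>.\<close>

lemma finite_restrictions:
  assumes Q: "finite Q"
  shows "finite ((\<lambda>\<phi> A. if A \<in> part_alg Q then \<phi> A else {}) ` sofic_homs M T d \<tau> P F \<delta>)"
proof (rule finite_subset)
  show "(\<lambda>\<phi> A. if A \<in> part_alg Q then \<phi> A else {}) ` sofic_homs M T d \<tau> P F \<delta> \<subseteq>
     {f. \<forall>A. (A \<in> part_alg Q \<longrightarrow> f A \<in> Pow {..<d}) \<and> (A \<notin> part_alg Q \<longrightarrow> f A = {})}"
  proof
    fix f assume "f \<in> (\<lambda>\<phi> A. if A \<in> part_alg Q then \<phi> A else {}) ` sofic_homs M T d \<tau> P F \<delta>"
    then obtain \<phi> where \<phi>: "\<phi> \<in> sofic_homs M T d \<tau> P F \<delta>" "f = (\<lambda>A. if A \<in> part_alg Q then \<phi> A else {})" by auto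
    then have "\<phi> A \<subseteq> {..<d}" for A
      by (cases "A \<in> part_alg (part_join M T P F)") (auto simp: sofic_homs_def bool_hom_def)
    then show "f \<in> {f. \<forall>A. (A \<in> part_alg Q \<longrightarrow> f A \<in> Pow {..<d}) \<and> (A \<notin> part_alg Q \<longrightarrow> f A = {})}"
      using \<phi>(2) by auto
  qed
  show "finite {f. \<forall>A. (A \<in> part_alg Q \<longrightarrow> f A \<in> Pow {..<d}) \<and> (A \<notin> part_alg Q \<longrightarrow> f A = {})}"
    using finite_part_alg[OF Q] by (intro finite_set_of_finite_funs) auto
qed

end

end

section \<open>Entropy bounds in terms of homomorphisms\<close>

text \<open>An empty set of homomorphisms has \<open>log_count\<close> equal to -\<infinity>.
  Nonnegative entropy prevents this from happening eventually, for all P refining one fixed Q; since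
  the entropy uses a limsup, existence is obtained for infinitely many i only.\<close>

lemma sofic_entropy_nonneg_homs:
  assumes "sofic_entropy G d \<sigma> M T \<ge> 0"
  obtains Q where "fin_meas_partition M Q" "\<And>P F \<delta>. fin_meas_partition M P \<Longrightarrow> refines P Q \<Longrightarrow> finite F \<Longrightarrow>
     F \<subseteq> carrier G \<Longrightarrow> \<one>\<^bsub>G\<^esub> \<in> F \<Longrightarrow> \<delta> > 0 \<Longrightarrow> \<exists>\<^sub>F i in sequentially. sofic_homs M T (d i) (\<sigma> i) P F \<delta> \<noteq> {}"
proof -
  \<comment> \<open>Any negative threshold would do; strictness lets a single Q witness the
    supremum.\<close>
  have "- 1 < sofic_entropy G d \<sigma> M T" using assms by (rule less_le_trans[rotated]) simp
  then obtain Q where Q: "fin_meas_partition M Q" and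
    "-1 < (INF P\<in>{P. fin_meas_partition M P \<and> refines P Q}.
        INF F\<in>{F. finite F \<and> F \<subseteq> carrier G \<and> \<one>\<^bsub>G\<^esub> \<in> F}.
         INF \<delta>\<in>{\<delta>::real. \<delta> > 0}.
          limsup (\<lambda>i. log_count (d i) (restr_count Q (sofic_homs M T (d i) (\<sigma> i) P F \<delta>))))" (is "_ < ?I")
    unfolding sofic_entropy_def less_SUP_iff by auto
  note I = this(2)
  have "\<exists>\<^sub>F i in sequentially. sofic_homs M T (d i) (\<sigma> i) P F \<delta> \<noteq> {}"
    if "fin_meas_partition M P" "refines P Q" "finite F" "F \<subseteq> carrier G" "\<one>\<^bsub>G\<^esub> \<in> F" "\<delta> > 0" for P F \<delta>
  proof (rule ccontr)
    assume "\<not> ?thesis"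
    then have ev: "\<forall>\<^sub>F i in sequentially. log_count (d i) (restr_count Q (sofic_homs M T (d i) (\<sigma> i) P F \<delta>)) = -\<infinity>"
      unfolding not_frequently by (auto elim!: eventually_mono simp: restr_count_def log_count_def)
    have "?I \<le> limsup (\<lambda>i. log_count (d i) (restr_count Q (sofic_homs M T (d i) (\<sigma> i) P F \<delta>)))"
      using that by (intro INF_lower2[of P] INF_lower2[of F] INF_lower2[of \<delta>]) auto
    also have "\<dots> = limsup (\<lambda>i. -\<infinity>)" using ev by (rule Limsup_eq)
    also have "\<dots> = (-\<infinity> :: ereal)" by (simp add: Limsup_const)
    finally show False using I by simp
  qed
  then show ?thesis using Q that by simp
qed

text \<open>The witness Q may vary with r because the entropy is a supremum over Q, and growth along
  infinitely many i is enough because of the limsup.\<close>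

lemma sofic_entropy_eq_infinity:
  assumes "\<And>r::real. \<exists>Q. fin_meas_partition M Q \<and> (\<forall>P F \<delta>. fin_meas_partition M P \<longrightarrow> refines P Q \<longrightarrow> finite F \<longrightarrow>
     F \<subseteq> carrier G \<longrightarrow> \<one>\<^bsub>G\<^esub> \<in> F \<longrightarrow> \<delta> > 0 \<longrightarrow>
     (\<exists>\<^sub>F i in sequentially. 0 < d i \<and> exp (r * real (d i)) \<le> real (restr_count Q (sofic_homs M T (d i) (\<sigma> i) P F \<delta>))))"
  shows "sofic_entropy G d \<sigma> M T = \<infinity>"
proof (rule ereal_top)
  fix r :: real
  obtain Q where Q: "fin_meas_partition M Q" and homs: "\<And>P F \<delta>. fin_meas_partition M P \<Longrightarrow> refines P Q \<Longrightarrow> finite F \<Longrightarrow>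
     F \<subseteq> carrier G \<Longrightarrow> \<one>\<^bsub>G\<^esub> \<in> F \<Longrightarrow> \<delta> > 0 \<Longrightarrow>
     (\<exists>\<^sub>F i in sequentially. 0 < d i \<and> exp (r * real (d i)) \<le> real (restr_count Q (sofic_homs M T (d i) (\<sigma> i) P F \<delta>)))"
    using assms[of r] by blast
  have "ereal r \<le> limsup (\<lambda>i. log_count (d i) (restr_count Q (sofic_homs M T (d i) (\<sigma> i) P F \<delta>)))"
    if "fin_meas_partition M P" "refines P Q" "finite F" "F \<subseteq> carrier G" "\<one>\<^bsub>G\<^esub> \<in> F" "\<delta> > 0" for P F \<delta>
  proof (rule ccontr)
    assume "\<not> ?thesis"
    then have "limsup (\<lambda>i. log_count (d i) (restr_count Q (sofic_homs M T (d i) (\<sigma> i) P F \<delta>))) < ereal r"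
      by (simp add: not_le)
    then have "\<forall>\<^sub>F i in sequentially. log_count (d i) (restr_count Q (sofic_homs M T (d i) (\<sigma> i) P F \<delta>)) < ereal r"
      by (rule Limsup_lessD)
    from frequently_eventually_frequently[OF homs[OF that] this]
    have "\<exists>\<^sub>F i in sequentially. False"
    proof (rule frequently_elim1)
      fix i
      let ?N = "restr_count Q (sofic_homs M T (d i) (\<sigma> i) P F \<delta>)"
      assume i: "(0 < d i \<and> exp (r * real (d i)) \<le> real ?N) \<and> log_count (d i) ?N < ereal r"
      have N: "0 < real ?N" using i by (meson exp_gt_zero less_le_trans)
      have "r * real (d i) \<le> ln (real ?N)" using i N by (simp add: ln_ge_iff)
      then have "r \<le> ln (real ?N) / real (d i)" using i by (simp add: pos_le_divide_eq)
      then show False using N i by (auto simp: log_count_def)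
    qed
    then show False by simp
  qed
  then have "ereal r \<le> (INF P\<in>{P. fin_meas_partition M P \<and> refines P Q}.
        INF F\<in>{F. finite F \<and> F \<subseteq> carrier G \<and> \<one>\<^bsub>G\<^esub> \<in> F}.
         INF \<delta>\<in>{\<delta>::real. \<delta> > 0}.
          limsup (\<lambda>i. log_count (d i) (restr_count Q (sofic_homs M T (d i) (\<sigma> i) P F \<delta>))))"
    by (intro INF_greatest) auto
  also have "\<dots> \<le> sofic_entropy G d \<sigma> M T"
    unfolding sofic_entropy_def using Q by (intro SUP_upper) auto
  finally show "ereal r \<le> sofic_entropy G d \<sigma> M T" .
qed

text \<open>Once the partition refines the level sets of \<kappa>, a vertex with mismatched labels
  lies in the defect set of some cell, and level sets are unions of atoms. Almost equivariance and
  frequencies of a homomorphism thus pass to the labels of points chosen for it.\<close>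

lemma (in pmp_system) sofic_labels:
  fixes \<kappa> :: "'x \<Rightarrow> nat"
  assumes h: "sofic_entropy G d \<sigma> M T \<ge> 0" and perm: "\<And>i s. s \<in> carrier G \<Longrightarrow> \<sigma> i s permutes {..<d i}"
    and \<kappa>: "\<kappa> \<in> M \<rightarrow>\<^sub>M count_space UNIV" "\<And>x. \<kappa> x < m"
    and F: "finite F" "F \<subseteq> carrier G" "\<one>\<^bsub>G\<^esub> \<in> F" and \<delta>: "\<delta> > 0"
  shows "\<exists>\<^sub>F i in sequentially. \<exists>y. (\<forall>v<d i. y v \<in> space M) \<and>
    (\<forall>s\<in>F. real (card {v. v < d i \<and> \<kappa> (T (inv\<^bsub>G\<^esub> s) (y v)) \<noteq> \<kappa> (y (inv_into UNIV (\<sigma> i s) v))}) \<le> \<delta> * real (d i)) \<and>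
    (\<forall>l. \<bar>real (card {v. v < d i \<and> \<kappa> (y v) = l}) / real (d i) - measure M {x\<in>space M. \<kappa> x = l}\<bar> < \<delta>)"
proof -
  obtain Q where Q: "fin_meas_partition M Q" and homs: "\<And>P F \<delta>. fin_meas_partition M P \<Longrightarrow> refines P Q \<Longrightarrow> finite F \<Longrightarrow>
     F \<subseteq> carrier G \<Longrightarrow> \<one>\<^bsub>G\<^esub> \<in> F \<Longrightarrow> \<delta> > 0 \<Longrightarrow> (\<exists>\<^sub>F i in sequentially. sofic_homs M T (d i) (\<sigma> i) P F \<delta> \<noteq> {})"
    by (rule sofic_entropy_nonneg_homs[OF h]) blast
  have "\<kappa> ` space M \<subseteq> {..<m}" using \<kappa>(2) by (simp add: image_subset_iff)
  then have "finite (\<kappa> ` space M)" by (rule finite_subset) simp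
  from fin_meas_partition_common_refinement[OF Q \<kappa>(1) this] obtain P where
    P: "fin_meas_partition M P" "refines P Q" and P\<kappa>: "\<And>A x x'. A \<in> P \<Longrightarrow> x \<in> A \<Longrightarrow> x' \<in> A \<Longrightarrow> \<kappa> x = \<kappa> x'" by metis
  note PD = fin_meas_partitionD[OF P(1)]
  let ?R = "part_join M T P F"
  show ?thesis
    using homs[OF P F \<delta>]
  proof (rule frequently_elim1)
    fix i assume "sofic_homs M T (d i) (\<sigma> i) P F \<delta> \<noteq> {}"
    then obtain \<phi> where \<phi>: "bool_hom M ?R (d i) \<phi>"
      "\<And>s. s \<in> F \<Longrightarrow> (\<Sum>A\<in>P. real (card (symdiff (\<phi> (T s ` A)) (\<sigma> i s ` \<phi> A))) / real (d i)) < \<delta>"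
      "(\<Sum>A\<in>?R. \<bar>real (card (\<phi> A)) / real (d i) - measure M A\<bar>) < \<delta>"
      by (auto simp: sofic_homs_def)
    obtain y where y: "\<And>v. v < d i \<Longrightarrow> y v \<in> space M" "\<And>A. A \<in> part_alg ?R \<Longrightarrow> \<phi> A = {v. v < d i \<and> y v \<in> A}"
      using sofic_hom_points[OF P(1) F \<phi>(1)] by blast
    have atom: "B \<in> ?R \<Longrightarrow> B \<in> part_alg ?R" for B using part_alg_UN[of "{B}" ?R] by simp
    have freq: "(\<Sum>B\<in>?R. \<bar>real (card {v. v < d i \<and> y v \<in> B}) / real (d i) - measure M B\<bar>) < \<delta>"
      using \<phi>(3) y(2)[OF atom] by simp
    show "\<exists>y. (\<forall>v<d i. y v \<in> space M) \<and>
      (\<forall>s\<in>F. real (card {v. v < d i \<and> \<kappa> (T (inv\<^bsub>G\<^esub> s) (y v)) \<noteq> \<kappa> (y (inv_into UNIV (\<sigma> i s) v))}) \<le> \<delta> * real (d i)) \<and>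
      (\<forall>l. \<bar>real (card {v. v < d i \<and> \<kappa> (y v) = l}) / real (d i) - measure M {x\<in>space M. \<kappa> x = l}\<bar> < \<delta>)"
    proof (intro exI[of _ y] conjI allI impI ballI)
      fix l
      have "{x\<in>space M. \<kappa> x = l} \<in> part_alg P"
      proof (rule part_algI)
        fix B assume "B \<in> P" "B \<inter> {x\<in>space M. \<kappa> x = l} \<noteq> {}"
        then show "B \<subseteq> {x\<in>space M. \<kappa> x = l}" using P\<kappa>[of B] PD(4) by blast
      qed (use PD(4) in auto)
      then have "{x\<in>space M. \<kappa> x = l} \<in> part_alg ?R" using part_alg_subset_part_join[OF P(1) F] by blast
      from part_alg_frequency_error[OF P(1) F this freq]
      have "\<bar>real (card {v. v < d i \<and> y v \<in> {x\<in>space M. \<kappa> x = l}}) / real (d i) - measure M {x\<in>space M. \<kappa> x = l}\<bar> < \<delta>" .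
      also have "{v. v < d i \<and> y v \<in> {x\<in>space M. \<kappa> x = l}} = {v. v < d i \<and> \<kappa> (y v) = l}" using y(1) by auto
      finally show "\<bar>real (card {v. v < d i \<and> \<kappa> (y v) = l}) / real (d i) - measure M {x\<in>space M. \<kappa> x = l}\<bar> < \<delta>" .
    next
      fix s assume s: "s \<in> F"
      then have sG: "s \<in> carrier G" using F by auto
      have "\<sigma> i s permutes {..<d i}" using perm[OF sG] .
      note inverse = permutes_inverses[OF this] and invd = permutes_in_image[OF permutes_inv[OF this]]
      have "{v. v < d i \<and> \<kappa> (T (inv\<^bsub>G\<^esub> s) (y v)) \<noteq> \<kappa> (y (inv_into UNIV (\<sigma> i s) v))}
         \<subseteq> (\<Union>A\<in>P. symdiff (\<phi> (T s ` A)) (\<sigma> i s ` \<phi> A))"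
      proof
        fix v assume v: "v \<in> {v. v < d i \<and> \<kappa> (T (inv\<^bsub>G\<^esub> s) (y v)) \<noteq> \<kappa> (y (inv_into UNIV (\<sigma> i s) v))}"
        have "T (inv\<^bsub>G\<^esub> s) (y v) \<in> space M" using v y(1) sG by (intro T_space) auto
        then obtain A where A: "A \<in> P" "T (inv\<^bsub>G\<^esub> s) (y v) \<in> A" using PD(4) by blast
        have As: "A \<subseteq> space M" using A PD(4) by blast
        have "v \<in> \<phi> (T s ` A)"
          using y(2)[OF image_part_alg_part_join[OF P(1) F A(1) s]] T_image_iff[OF sG As] A v y(1) by auto
        moreover have "v \<notin> \<sigma> i s ` \<phi> A"
        proof
          assume "v \<in> \<sigma> i s ` \<phi> A"
          then obtain w where w: "w \<in> \<phi> A" "v = \<sigma> i s w" by auto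
          have "A \<in> part_alg ?R" using part_alg_subset_part_join[OF P(1) F part_alg_UN[of "{A}" P]] A by simp
          then have "y w \<in> A" using w(1) y(2) by simp
          moreover have "w = inv_into UNIV (\<sigma> i s) v" using w(2) inverse(2) by simp
          ultimately show False using P\<kappa>[OF A(1) A(2)] v by auto
        qed
        ultimately show "v \<in> (\<Union>A\<in>P. symdiff (\<phi> (T s ` A)) (\<sigma> i s ` \<phi> A))" using A(1) by (auto simp: symdiff_def)
      qed
      moreover have fin: "finite (symdiff (\<phi> (T s ` A)) (\<sigma> i s ` \<phi> A))" if "A \<in> P" for A
      proof -
        have "\<phi> B \<subseteq> {..<d i}" for B
          using \<phi>(1) by (cases "B \<in> part_alg ?R") (auto simp: bool_hom_def)
        then have "finite (\<phi> B)" for B using finite_subset by blast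
        then show ?thesis by (simp add: symdiff_def)
      qed
      ultimately have "card {v. v < d i \<and> \<kappa> (T (inv\<^bsub>G\<^esub> s) (y v)) \<noteq> \<kappa> (y (inv_into UNIV (\<sigma> i s) v))}
         \<le> card (\<Union>A\<in>P. symdiff (\<phi> (T s ` A)) (\<sigma> i s ` \<phi> A))"
        using PD(1) by (intro card_mono) auto
      also have "\<dots> \<le> (\<Sum>A\<in>P. card (symdiff (\<phi> (T s ` A)) (\<sigma> i s ` \<phi> A)))"
        using PD(1) by (intro card_UN_le)
      finally have "real (card {v. v < d i \<and> \<kappa> (T (inv\<^bsub>G\<^esub> s) (y v)) \<noteq> \<kappa> (y (inv_into UNIV (\<sigma> i s) v))})
         \<le> (\<Sum>A\<in>P. real (card (symdiff (\<phi> (T s ` A)) (\<sigma> i s ` \<phi> A))))"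
        unfolding of_nat_sum[symmetric] of_nat_le_iff .
      also have "\<dots> = real (d i) * (\<Sum>A\<in>P. real (card (symdiff (\<phi> (T s ` A)) (\<sigma> i s ` \<phi> A))) / real (d i))"
      \<comment> \<open>For \<open>d i = 0\<close> the quotients are 0 by convention, but then all
        values of the homomorphism are empty too.\<close>
      proof (cases "d i = 0")
        case True
        have "\<phi> B = {}" for B
          using \<phi>(1) True by (cases "B \<in> part_alg ?R") (auto simp: bool_hom_def)
        then show ?thesis using True by (simp add: symdiff_def)
      qed (simp add: sum_distrib_left)
      also have "\<dots> \<le> real (d i) * \<delta>" using \<phi>(2)[OF s] by (intro mult_left_mono) auto
      finally show "real (card {v. v < d i \<and> \<kappa> (T (inv\<^bsub>G\<^esub> s) (y v)) \<noteq> \<kappa> (y (inv_into UNIV (\<sigma> i s) v))}) \<le> \<delta> * real (d i)"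
        by (simp add: mult.commute)
    qed (rule y(1))
  qed
qed

section \<open>Counting, approximation by labels, and sofic error sets\<close>

lemma card_eq_sum_indicator:
  "real (card {v. v < d \<and> \<omega> \<in> E v}) = (\<Sum>v<d::nat. indicat_real (E v) \<omega>)"
proof -
  have "{v. v < d \<and> \<omega> \<in> E v} = {..<d} \<inter> {v. \<omega> \<in> E v}" by auto
  then show ?thesis by (simp add: indicator_def sum.If_cases)
qed

lemma (in prob_space) integrable_card:
  assumes "\<And>v. v < d \<Longrightarrow> E v \<in> events"
  shows "integrable M (\<lambda>\<omega>. real (card {v::nat. v < d \<and> \<omega> \<in> E v}))"
  unfolding card_eq_sum_indicator
  using assms by (intro Bochner_Integration.integrable_sum integrable_real_indicator) (auto simp: emeasure_eq_measure)

lemma (in prob_space) expectation_card: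
  assumes "\<And>v. v < d \<Longrightarrow> E v \<in> events"
  shows "expectation (\<lambda>\<omega>. real (card {v::nat. v < d \<and> \<omega> \<in> E v})) = (\<Sum>v<d. prob (E v))"
  unfolding card_eq_sum_indicator
  using assms by (subst Bochner_Integration.integral_sum) (auto intro!: integrable_real_indicator simp: emeasure_eq_measure)

text \<open>When the square is expanded, pairs with product probabilities cancel, and each event
  keeps at most D partners, each contributing at most 1. The variance is therefore at most d * D,
  and the mean modulus is at most its root.\<close>

lemma (in prob_space) card_deviation:
  fixes d D :: nat
  assumes E: "\<And>v. v < d \<Longrightarrow> E v \<in> events"
    and dep: "\<And>v. v < d \<Longrightarrow> card {w. w < d \<and> prob (E v \<inter> E w) \<noteq> prob (E v) * prob (E w)} \<le> D"
  shows "expectation (\<lambda>\<omega>. \<bar>real (card {v. v < d \<and> \<omega> \<in> E v}) - (\<Sum>v<d. prob (E v))\<bar>) \<le> sqrt (real d * real D)"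
proof -
  define X where "X \<omega> = (\<Sum>v<d. indicat_real (E v) \<omega> - prob (E v))" for \<omega>
  have ind: "integrable M (indicat_real (E v))" if "v < d" for v
    using E[OF that] by (intro integrable_real_indicator) (auto simp: emeasure_eq_measure)
  have XE: "X \<omega> = real (card {v. v < d \<and> \<omega> \<in> E v}) - (\<Sum>v<d. prob (E v))" for \<omega>
    unfolding X_def card_eq_sum_indicator by (simp add: sum_subtractf)
  have X: "integrable M X" unfolding X_def[abs_def]
    using ind by (intro Bochner_Integration.integrable_sum Bochner_Integration.integrable_diff) auto
  have "(X \<omega>)\<^sup>2 = (\<Sum>v<d. \<Sum>w<d. indicat_real (E v \<inter> E w) \<omega> - prob (E w) * indicat_real (E v) \<omega>
      - prob (E v) * indicat_real (E w) \<omega> + prob (E v) * prob (E w))" for \<omega>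
    unfolding X_def power2_eq_square sum_product
    by (intro sum.cong refl) (simp add: indicator_inter_arith algebra_simps)
  note X2 = this
  have trm: "integrable M (\<lambda>\<omega>. indicat_real (E v \<inter> E w) \<omega> - prob (E w) * indicat_real (E v) \<omega>
      - prob (E v) * indicat_real (E w) \<omega> + prob (E v) * prob (E w))" (is ?i)
    "expectation (\<lambda>\<omega>. indicat_real (E v \<inter> E w) \<omega> - prob (E w) * indicat_real (E v) \<omega>
      - prob (E v) * indicat_real (E w) \<omega> + prob (E v) * prob (E w)) = prob (E v \<inter> E w) - prob (E v) * prob (E w)" (is ?e)
    if vw: "v < d" "w < d" for v w
  proof -
    have i: "integrable M (indicat_real (E v \<inter> E w))"
      using E vw by (intro integrable_real_indicator) (auto simp: emeasure_eq_measure)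
    show ?i using i ind vw by auto
    show ?e using i ind[OF vw(1)] ind[OF vw(2)] E[OF vw(1)] E[OF vw(2)] by (simp add: prob_space)
  qed
  have X2i: "integrable M (\<lambda>\<omega>. (X \<omega>)\<^sup>2)"
    unfolding X2 using trm(1) by (intro Bochner_Integration.integrable_sum) auto
  have "expectation (\<lambda>\<omega>. (X \<omega>)\<^sup>2) = (\<Sum>v<d. \<Sum>w<d. prob (E v \<inter> E w) - prob (E v) * prob (E w))"
    unfolding X2 using trm
    by (subst Bochner_Integration.integral_sum) (auto intro!: Bochner_Integration.integrable_sum sum.cong simp: Bochner_Integration.integral_sum)
  also have "\<dots> \<le> (\<Sum>v<d. real D)"
  proof (rule sum_mono)
    fix v assume "v \<in> {..<d}"
    then have v: "v < d" by simp
    let ?S = "{w. w < d \<and> prob (E v \<inter> E w) \<noteq> prob (E v) * prob (E w)}"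
    have "(\<Sum>w<d. prob (E v \<inter> E w) - prob (E v) * prob (E w)) = (\<Sum>w\<in>?S. prob (E v \<inter> E w) - prob (E v) * prob (E w))"
      by (intro sum.mono_neutral_right) auto
    also have "\<dots> \<le> (\<Sum>w\<in>?S. 1)"
    proof (rule sum_mono)
      fix w
      have "prob (E v \<inter> E w) \<le> 1" "0 \<le> prob (E v) * prob (E w)" by simp_all
      then show "prob (E v \<inter> E w) - prob (E v) * prob (E w) \<le> 1" by linarith
    qed
    also have "\<dots> \<le> real D" using dep[OF v] by simp
    finally show "(\<Sum>w<d. prob (E v \<inter> E w) - prob (E v) * prob (E w)) \<le> real D" .
  qed
  finally have "expectation (\<lambda>\<omega>. (X \<omega>)\<^sup>2) \<le> real d * real D" by simp
  moreover have "(expectation (\<lambda>\<omega>. \<bar>X \<omega>\<bar>))\<^sup>2 \<le> expectation (\<lambda>\<omega>. (X \<omega>)\<^sup>2)"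
  proof -
    have "variance (\<lambda>\<omega>. \<bar>X \<omega>\<bar>) = expectation (\<lambda>\<omega>. \<bar>X \<omega>\<bar>\<^sup>2) - (expectation (\<lambda>\<omega>. \<bar>X \<omega>\<bar>))\<^sup>2"
      using X X2i by (intro variance_eq) auto
    then show ?thesis using variance_positive[of "\<lambda>\<omega>. \<bar>X \<omega>\<bar>"] by simp
  qed
  ultimately have "expectation (\<lambda>\<omega>. \<bar>X \<omega>\<bar>) \<le> sqrt (real d * real D)"
    by (intro real_le_rsqrt) linarith
  then show ?thesis by (simp add: XE)
qed

text \<open>The fibres of \<Phi> cover \<Omega> and each weighs at most q, so there must be many of
  them. A fibre is weighed through an event containing it up to a null set, which allows \<Phi> to
  be an arbitrary map.\<close>

lemma (in prob_space) card_image_from_small_prob: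
  assumes fin: "finite (\<Phi> ` \<Omega>)" and \<Omega>: "\<Omega> \<in> events" "prob \<Omega> \<ge> 1/2"
    and small: "\<And>\<omega>\<^sub>0. \<omega>\<^sub>0 \<in> \<Omega> \<Longrightarrow> \<exists>E\<in>events. prob E \<le> q \<and> (AE \<omega> in M. \<omega> \<in> \<Omega> \<longrightarrow> \<Phi> \<omega> = \<Phi> \<omega>\<^sub>0 \<longrightarrow> \<omega> \<in> E)"
  shows "1/2 \<le> real (card (\<Phi> ` \<Omega>)) * q"
proof -
  define R where "R f E \<longleftrightarrow> E \<in> events \<and> prob E \<le> q \<and> (AE \<omega> in M. \<omega> \<in> \<Omega> \<longrightarrow> \<Phi> \<omega> = f \<longrightarrow> \<omega> \<in> E)" for f E
  have "\<forall>f\<in>\<Phi> ` \<Omega>. \<exists>E. R f E"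
    using small by (auto simp: R_def)
  then obtain E where "\<And>f. f \<in> \<Phi> ` \<Omega> \<Longrightarrow> R f (E f)" by metis
  then have E: "\<And>f. f \<in> \<Phi> ` \<Omega> \<Longrightarrow> E f \<in> events" "\<And>f. f \<in> \<Phi> ` \<Omega> \<Longrightarrow> prob (E f) \<le> q"
    and ae: "\<And>f. f \<in> \<Phi> ` \<Omega> \<Longrightarrow> AE \<omega> in M. \<omega> \<in> \<Omega> \<longrightarrow> \<Phi> \<omega> = f \<longrightarrow> \<omega> \<in> E f" unfolding R_def by simp_all
  have "AE \<omega> in M. \<forall>f\<in>\<Phi> ` \<Omega>. \<omega> \<in> \<Omega> \<longrightarrow> \<Phi> \<omega> = f \<longrightarrow> \<omega> \<in> E f"
    using ae fin by (intro AE_finite_allI) auto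
  then have "AE \<omega> in M. \<omega> \<in> \<Omega> \<longrightarrow> \<omega> \<in> (\<Union>f\<in>\<Phi> ` \<Omega>. E f)" by eventually_elim auto
  then have "prob \<Omega> \<le> prob (\<Union>f\<in>\<Phi> ` \<Omega>. E f)"
    using E(1) fin by (intro finite_measure_mono_AE sets.finite_UN) auto
  also have "\<dots> \<le> (\<Sum>f\<in>\<Phi> ` \<Omega>. prob (E f))"
    using E(1) fin by (intro finite_measure_subadditive_finite) auto
  also have "\<dots> \<le> (\<Sum>f\<in>\<Phi> ` \<Omega>. q)" using E(2) by (intro sum_mono)
  finally show ?thesis using \<Omega>(2) by simp
qed

section \<open>Finite labels for the second factor\<close>

lemma joint_label:
  fixes \<kappa> :: "'a \<Rightarrow> 'y \<Rightarrow> nat"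
  assumes "finite I" "\<And>a. a \<in> I \<Longrightarrow> \<kappa> a \<in> N \<rightarrow>\<^sub>M count_space UNIV" "\<And>a y. a \<in> I \<Longrightarrow> \<kappa> a y < m a"
  shows "\<exists>k (n::nat) r. k \<in> N \<rightarrow>\<^sub>M count_space UNIV \<and> (\<forall>y. k y < n) \<and> (\<forall>a\<in>I. \<forall>y. \<kappa> a y = r a (k y))"
  using assms
proof (induction I rule: finite_induct)
  case empty
  then show ?case by (intro exI[of _ "\<lambda>_. 0"] exI[of _ 1]) auto
next
  case (insert a I)
  have "\<exists>k (n::nat) r. k \<in> N \<rightarrow>\<^sub>M count_space UNIV \<and> (\<forall>y. k y < n) \<and> (\<forall>a\<in>I. \<forall>y. \<kappa> a y = r a (k y))"
    by (rule insert.IH) (use insert.prems in auto)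
  then obtain k and n :: nat and r where krn: "k \<in> N \<rightarrow>\<^sub>M count_space UNIV \<and> (\<forall>y. k y < n) \<and> (\<forall>a\<in>I. \<forall>y. \<kappa> a y = r a (k y))"
    by blast
  then have k [measurable]: "k \<in> N \<rightarrow>\<^sub>M count_space UNIV" and kn: "\<And>y. k y < n"
    and r: "\<And>b y. b \<in> I \<Longrightarrow> \<kappa> b y = r b (k y)" by simp_all
  have [measurable]: "\<kappa> a \<in> N \<rightarrow>\<^sub>M count_space UNIV" using insert by auto
  let ?k = "\<lambda>y. \<kappa> a y * n + k y"
  let ?r = "\<lambda>b l. if b = a then l div n else r b (l mod n)"
  have "?k \<in> N \<rightarrow>\<^sub>M count_space UNIV" by measurable
  moreover have "?k y < m a * n" for y
  proof -
    have "?k y < Suc (\<kappa> a y) * n" using kn by simp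
    also have "\<dots> \<le> m a * n" using insert by (intro mult_right_mono) (auto simp: Suc_le_eq)
    finally show ?thesis .
  qed
  moreover have "\<kappa> b y = ?r b (?k y)" if "b \<in> insert a I" for b y
    using that kn[of y] r[of b y] insert.hyps by (auto simp: div_mult_self3[OF less_imp_neq[THEN not_sym]])
  ultimately show ?case
    by (intro exI[of _ ?k] exI[of _ "m a * n"] exI[of _ ?r] conjI allI ballI)
qed

text \<open>By Fubini and Markov, a symmetric difference of measure below e^2 has sections of
  measure below e outside a set of y of measure at most e. Being exceptional is made part of the
  label, so that control of label frequencies also controls how often exceptional points
  occur.\<close>

lemma approx_family:
  assumes M: "prob_space M" and N: "prob_space N" and fin: "finite \<A>" and \<A>: "\<A> \<subseteq> sets (M \<Otimes>\<^sub>M N)" and \<eta>: "\<eta> > 0"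
  shows "\<exists>k (n::nat) C Bad. k \<in> N \<rightarrow>\<^sub>M count_space UNIV \<and> (\<forall>y. k y < n) \<and> (\<forall>A l. C A l \<in> sets M) \<and>
     (\<forall>A\<in>\<A>. \<forall>y\<in>space N. k y \<notin> Bad \<longrightarrow> measure M (symdiff {x\<in>space M. (x, y) \<in> A} (C A (k y))) \<le> \<eta>) \<and>
     measure N {y\<in>space N. k y \<in> Bad} \<le> \<eta>"
proof -
  interpret M: prob_space M by fact
  interpret N: prob_space N by fact
  interpret P: pair_prob_space M N ..
  \<comment> \<open>The exceptional sets of the finitely many A add up to at most \<eta>; the
    \<open>+ 1\<close> covers an empty family.\<close>
  define e where "e = \<eta> / (real (card \<A>) + 1)"
  have e: "e > 0" "e \<le> \<eta>" "real (card \<A>) * e \<le> \<eta>"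
    using \<eta> by (auto simp: e_def field_simps)
  define R where "R A \<kappa> C m \<longleftrightarrow> \<kappa> \<in> measurable N (count_space UNIV) \<and> (\<forall>y. \<kappa> y < m) \<and> (\<forall>l. C l \<in> sets M) \<and>
     measure (M \<Otimes>\<^sub>M N) (symdiff A {p \<in> space (M \<Otimes>\<^sub>M N). fst p \<in> C (\<kappa> (snd p))}) < e\<^sup>2"
    for A and \<kappa> :: "'b \<Rightarrow> nat" and C m
  have "\<forall>A\<in>\<A>. \<exists>\<kappa> C m. R A \<kappa> C m"
    unfolding R_def using \<A> e by (intro ballI approx_sections M N) auto
  then obtain \<kappa> C m where R: "\<And>A. A \<in> \<A> \<Longrightarrow> R A (\<kappa> A) (C A) (m A)" by metis
  have \<kappa>: "\<And>A. A \<in> \<A> \<Longrightarrow> \<kappa> A \<in> measurable N (count_space UNIV)"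
    and m: "\<And>A y. A \<in> \<A> \<Longrightarrow> \<kappa> A y < m A" and C: "\<And>A l. A \<in> \<A> \<Longrightarrow> C A l \<in> sets M"
    and close: "\<And>A. A \<in> \<A> \<Longrightarrow> measure (M \<Otimes>\<^sub>M N) (symdiff A {p \<in> space (M \<Otimes>\<^sub>M N). fst p \<in> C A (\<kappa> A (snd p))}) < e\<^sup>2"
    using R unfolding R_def by simp_all
  define S where "S A = symdiff A {p \<in> space (M \<Otimes>\<^sub>M N). fst p \<in> C A (\<kappa> A (snd p))}" for A
  have S: "S A \<in> sets (M \<Otimes>\<^sub>M N)" if "A \<in> \<A>" for A
  proof -
    have [measurable]: "\<kappa> A \<in> measurable N (count_space UNIV)" using \<kappa>[OF that] .
    have "{p \<in> space (M \<Otimes>\<^sub>M N). fst p \<in> C A (\<kappa> A (snd p))} = (\<Union>l. C A l \<times> (\<kappa> A -` {l} \<inter> space N))"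
      using sets.sets_into_space[OF C[OF that]] by (auto simp: space_pair_measure)
    also have "\<dots> \<in> sets (M \<Otimes>\<^sub>M N)" using C[OF that] by auto
    finally show ?thesis unfolding S_def symdiff_def using \<A> that by auto
  qed
  define g where "g A y = measure M ((\<lambda>x. (x, y)) -` S A)" for A y
  have gm [measurable]: "g A \<in> borel_measurable N" if "A \<in> \<A>" for A
    unfolding g_def[abs_def] measure_def using P.measurable_emeasure_Pair2[OF S[OF that]] by measurable
  have gi: "integrable N (g A)" if "A \<in> \<A>" for A
    using gm[OF that] by (intro N.integrable_const_bound[where B=1]) (auto simp: g_def)
  have gint: "(\<integral>y. g A y \<partial>N) \<le> e\<^sup>2" if "A \<in> \<A>" for A
  proof -
    have "ennreal (\<integral>y. g A y \<partial>N) = (\<integral>\<^sup>+y. ennreal (g A y) \<partial>N)"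
      by (intro nn_integral_eq_integral[symmetric] gi[OF that]) (simp add: g_def)
    also have "\<dots> = emeasure (M \<Otimes>\<^sub>M N) (S A)"
      unfolding P.emeasure_pair_measure_alt2[OF S[OF that]] g_def by (simp add: M.emeasure_eq_measure)
    also have "\<dots> = ennreal (measure (M \<Otimes>\<^sub>M N) (S A))" by (rule P.emeasure_eq_measure)
    finally show ?thesis using close[OF that] unfolding S_def by (simp add: g_def integral_nonneg_AE)
  qed
  have gbad: "measure N {y\<in>space N. e \<le> g A y} \<le> e" if "A \<in> \<A>" for A
  proof -
    have "measure N {y\<in>space N. e \<le> g A y} \<le> (\<integral>y. g A y \<partial>N) / e"
      by (rule integral_Markov_inequality_measure[OF gi[OF that] sets.top]) (use e(1) in \<open>auto simp: g_def\<close>)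
    also have "\<dots> \<le> e\<^sup>2 / e" using gint[OF that] e(1) by (intro divide_right_mono) auto
    finally show ?thesis using e(1) by (simp add: power2_eq_square)
  qed
  \<comment> \<open>The parity records whether y is exceptional for A; halving returns the original
    label.\<close>
  define \<kappa>' where "\<kappa>' A y = 2 * \<kappa> A y + (if e \<le> g A y then 1 else 0)" for A y
  have "\<exists>k (n::nat) r. k \<in> N \<rightarrow>\<^sub>M count_space UNIV \<and> (\<forall>y. k y < n) \<and> (\<forall>A\<in>\<A>. \<forall>y. \<kappa>' A y = r A (k y))"
  proof (rule joint_label[OF fin])
    fix A assume A: "A \<in> \<A>"
    have [measurable]: "\<kappa> A \<in> measurable N (count_space UNIV)" "g A \<in> borel_measurable N" using \<kappa> gm A by auto
    show "\<kappa>' A \<in> N \<rightarrow>\<^sub>M count_space UNIV" unfolding \<kappa>'_def by measurable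
    show "\<kappa>' A y < 2 * m A + 2" for y using m[OF A, of y] by (simp add: \<kappa>'_def)
  qed
  then obtain k n r where k: "k \<in> N \<rightarrow>\<^sub>M count_space UNIV" "\<And>y. k y < (n::nat)"
    and r: "\<And>A y. A \<in> \<A> \<Longrightarrow> \<kappa>' A y = r A (k y)" by blast
  define Bad where "Bad = {l. \<exists>A\<in>\<A>. odd (r A l)}"
  define C'' where "C'' A l = (if A \<in> \<A> then C A (r A l div 2) else {})" for A l
  have Bad_iff: "k y \<in> Bad \<longleftrightarrow> (\<exists>A\<in>\<A>. e \<le> g A y)" for y
  proof -
    have "odd (r A (k y)) \<longleftrightarrow> e \<le> g A y" if "A \<in> \<A>" for A
      using r[OF that, of y, symmetric] by (simp add: \<kappa>'_def)
    then show ?thesis unfolding Bad_def by auto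
  qed
  show ?thesis
  proof (intro exI[of _ k] exI[of _ n] exI[of _ C''] exI[of _ Bad] conjI allI ballI impI k)
    show "C'' A l \<in> sets M" for A l using C by (simp add: C''_def)
    show "measure N {y\<in>space N. k y \<in> Bad} \<le> \<eta>"
    proof -
      have "{y\<in>space N. k y \<in> Bad} = (\<Union>A\<in>\<A>. {y\<in>space N. e \<le> g A y})" unfolding Bad_iff by auto
      also have "measure N \<dots> \<le> (\<Sum>A\<in>\<A>. measure N {y\<in>space N. e \<le> g A y})"
        using gm fin by (intro N.finite_measure_subadditive_finite) auto
      also have "\<dots> \<le> (\<Sum>A\<in>\<A>. e)" by (intro sum_mono gbad)
      finally show ?thesis using e(3) by simp
    qed
    fix A y assume A: "A \<in> \<A>" and y: "y \<in> space N" and nb: "k y \<notin> Bad"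
    have "g A y < e" using nb A unfolding Bad_iff by (simp add: not_le)
    moreover have "r A (k y) div 2 = \<kappa> A y" using r[OF A, of y, symmetric] by (simp add: \<kappa>'_def)
    then have "(\<lambda>x. (x, y)) -` S A = symdiff {x\<in>space M. (x, y) \<in> A} (C'' A (k y))"
      using sets.sets_into_space[OF C[OF A, of "\<kappa> A y"]] y A \<A> sets.sets_into_space[of A "M \<Otimes>\<^sub>M N"]
      by (auto simp: S_def symdiff_def C''_def space_pair_measure)
    ultimately show "measure M (symdiff {x\<in>space M. (x, y) \<in> A} (C'' A (k y))) \<le> \<eta>"
      using e(2) by (simp add: g_def)
  qed
qed

text \<open>A function of the label with values in [0, 1] has vertex and space averages within n *
  \<delta> of each other. In the second bound, replacing sections by C costs 2 * \<eta> + n *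
  \<delta> on the vertices and 2 * \<eta> on the space, and comparing the label averages costs
  another n * \<delta>.\<close>

lemma label_frequencies:
  fixes k :: "'y \<Rightarrow> nat"
  assumes M: "prob_space M" and N: "prob_space N" and A: "A \<in> sets (M \<Otimes>\<^sub>M N)"
    and k [measurable]: "k \<in> N \<rightarrow>\<^sub>M count_space UNIV" and kn: "\<And>y. k y < n" and C: "\<And>l. C l \<in> sets M"
    and close: "\<And>y. y \<in> space N \<Longrightarrow> k y \<notin> Bad \<Longrightarrow> measure M (symdiff {x\<in>space M. (x, y) \<in> A} (C (k y))) \<le> \<eta>"
    and bad: "measure N {y\<in>space N. k y \<in> Bad} \<le> \<eta>" and \<eta>: "\<eta> \<ge> 0"
    and d: "d > 0" and y: "\<And>v. v < d \<Longrightarrow> y v \<in> space N"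
    and freq: "\<And>l. \<bar>real (card {v. v < d \<and> k (y v) = l}) / real d - measure N {x\<in>space N. k x = l}\<bar> < \<delta>"
  shows "real (card {v. v < d \<and> k (y v) \<in> Bad}) / real d \<le> \<eta> + real n * \<delta>"
    and "\<bar>(\<Sum>v<d. measure M {x\<in>space M. (x, y v) \<in> A}) / real d - measure (M \<Otimes>\<^sub>M N) A\<bar> \<le> 4 * \<eta> + 2 * real n * \<delta>"
proof -
  interpret M: prob_space M by fact
  interpret N: prob_space N by fact
  interpret P: pair_prob_space M N ..
  define f where "f l = real (card {v. v < d \<and> k (y v) = l}) / real d" for l
  define \<nu> where "\<nu> l = measure N {x\<in>space N. k x = l}" for l
  have f\<nu>: "\<bar>f l - \<nu> l\<bar> \<le> \<delta>" for l using freq[of l] by (simp add: f_def \<nu>_def)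
  have avg: "(\<Sum>v<d. c (k (y v))) / real d = (\<Sum>l<n. c l * f l)" for c :: "nat \<Rightarrow> real"
  proof -
    have "(\<Sum>v<d. c (k (y v))) = (\<Sum>v<d. \<Sum>l<n. if l = k (y v) then c l else 0)"
      using kn by (intro sum.cong refl) (simp add: sum.delta)
    also have "\<dots> = (\<Sum>l<n. \<Sum>v<d. if l = k (y v) then c l else 0)" by (rule sum.swap)
    also have "\<dots> = (\<Sum>l<n. c l * real (card {v. v < d \<and> k (y v) = l}))"
    proof (intro sum.cong refl)
      fix l
      have "(\<Sum>v<d. if l = k (y v) then c l else 0) = (\<Sum>v\<in>{v. v < d \<and> k (y v) = l}. c l)"
        by (intro sum.mono_neutral_cong_right) auto
      then show "(\<Sum>v<d. if l = k (y v) then c l else 0) = c l * real (card {v. v < d \<and> k (y v) = l})"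
        by (simp add: mult.commute)
    qed
    finally show ?thesis by (simp add: f_def sum_divide_distrib)
  qed
  have int: "(\<integral>y. c (k y) \<partial>N) = (\<Sum>l<n. c l * \<nu> l)" for c :: "nat \<Rightarrow> real"
  proof -
    have "(\<integral>y. c (k y) \<partial>N) = (\<integral>y. (\<Sum>l<n. c l * indicat_real {x\<in>space N. k x = l} y) \<partial>N)"
    proof (rule Bochner_Integration.integral_cong[OF refl])
      fix y assume "y \<in> space N"
      then have "(\<Sum>l<n. c l * indicat_real {x\<in>space N. k x = l} y) = (\<Sum>l<n. if l = k y then c l else 0)"
        by (intro sum.cong) (auto simp: indicator_def)
      then show "c (k y) = (\<Sum>l<n. c l * indicat_real {x\<in>space N. k x = l} y)" using kn by simp
    qed
    also have "\<dots> = (\<Sum>l<n. \<integral>y. c l * indicat_real {x\<in>space N. k x = l} y \<partial>N)"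
      by (intro Bochner_Integration.integral_sum integrable_mult_right integrable_real_indicator)
        (auto simp: N.emeasure_eq_measure)
    finally show ?thesis by (simp add: \<nu>_def)
  qed
  have diff: "\<bar>(\<Sum>l<n. c l * f l) - (\<Sum>l<n. c l * \<nu> l)\<bar> \<le> real n * \<delta>" if c: "\<And>l. 0 \<le> c l" "\<And>l. c l \<le> 1" for c :: "nat \<Rightarrow> real"
  proof -
    have "\<bar>(\<Sum>l<n. c l * f l) - (\<Sum>l<n. c l * \<nu> l)\<bar> = \<bar>\<Sum>l<n. c l * (f l - \<nu> l)\<bar>"
      by (simp add: right_diff_distrib sum_subtractf)
    also have "\<dots> \<le> (\<Sum>l<n. \<bar>c l * (f l - \<nu> l)\<bar>)" by (rule sum_abs)
    also have "\<dots> \<le> (\<Sum>l<n. 1 * \<delta>)"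
    proof (rule sum_mono)
      fix l
      have "c l * \<bar>f l - \<nu> l\<bar> \<le> 1 * \<delta>" using c f\<nu> by (intro mult_mono) auto
      then show "\<bar>c l * (f l - \<nu> l)\<bar> \<le> 1 * \<delta>" using c[of l] by (simp add: abs_mult)
    qed
    finally show ?thesis by simp
  qed
  let ?b = "\<lambda>l. of_bool (l \<in> Bad) :: real"
  have intb: "(\<integral>y. ?b (k y) \<partial>N) \<le> \<eta>"
  proof -
    have "(\<integral>y. ?b (k y) \<partial>N) = (\<integral>y. indicat_real {y\<in>space N. k y \<in> Bad} y \<partial>N)"
      by (intro Bochner_Integration.integral_cong) (auto simp: indicator_def)
    then show ?thesis using bad by simp
  qed
  have bfreq: "(\<Sum>v<d. ?b (k (y v))) / real d \<le> \<eta> + real n * \<delta>"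
  proof -
    have "\<bar>(\<Sum>l<n. ?b l * f l) - (\<Sum>l<n. ?b l * \<nu> l)\<bar> \<le> real n * \<delta>" by (rule diff) auto
    moreover have "(\<Sum>l<n. ?b l * \<nu> l) \<le> \<eta>" using intb unfolding int[of ?b] .
    ultimately show ?thesis unfolding avg[of ?b] by linarith
  qed
  moreover have "(\<Sum>v<d. ?b (k (y v))) = real (card {v. v < d \<and> k (y v) \<in> Bad})"
  proof -
    have "{v. v < d \<and> k (y v) \<in> Bad} = {..<d} \<inter> {v. k (y v) \<in> Bad}" by auto
    then show ?thesis by (simp add: of_bool_def sum.If_cases)
  qed
  ultimately show "real (card {v. v < d \<and> k (y v) \<in> Bad}) / real d \<le> \<eta> + real n * \<delta>" by simp
  define h where "h y = measure M ((\<lambda>x. (x, y)) -` A)" for y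
  define c where "c l = measure M (C l)" for l
  have As: "A \<subseteq> space M \<times> space N" using sets.sets_into_space[OF A] by (simp add: space_pair_measure)
  have h_eq: "h y = measure M {x\<in>space M. (x, y) \<in> A}" for y
    unfolding h_def using As by (intro arg_cong[where f="measure M"]) auto
  have hm [measurable]: "h \<in> borel_measurable N"
    unfolding h_def[abs_def] measure_def using P.measurable_emeasure_Pair2[OF A] by measurable
  have hi: "integrable N h"
    using hm by (intro N.integrable_const_bound[where B=1]) (auto simp: h_def)
  have ci: "integrable N (\<lambda>y. c (k y))" "integrable N (\<lambda>y. ?b (k y))"
  proof -
    have m: "(\<lambda>y. b (k y)) \<in> borel_measurable N" for b :: "nat \<Rightarrow> real"
      by (rule measurable_compose[OF k]) simp
    show "integrable N (\<lambda>y. c (k y))" "integrable N (\<lambda>y. ?b (k y))"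
      by (rule N.integrable_const_bound[where B=1, OF _ m]; simp add: c_def)+
  qed
  \<comment> \<open>On exceptional labels only the trivial bound 1 is available; it is charged to
    the indicator of \<open>Bad\<close>.\<close>
  have hc: "\<bar>h y - c (k y)\<bar> \<le> \<eta> + ?b (k y)" if y: "y \<in> space N" for y
  proof (cases "k y \<in> Bad")
    case True
    have "0 \<le> h y" "h y \<le> 1" "0 \<le> c (k y)" "c (k y) \<le> 1" by (simp_all add: h_def c_def)
    then show ?thesis using True \<eta> by simp
  next
    case False
    let ?A = "{x\<in>space M. (x, y) \<in> A}"
    have Am: "?A \<in> sets M"
      using sets_Pair2[OF A, of y] As by (auto simp: vimage_def intro: back_subst[where P="\<lambda>X. X \<in> sets M"])
    have "measure M ?A \<le> measure M (C (k y) \<union> symdiff ?A (C (k y)))"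
      using Am C by (intro M.finite_measure_mono) (auto simp: symdiff_def)
    also have "\<dots> \<le> measure M (C (k y)) + measure M (symdiff ?A (C (k y)))"
      using Am C by (intro measure_Un_le) (auto simp: symdiff_def)
    finally have 1: "h y \<le> c (k y) + measure M (symdiff ?A (C (k y)))" by (simp add: h_eq c_def)
    have "measure M (C (k y)) \<le> measure M (?A \<union> symdiff ?A (C (k y)))"
      using Am C by (intro M.finite_measure_mono) (auto simp: symdiff_def)
    also have "\<dots> \<le> measure M ?A + measure M (symdiff ?A (C (k y)))"
      using Am C by (intro measure_Un_le) (auto simp: symdiff_def)
    finally have 2: "c (k y) \<le> h y + measure M (symdiff ?A (C (k y)))" by (simp add: h_eq c_def)
    show ?thesis using 1 2 close[OF y False] False by simp
  qed
  have "\<bar>(\<Sum>v<d. h (y v)) / real d - (\<Sum>l<n. c l * f l)\<bar> \<le> \<eta> + (\<Sum>v<d. ?b (k (y v))) / real d"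
  proof -
    have "\<bar>(\<Sum>v<d. h (y v)) - (\<Sum>v<d. c (k (y v)))\<bar> = \<bar>\<Sum>v<d. h (y v) - c (k (y v))\<bar>"
      by (simp add: sum_subtractf)
    also have "\<dots> \<le> (\<Sum>v<d. \<bar>h (y v) - c (k (y v))\<bar>)" by (rule sum_abs)
    also have "\<dots> \<le> (\<Sum>v<d. \<eta> + ?b (k (y v)))" using hc y by (intro sum_mono) auto
    also have "\<dots> = real d * \<eta> + (\<Sum>v<d. ?b (k (y v)))" by (simp add: sum.distrib)
    finally have "\<bar>(\<Sum>v<d. h (y v)) - (\<Sum>v<d. c (k (y v)))\<bar> / real d \<le> (real d * \<eta> + (\<Sum>v<d. ?b (k (y v)))) / real d"
      using d by (intro divide_right_mono) auto
    also have "\<dots> = \<eta> + (\<Sum>v<d. ?b (k (y v))) / real d" using d by (simp add: add_divide_distrib)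
    finally show ?thesis unfolding avg[of c, symmetric] using d by (simp add: diff_divide_distrib[symmetric])
  qed
  moreover have "\<bar>(\<Sum>l<n. c l * f l) - (\<Sum>l<n. c l * \<nu> l)\<bar> \<le> real n * \<delta>"
    by (intro diff) (auto simp: c_def)
  moreover have "\<bar>(\<integral>y. h y \<partial>N) - (\<Sum>l<n. c l * \<nu> l)\<bar> \<le> 2 * \<eta>"
  proof -
    have "\<bar>(\<integral>y. h y \<partial>N) - (\<integral>y. c (k y) \<partial>N)\<bar> = \<bar>\<integral>y. h y - c (k y) \<partial>N\<bar>"
      using hi ci by simp
    also have "\<dots> \<le> (\<integral>y. \<bar>h y - c (k y)\<bar> \<partial>N)" by (rule integral_abs_bound)
    also have "\<dots> \<le> (\<integral>y. \<eta> + ?b (k y) \<partial>N)"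
      using hi ci hc by (intro integral_mono integrable_abs Bochner_Integration.integrable_diff Bochner_Integration.integrable_add) auto
    also have "\<dots> = \<eta> + (\<integral>y. ?b (k y) \<partial>N)" using ci by (simp add: N.prob_space)
    finally show ?thesis using intb unfolding int[of c] by linarith
  qed
  moreover have "measure (M \<Otimes>\<^sub>M N) A = (\<integral>y. h y \<partial>N)"
  proof -
    have "ennreal (\<integral>y. h y \<partial>N) = (\<integral>\<^sup>+y. ennreal (h y) \<partial>N)"
      by (intro nn_integral_eq_integral[symmetric] hi) (simp add: h_def)
    also have "\<dots> = emeasure (M \<Otimes>\<^sub>M N) A"
      unfolding P.emeasure_pair_measure_alt2[OF A] h_def by (simp add: M.emeasure_eq_measure)
    also have "\<dots> = ennreal (measure (M \<Otimes>\<^sub>M N) A)" by (rule P.emeasure_eq_measure)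
    finally show ?thesis by (simp add: h_def integral_nonneg_AE)
  qed
  ultimately show "\<bar>(\<Sum>v<d. measure M {x\<in>space M. (x, y v) \<in> A}) / real d - measure (M \<Otimes>\<^sub>M N) A\<bar> \<le> 4 * \<eta> + 2 * real n * \<delta>"
    using bfreq unfolding h_eq[symmetric] by linarith
qed

section \<open>Vertex sets of vanishing density\<close>

definition negligible_sets :: "(nat \<Rightarrow> nat) \<Rightarrow> (nat \<Rightarrow> nat set) \<Rightarrow> bool" where
  "negligible_sets d B \<longleftrightarrow> (\<forall>i. B i \<subseteq> {..<d i}) \<and> (\<lambda>i. real (card (B i)) / real (d i)) \<longlonglongrightarrow> 0"

text \<open>Comparison by cardinality rather than inclusion is what is needed when an exceptional
  set has first been moved by a permutation.\<close>

lemma negligible_sets_card_le: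
  assumes "negligible_sets d B" "\<And>i. B' i \<subseteq> {..<d i}" "\<And>i. card (B' i) \<le> card (B i)"
  shows "negligible_sets d B'"
  unfolding negligible_sets_def
proof (intro conjI allI assms(2))
  show "(\<lambda>i. real (card (B' i)) / real (d i)) \<longlonglongrightarrow> 0"
  proof (rule tendsto_sandwich[of "\<lambda>_. 0"])
    show "(\<lambda>i. real (card (B i)) / real (d i)) \<longlonglongrightarrow> 0" using assms(1) by (simp add: negligible_sets_def)
  qed (use assms(3) in \<open>auto intro!: always_eventually divide_right_mono\<close>)
qed

lemma negligible_sets_subset:
  assumes "negligible_sets d B" "\<And>i. B' i \<subseteq> B i"
  shows "negligible_sets d B'"
proof (rule negligible_sets_card_le[OF assms(1)])
  fix i
  have B: "B i \<subseteq> {..<d i}" using assms(1) by (auto simp: negligible_sets_def)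
  then show "B' i \<subseteq> {..<d i}" using assms(2)[of i] by blast
  show "card (B' i) \<le> card (B i)" using finite_subset[OF B] assms(2) by (intro card_mono) auto
qed

lemma negligible_sets_Un:
  assumes "negligible_sets d B" "negligible_sets d C"
  shows "negligible_sets d (\<lambda>i. B i \<union> C i)"
  unfolding negligible_sets_def
proof (intro conjI allI)
  show "B i \<union> C i \<subseteq> {..<d i}" for i using assms by (auto simp: negligible_sets_def)
  show "(\<lambda>i. real (card (B i \<union> C i)) / real (d i)) \<longlonglongrightarrow> 0"
  proof (rule tendsto_sandwich[of "\<lambda>_. 0"])
    show "(\<lambda>i. real (card (B i)) / real (d i) + real (card (C i)) / real (d i)) \<longlonglongrightarrow> 0"
      using assms tendsto_add[of _ "0::real" _ _ 0] by (fastforce simp: negligible_sets_def)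
    have "real (card (B i \<union> C i)) \<le> real (card (B i)) + real (card (C i))" for i
      using card_Un_le[of "B i" "C i"] by linarith
    then show "\<forall>\<^sub>F i in sequentially. real (card (B i \<union> C i)) / real (d i) \<le> real (card (B i)) / real (d i) + real (card (C i)) / real (d i)"
      by (intro always_eventually allI) (simp add: add_divide_distrib[symmetric] divide_right_mono)
  qed auto
qed

lemma negligible_sets_UN:
  assumes "finite I" "\<And>a. a \<in> I \<Longrightarrow> negligible_sets d (B a)"
  shows "negligible_sets d (\<lambda>i. \<Union>a\<in>I. B a i)"
  using assms
proof (induction I rule: finite_induct)
  case empty
  then show ?case by (simp add: negligible_sets_def)
next
  case (insert a I)
  then show ?case by (simp add: negligible_sets_Un)
qed

text \<open>The density-one clauses of \<open>sofic_approx\<close> turn into vanishing densities of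
  complements as soon as \<open>d i\<close> is positive, which holds eventually.\<close>

lemma negligible_sets_complement:
  assumes lim: "(\<lambda>i. real (card {v. v < d i \<and> P i v}) / real (d i)) \<longlonglongrightarrow> 1" and d: "filterlim d at_top sequentially"
  shows "negligible_sets d (\<lambda>i. {v. v < d i \<and> \<not> P i v})"
  unfolding negligible_sets_def
proof (intro conjI allI)
  have "(\<lambda>i. 1 - real (card {v. v < d i \<and> P i v}) / real (d i)) \<longlonglongrightarrow> 1 - 1" by (intro tendsto_intros lim)
  moreover have "\<forall>\<^sub>F i in sequentially. 1 - real (card {v. v < d i \<and> P i v}) / real (d i) = real (card {v. v < d i \<and> \<not> P i v}) / real (d i)"
    using filterlim_at_top[THEN iffD1, OF d, rule_format, of 1]
  proof eventually_elim
    case (elim i)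
    have "card {v. v < d i \<and> P i v} + card {v. v < d i \<and> \<not> P i v} = card ({v. v < d i \<and> P i v} \<union> {v. v < d i \<and> \<not> P i v})"
      by (intro card_Un_disjoint[symmetric]) auto
    also have "{v. v < d i \<and> P i v} \<union> {v. v < d i \<and> \<not> P i v} = {..<d i}" by auto
    finally have "real (card {v. v < d i \<and> P i v}) + real (card {v. v < d i \<and> \<not> P i v}) = real (d i)" by simp
    then show ?case using elim by (simp add: field_simps)
  qed
  ultimately show "(\<lambda>i. real (card {v. v < d i \<and> \<not> P i v}) / real (d i)) \<longlonglongrightarrow> 0"
    by (simp cong: filterlim_cong add: filterlim_cong[OF refl refl])
qed auto

text \<open>Names are read along inverse permutations: the sofic condition compares the image of A
  under \<open>T s\<close> with a vertex set moved by \<open>\<tau> s\<close>, that is, the point at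
  v with the point at the preimage of v.\<close>

abbreviation sinv :: "('g \<Rightarrow> nat \<Rightarrow> nat) \<Rightarrow> 'g \<Rightarrow> nat \<Rightarrow> nat" where
  "sinv \<tau> s \<equiv> inv_into UNIV (\<tau> s)"

lemma sofic_approxD:
  assumes "sofic_approx G d \<sigma>"
  shows "s \<in> carrier G \<Longrightarrow> \<sigma> i s permutes {..<d i}" "filterlim d at_top sequentially"
  using assms by (auto simp: sofic_approx_def)

text \<open>If two inverse permutations agree at v, the permutations themselves agree at the common
  preimage of v, so this exceptional set lies in a permuted copy of the one in
  \<open>sofic_approx\<close>.\<close>

lemma sofic_free:
  assumes S: "sofic_approx G d \<sigma>" and s: "s \<in> carrier G" "t \<in> carrier G" "s \<noteq> t"
  shows "negligible_sets d (\<lambda>i. {v. v < d i \<and> sinv (\<sigma> i) s v = sinv (\<sigma> i) t v})"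
proof (rule negligible_sets_card_le)
  have "(\<lambda>i. real (card {v. v < d i \<and> \<sigma> i s v \<noteq> \<sigma> i t v}) / real (d i)) \<longlonglongrightarrow> 1"
    using S s by (auto simp: sofic_approx_def)
  from negligible_sets_complement[OF this sofic_approxD(2)[OF S]]
  show "negligible_sets d (\<lambda>i. {v. v < d i \<and> \<not> \<sigma> i s v \<noteq> \<sigma> i t v})" .
  fix i
  note ps = sofic_approxD(1)[OF S s(1), of i] and pt = sofic_approxD(1)[OF S s(2), of i]
  have "{v. v < d i \<and> sinv (\<sigma> i) s v = sinv (\<sigma> i) t v} \<subseteq> \<sigma> i s ` {v. v < d i \<and> \<not> \<sigma> i s v \<noteq> \<sigma> i t v}"
  proof
    fix v assume v: "v \<in> {v. v < d i \<and> sinv (\<sigma> i) s v = sinv (\<sigma> i) t v}"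
    have "sinv (\<sigma> i) s v < d i" using permutes_in_image[OF permutes_inv[OF ps], of v] v by simp
    moreover have "\<sigma> i s (sinv (\<sigma> i) s v) = v" "\<sigma> i t (sinv (\<sigma> i) s v) = v"
      using permutes_inverses(1)[OF ps, of v] permutes_inverses(1)[OF pt, of v] v by simp_all
    ultimately show "v \<in> \<sigma> i s ` {v. v < d i \<and> \<not> \<sigma> i s v \<noteq> \<sigma> i t v}"
      by (intro image_eqI[of _ _ "sinv (\<sigma> i) s v"]) auto
  qed
  then show "card {v. v < d i \<and> sinv (\<sigma> i) s v = sinv (\<sigma> i) t v} \<le> card {v. v < d i \<and> \<not> \<sigma> i s v \<noteq> \<sigma> i t v}"
    by (rule surj_card_le[rotated]) simp
qed auto

text \<open>Inversion reverses composition: stepping back by s and then by t is stepping back by the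
  product of s and t. This is the relation that matches the left shift of names.\<close>

lemma sofic_mult:
  assumes G: "group G" and S: "sofic_approx G d \<sigma>" and s: "s \<in> carrier G" "t \<in> carrier G"
  shows "negligible_sets d (\<lambda>i. {v. v < d i \<and> sinv (\<sigma> i) t (sinv (\<sigma> i) s v) \<noteq> sinv (\<sigma> i) (s \<otimes>\<^bsub>G\<^esub> t) v})"
proof (rule negligible_sets_card_le)
  let ?st = "s \<otimes>\<^bsub>G\<^esub> t"
  have st: "?st \<in> carrier G" using G s by (simp add: group.is_monoid monoid.m_closed)
  have "(\<lambda>i. real (card {v. v < d i \<and> \<sigma> i ?st v = \<sigma> i s (\<sigma> i t v)}) / real (d i)) \<longlonglongrightarrow> 1"
    using S s by (auto simp: sofic_approx_def)
  from negligible_sets_complement[OF this sofic_approxD(2)[OF S]]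
  show "negligible_sets d (\<lambda>i. {v. v < d i \<and> \<not> \<sigma> i ?st v = \<sigma> i s (\<sigma> i t v)})" .
  fix i
  note ps = sofic_approxD(1)[OF S s(1), of i] and pt = sofic_approxD(1)[OF S s(2), of i]
    and pst = sofic_approxD(1)[OF S st, of i]
  have "{v. v < d i \<and> sinv (\<sigma> i) t (sinv (\<sigma> i) s v) \<noteq> sinv (\<sigma> i) ?st v} \<subseteq> \<sigma> i ?st ` {v. v < d i \<and> \<not> \<sigma> i ?st v = \<sigma> i s (\<sigma> i t v)}"
  proof
    fix v assume v: "v \<in> {v. v < d i \<and> sinv (\<sigma> i) t (sinv (\<sigma> i) s v) \<noteq> sinv (\<sigma> i) ?st v}"
    let ?u = "sinv (\<sigma> i) ?st v"
    have u: "?u < d i" using permutes_in_image[OF permutes_inv[OF pst], of v] v by simp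
    have uv: "\<sigma> i ?st ?u = v" using permutes_inverses(1)[OF pst, of v] by simp
    have "\<sigma> i ?st ?u \<noteq> \<sigma> i s (\<sigma> i t ?u)"
    proof
      assume "\<sigma> i ?st ?u = \<sigma> i s (\<sigma> i t ?u)"
      then have "v = \<sigma> i s (\<sigma> i t ?u)" using uv by simp
      then have "sinv (\<sigma> i) t (sinv (\<sigma> i) s v) = ?u"
        using permutes_inverses(2)[OF ps, of "\<sigma> i t ?u"] permutes_inverses(2)[OF pt, of ?u] by metis
      then show False using v by simp
    qed
    then show "v \<in> \<sigma> i ?st ` {v. v < d i \<and> \<not> \<sigma> i ?st v = \<sigma> i s (\<sigma> i t v)}"
      using u uv by (intro image_eqI[of _ _ ?u]) auto
  qed
  then show "card {v. v < d i \<and> sinv (\<sigma> i) t (sinv (\<sigma> i) s v) \<noteq> sinv (\<sigma> i) ?st v} \<le> card {v. v < d i \<and> \<not> \<sigma> i ?st v = \<sigma> i s (\<sigma> i t v)}"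
    by (rule surj_card_le[rotated]) simp
qed auto

section \<open>The random model\<close>

definition free_at :: "('g \<Rightarrow> nat \<Rightarrow> nat) \<Rightarrow> 'g set \<Rightarrow> nat \<Rightarrow> bool" where
  "free_at \<tau> K v \<longleftrightarrow> inj_on (\<lambda>h. sinv \<tau> h v) K"

text \<open>The Bernoulli name read off at the vertex \<open>v\<close>: coordinates in the window \<open>K\<close> are pulled back
  along the sofic approximation (tag \<open>None\<close>), all others are fresh variables private to \<open>v\<close>.\<close>
definition model_index :: "('g \<Rightarrow> nat \<Rightarrow> nat) \<Rightarrow> 'g set \<Rightarrow> nat \<Rightarrow> nat \<times> 'g \<Rightarrow> nat \<times> nat \<times> 'g option" where
  "model_index \<tau> K v = (\<lambda>(n, h). if free_at \<tau> K v \<and> h \<in> K then (n, sinv \<tau> h v, None) else (n, v, Some h))"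

text \<open>On the window injectivity is freeness, and the tags keep private variables apart from
  shared ones. It holds for every \<tau> and v, so each model point has the exact law of X and not
  just an approximate one.\<close>

lemma inj_model_index: "inj (model_index \<tau> K v)"
  by (auto simp: inj_def model_index_def free_at_def inj_on_def split: if_splits)

text \<open>Private variables of different vertices never meet, and a shared variable lies in both
  names only if w is determined by v and two elements of K. The extra 1 accounts for w = v.\<close>

lemma card_overlapping_names:
  assumes K: "finite K" and \<tau>: "\<And>h. h \<in> K \<Longrightarrow> \<tau> h permutes {..<d}"
  shows "card {w. w < d \<and> range (model_index \<tau> K v) \<inter> range (model_index \<tau> K w) \<noteq> {}} \<le> card K * card K + 1"
proof -
  let ?I = "(\<lambda>(h, h'). \<tau> h' (sinv \<tau> h v)) ` (K \<times> K)"
  have "{w. w < d \<and> range (model_index \<tau> K v) \<inter> range (model_index \<tau> K w) \<noteq> {}} \<subseteq> insert v ?I"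
  proof
    fix w assume "w \<in> {w. w < d \<and> range (model_index \<tau> K v) \<inter> range (model_index \<tau> K w) \<noteq> {}}"
    then obtain q where q: "q \<in> range (model_index \<tau> K v)" "q \<in> range (model_index \<tau> K w)" by blast
    from q(1) obtain p where "q = model_index \<tau> K v p" by (rule rangeE)
    moreover from q(2) obtain p' where "q = model_index \<tau> K w p'" by (rule rangeE)
    ultimately have eq: "model_index \<tau> K v p = model_index \<tau> K w p'" by simp
    obtain n h n' h' where p: "p = (n, h)" "p' = (n', h')" by (cases p, cases p')
    show "w \<in> insert v ?I"
    proof (cases "w = v")
      case False
      then have h: "h \<in> K" "h' \<in> K" "sinv \<tau> h v = sinv \<tau> h' w"
        using eq by (auto simp: p model_index_def split: if_splits)
      have "w = \<tau> h' (sinv \<tau> h v)"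
        using permutes_inverses(1)[OF \<tau>[OF h(2)], of w] h(3) by simp
      then show ?thesis using h by force
    qed simp
  qed
  then have "card {w. w < d \<and> range (model_index \<tau> K v) \<inter> range (model_index \<tau> K w) \<noteq> {}} \<le> card (insert v ?I)"
    using K by (intro card_mono) auto
  also have "\<dots> \<le> card ?I + 1" by (simp add: card_insert_le_m1 card_insert_if)
  also have "card ?I \<le> card (K \<times> K)" using K by (intro card_image_le) auto
  finally show ?thesis by (simp add: card_cartesian_product)
qed

lemma measure_gauss_reindex:
  assumes "inj \<iota>" "A \<in> sets gauss"
  shows "measure gauss {\<omega>. \<omega> \<circ> \<iota> \<in> A} = measure gauss A"
proof -
  have "measure gauss A = measure (distr gauss gauss (\<lambda>\<omega>. \<omega> \<circ> \<iota>)) A"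
    by (simp add: distr_gauss_reindex[OF assms(1)])
  also have "\<dots> = measure gauss ((\<lambda>\<omega>. \<omega> \<circ> \<iota>) -` A \<inter> space gauss)"
    using assms(2) by (intro measure_distr) auto
  finally show ?thesis by (simp add: vimage_def)
qed

locale gaussian_factor = pmp_system G MX TX
  for G :: "'g monoid" and MX :: "'x measure" and TX :: "'g \<Rightarrow> 'x \<Rightarrow> 'x" +
  fixes \<Theta> :: "(nat \<times> 'g \<Rightarrow> real) \<Rightarrow> 'x"
  assumes \<Theta> [measurable]: "\<Theta> \<in> gauss \<rightarrow>\<^sub>M MX" and distr_\<Theta>: "distr gauss MX \<Theta> = MX"
    and \<Theta>_shift: "\<And>s. s \<in> carrier G \<Longrightarrow> AE \<omega> in gauss. \<Theta> (\<omega> \<circ> left_shift G s) = TX (inv\<^bsub>G\<^esub> s) (\<Theta> \<omega>)"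
    and \<Theta>_carrier: "\<And>\<iota> \<iota>' :: nat \<times> 'g \<Rightarrow> nat \<times> nat \<times> 'g option. inj \<iota> \<Longrightarrow> inj \<iota>' \<Longrightarrow>
       (\<And>n h. h \<in> carrier G \<Longrightarrow> \<iota> (n, h) = \<iota>' (n, h)) \<Longrightarrow> AE \<omega> in gauss. \<Theta> (\<omega> \<circ> \<iota>) = \<Theta> (\<omega> \<circ> \<iota>')"
begin

definition model_point :: "('g \<Rightarrow> nat \<Rightarrow> nat) \<Rightarrow> 'g set \<Rightarrow> nat \<Rightarrow> (nat \<times> nat \<times> 'g option \<Rightarrow> real) \<Rightarrow> 'x" where
  "model_point \<tau> K v \<omega> = \<Theta> (\<omega> \<circ> model_index \<tau> K v)"

lemma model_point_measurable [measurable]: "model_point \<tau> K v \<in> gauss \<rightarrow>\<^sub>M MX"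
  unfolding model_point_def[abs_def] by (rule measurable_compose[OF gauss_reindex_measurable \<Theta>])

lemma model_point_space: "model_point \<tau> K v \<omega> \<in> space MX"
  using measurable_space[OF model_point_measurable, of \<omega>] by simp

lemma distr_model_point: "distr gauss MX (model_point \<tau> K v) = MX"
proof -
  have "distr gauss MX (model_point \<tau> K v) = distr (distr gauss gauss (\<lambda>\<omega>. \<omega> \<circ> model_index \<tau> K v)) MX \<Theta>"
    by (subst distr_distr[OF \<Theta> gauss_reindex_measurable]) (simp add: model_point_def[abs_def] comp_def)
  then show ?thesis by (simp add: distr_gauss_reindex[OF inj_model_index] distr_\<Theta>)
qed

lemma model_point_event: "A \<in> sets MX \<Longrightarrow> {\<omega>. model_point \<tau> K v \<omega> \<in> A} \<in> sets gauss"
  using measurable_sets[OF model_point_measurable, of A] by (simp add: vimage_def)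

lemma measure_model_point:
  assumes "A \<in> sets MX"
  shows "measure gauss {\<omega>. model_point \<tau> K v \<omega> \<in> A} = measure MX A"
proof -
  have "measure MX A = measure (distr gauss MX (model_point \<tau> K v)) A" by (simp add: distr_model_point)
  also have "\<dots> = measure gauss (model_point \<tau> K v -` A \<inter> space gauss)"
    using assms by (intro measure_distr) auto
  finally show ?thesis by (simp add: vimage_def)
qed

text \<open>A model point is a function of the coordinates in the range of its index map, and
  disjoint blocks of coordinates are independent.\<close>

lemma model_point_indep:
  assumes disj: "range (model_index \<tau> K v) \<inter> range (model_index \<tau> K w) = {}" and A: "A \<in> sets MX" "B \<in> sets MX"
  shows "measure gauss ({\<omega>. model_point \<tau> K v \<omega> \<in> A} \<inter> {\<omega>. model_point \<tau> K w \<omega> \<in> B})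
     = measure gauss {\<omega>. model_point \<tau> K v \<omega> \<in> A} * measure gauss {\<omega>. model_point \<tau> K w \<omega> \<in> B}"
proof -
  define f where "f u = (\<lambda>r. \<Theta> (\<lambda>p. r (model_index \<tau> K u p)))" for u
  have f: "f u \<in> PiM (range (model_index \<tau> K u)) (\<lambda>_. borel) \<rightarrow>\<^sub>M MX" for u
  proof -
    have "(\<lambda>r p. r (model_index \<tau> K u p)) \<in> PiM (range (model_index \<tau> K u)) (\<lambda>_. borel) \<rightarrow>\<^sub>M PiM UNIV (\<lambda>_. borel)"
      by (intro measurable_PiM_single') (auto intro!: measurable_component_singleton)
    then have "(\<lambda>r p. r (model_index \<tau> K u p)) \<in> PiM (range (model_index \<tau> K u)) (\<lambda>_. borel) \<rightarrow>\<^sub>M gauss"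
      by (simp cong: measurable_cong_sets add: sets_gauss)
    then show ?thesis unfolding f_def by (rule measurable_compose) (rule \<Theta>)
  qed
  have mp: "model_point \<tau> K u = f u \<circ> (\<lambda>\<omega>. restrict (\<lambda>i. \<omega> i) (range (model_index \<tau> K u)))" for u
    by (auto simp: model_point_def f_def comp_def)
  have "gauss.indep_var (PiM (range (model_index \<tau> K v)) (\<lambda>_. borel)) (\<lambda>\<omega>. restrict (\<lambda>i. \<omega> i) (range (model_index \<tau> K v)))
     (PiM (range (model_index \<tau> K w)) (\<lambda>_. borel)) (\<lambda>\<omega>. restrict (\<lambda>i. \<omega> i) (range (model_index \<tau> K w)))"
    by (rule gauss.indep_var_restrict[OF indep_gauss_coordinates disj]) auto
  from gauss.indep_var_compose[OF this f f]
  have "gauss.indep_var MX (model_point \<tau> K v) MX (model_point \<tau> K w)" unfolding mp .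
  from gauss.indep_varD[OF this A] show ?thesis
    by (simp add: vimage_def Int_def)
qed

text \<open>The preimage of C under \<Theta> is replaced by a cylinder event over a finite set J. If
  the window contains the group parts \<open>K1\<close> of J and their translates by s, the shifted
  name at v and the name at w agree on J, and only two approximation errors remain. The estimate
  holds for all larger windows, so finitely many sets C can share one.\<close>

lemma approx_equivariance:
  assumes C: "C \<in> sets MX" and s: "s \<in> carrier G" and e: "e > 0"
  shows "\<exists>K1. finite K1 \<and> K1 \<subseteq> carrier G \<and> (\<forall>\<tau> K v w. K1 \<subseteq> K \<longrightarrow> (\<lambda>h. s \<otimes>\<^bsub>G\<^esub> h) ` K1 \<subseteq> K \<longrightarrow> K \<subseteq> carrier G \<longrightarrow>
    free_at \<tau> K v \<longrightarrow> free_at \<tau> K w \<longrightarrow> (\<forall>h\<in>K1. sinv \<tau> h w = sinv \<tau> (s \<otimes>\<^bsub>G\<^esub> h) v) \<longrightarrow>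
    measure gauss {\<omega>. (TX (inv\<^bsub>G\<^esub> s) (model_point \<tau> K v \<omega>) \<in> C) \<noteq> (model_point \<tau> K w \<omega> \<in> C)} \<le> e)"
proof -
  define C' where "C' = {\<omega>. \<Theta> \<omega> \<in> C}"
  have C': "C' \<in> sets gauss" using measurable_sets[OF \<Theta> C] by (simp add: C'_def vimage_def)
  have "\<exists>D J. D \<in> sets gauss \<and> finite J \<and> (\<forall>\<omega> \<omega>'. (\<forall>i\<in>J. \<omega> i = \<omega>' i) \<longrightarrow> (\<omega> \<in> D \<longleftrightarrow> \<omega>' \<in> D)) \<and>
    measure gauss (symdiff C' D) < e / 2"
    unfolding gauss_def using C' e by (intro approx_cylinder prob_space_std_normal) (auto simp: gauss_def)
  then obtain D J where DJ: "D \<in> sets gauss \<and> finite J \<and> (\<forall>\<omega> \<omega>'. (\<forall>i\<in>J. \<omega> i = \<omega>' i) \<longrightarrow> (\<omega> \<in> D \<longleftrightarrow> \<omega>' \<in> D)) \<and>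
    measure gauss (symdiff C' D) < e / 2" by (elim exE)
  then have D: "D \<in> sets gauss" "finite J" "measure gauss (symdiff C' D) < e / 2" by simp_all
  have Ddet: "\<omega> \<in> D \<longleftrightarrow> \<omega>' \<in> D" if "\<forall>i\<in>J. \<omega> i = \<omega>' i" for \<omega> \<omega>' using DJ that by blast
  have sdm: "symdiff C' D \<in> sets gauss" using C' D by (auto simp: symdiff_def)
  define K1 where "K1 = snd ` J \<inter> carrier G"
  have "measure gauss {\<omega>. (TX (inv\<^bsub>G\<^esub> s) (model_point \<tau> K v \<omega>) \<in> C) \<noteq> (model_point \<tau> K w \<omega> \<in> C)} \<le> e"
    if K: "K1 \<subseteq> K" "(\<lambda>h. s \<otimes>\<^bsub>G\<^esub> h) ` K1 \<subseteq> K" "K \<subseteq> carrier G" and free: "free_at \<tau> K v" "free_at \<tau> K w"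
      and eq: "\<And>h. h \<in> K1 \<Longrightarrow> sinv \<tau> h w = sinv \<tau> (s \<otimes>\<^bsub>G\<^esub> h) v" for \<tau> K v w
  proof -
    define \<iota>1 where "\<iota>1 = model_index \<tau> K v \<circ> left_shift G s"
    \<comment> \<open>Off the carrier the name at w is redirected to the private variables of v,
      where the shifted name at v also looks. The two index maps then agree on all of J, and by
      \<open>\<Theta>_carrier\<close> the redirection changes \<Theta> only on a null set.\<close>
    define \<iota>2 where "\<iota>2 = (\<lambda>(n, h). if h \<in> carrier G then model_index \<tau> K w (n, h) else (n, v, Some h))"
    have inj1: "inj \<iota>1" unfolding \<iota>1_def
      using bij_left_shift[OF group_axioms s] by (intro inj_compose inj_model_index) (simp add: bij_def)
    have inj2: "inj \<iota>2"
    proof (rule injI)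
      fix p q assume pq: "\<iota>2 p = \<iota>2 q"
      obtain n h n' h' where p: "p = (n, h)" "q = (n', h')" by (cases p, cases q)
      show "p = q"
      proof (cases "h \<in> carrier G \<and> h' \<in> carrier G")
        case True
        then have "model_index \<tau> K w p = model_index \<tau> K w q" using pq by (simp add: p \<iota>2_def)
        then show ?thesis by (rule injD[OF inj_model_index])
      next
        case False
        then show ?thesis using pq K(3) by (auto simp: p \<iota>2_def model_index_def split: if_splits)
      qed
    qed
    have d: "distr gauss gauss (\<lambda>\<omega>. \<omega> \<circ> model_index \<tau> K v) = gauss"
      by (rule distr_gauss_reindex[OF inj_model_index])
    have ae1: "AE \<omega> in gauss. \<Theta> (\<omega> \<circ> \<iota>1) = TX (inv\<^bsub>G\<^esub> s) (model_point \<tau> K v \<omega>)"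
    proof -
      have "AE \<omega> in gauss. \<Theta> ((\<omega> \<circ> model_index \<tau> K v) \<circ> left_shift G s) = TX (inv\<^bsub>G\<^esub> s) (\<Theta> (\<omega> \<circ> model_index \<tau> K v))"
        by (rule AE_distrD[OF gauss_reindex_measurable], unfold d) (rule \<Theta>_shift[OF s])
      then show ?thesis by (simp add: \<iota>1_def model_point_def comp_assoc)
    qed
    have ae2: "AE \<omega> in gauss. model_point \<tau> K w \<omega> = \<Theta> (\<omega> \<circ> \<iota>2)"
      unfolding model_point_def by (rule \<Theta>_carrier[OF inj_model_index inj2]) (simp add: \<iota>2_def)
    have agree: "\<iota>1 p = \<iota>2 p" if "p \<in> J" for p
    proof (cases p)
      case (Pair n h)
      show ?thesis
      proof (cases "h \<in> carrier G")
        case True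
        then have h: "h \<in> K1" using that Pair by (force simp: K1_def)
        then have "h \<in> K" "s \<otimes>\<^bsub>G\<^esub> h \<in> K" using K by auto
        then show ?thesis using True free eq[OF h] by (simp add: Pair \<iota>1_def \<iota>2_def left_shift_def model_index_def)
      next
        case False
        then have "h \<notin> K" using K by auto
        then show ?thesis using False by (simp add: Pair \<iota>1_def \<iota>2_def left_shift_def model_index_def)
      qed
    qed
    have Deq: "\<omega> \<circ> \<iota>1 \<in> D \<longleftrightarrow> \<omega> \<circ> \<iota>2 \<in> D" for \<omega>
      by (rule Ddet) (simp add: agree)
    have ev: "{\<omega>. \<omega> \<circ> \<iota> \<in> symdiff C' D} \<in> sets gauss" for \<iota> :: "nat \<times> 'g \<Rightarrow> nat \<times> nat \<times> 'g option"
      using measurable_sets[OF gauss_reindex_measurable sdm, of \<iota>] by (simp add: vimage_def)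
    have "measure gauss {\<omega>. (TX (inv\<^bsub>G\<^esub> s) (model_point \<tau> K v \<omega>) \<in> C) \<noteq> (model_point \<tau> K w \<omega> \<in> C)}
      \<le> measure gauss ({\<omega>. \<omega> \<circ> \<iota>1 \<in> symdiff C' D} \<union> {\<omega>. \<omega> \<circ> \<iota>2 \<in> symdiff C' D})"
    proof (rule gauss.finite_measure_mono_AE)
      show "AE \<omega> in gauss. \<omega> \<in> {\<omega>. (TX (inv\<^bsub>G\<^esub> s) (model_point \<tau> K v \<omega>) \<in> C) \<noteq> (model_point \<tau> K w \<omega> \<in> C)} \<longrightarrow>
         \<omega> \<in> {\<omega>. \<omega> \<circ> \<iota>1 \<in> symdiff C' D} \<union> {\<omega>. \<omega> \<circ> \<iota>2 \<in> symdiff C' D}"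
        using ae1 ae2
      proof eventually_elim
        case (elim \<omega>)
        show ?case using Deq[of \<omega>] elim by (auto simp: C'_def symdiff_def)
      qed
      show "{\<omega>. \<omega> \<circ> \<iota>1 \<in> symdiff C' D} \<union> {\<omega>. \<omega> \<circ> \<iota>2 \<in> symdiff C' D} \<in> sets gauss" using ev by auto
    qed
    also have "\<dots> \<le> measure gauss {\<omega>. \<omega> \<circ> \<iota>1 \<in> symdiff C' D} + measure gauss {\<omega>. \<omega> \<circ> \<iota>2 \<in> symdiff C' D}"
      by (intro measure_Un_le ev)
    also have "\<dots> = measure gauss (symdiff C' D) + measure gauss (symdiff C' D)"
      using measure_gauss_reindex[OF inj1 sdm] measure_gauss_reindex[OF inj2 sdm] by simp
    finally show ?thesis using D(3) by simp
  qed
  moreover have "finite K1" "K1 \<subseteq> carrier G" using D(2) by (auto simp: K1_def)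
  ultimately show ?thesis by (intro exI[of _ K1] conjI allI impI) auto
qed

end

section \<open>Small balls for the names read at the vertices\<close>

definition push :: "('p \<Rightarrow> 'q) \<Rightarrow> ('p \<Rightarrow> real) \<Rightarrow> 'q \<Rightarrow> real" where
  "push \<iota> c q = (if q \<in> range \<iota> then c (inv_into UNIV \<iota> q) else 0)"

lemma push_apply: "inj \<iota> \<Longrightarrow> push \<iota> c (\<iota> p) = c p"
  by (simp add: push_def)

text \<open>A finite core of coefficients carries 15/16 of the variance A and, spread over the
  vertices, hits each shared variable at most \<open>card K0\<close> times, which bounds an operator
  norm. The rest of the window, of variance at most A/16, is the perturbation allowed in
  \<open>greedy_orthonormal\<close>. Since \<open>K0\<close> and \<open>c0\<close> come from the
  core alone, they serve every larger window.\<close>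

lemma model_small_ball:
  fixes G :: "'g monoid" and a :: "nat \<times> 'g \<Rightarrow> real"
  assumes lin: "gauss_lin a W" and A: "((\<lambda>p. (a p)\<^sup>2) has_sum A) UNIV" "A > 0"
    and off: "\<And>n h. h \<notin> carrier G \<Longrightarrow> a (n, h) = 0"
  shows "\<exists>K0 c0. finite K0 \<and> K0 \<subseteq> carrier G \<and> c0 > 0 \<and> (\<forall>\<tau> d K N c. finite K \<longrightarrow> K0 \<subseteq> K \<longrightarrow>
     (\<forall>h\<in>K. \<tau> h permutes {..<d}) \<longrightarrow> d \<le> 2 * card {v. v < d \<and> free_at \<tau> K v} \<longrightarrow> 0 < d \<longrightarrow> 0 < N \<longrightarrow>
     (\<forall>v<d. cmod (c v) \<le> 1) \<longrightarrow>
     measure gauss {\<omega>. \<forall>v<d. cmod (iexp (W (\<omega> \<circ> model_index \<tau> K v)) - c v) \<le> 1 / real N}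
       \<le> (4 * gauss_sum_const (sqrt (A / 4)) / real N) ^ nat \<lfloor>c0 * real d\<rfloor>)"
proof -
  obtain E0 where E0: "finite E0" "dist (\<Sum>p\<in>E0. (a p)\<^sup>2) A < A / 16"
    using tendstoD[OF A(1)[unfolded has_sum_def], of "A / 16"] A(2) unfolding eventually_finite_subsets_at_top by auto
  have le: "(\<Sum>p\<in>E. (a p)\<^sup>2) \<le> A" if "finite E" for E
    by (rule finite_sum_le_has_sum[OF A(1) that]) auto
  obtain n0 where n0: "fst ` E0 \<subseteq> {..<n0::nat}"
    using finite_nat_bounded[of "fst ` E0"] E0(1) by auto
  define K0 where "K0 = snd ` E0 \<inter> carrier G"
  define S0 where "S0 = {..<n0} \<times> K0"
  have K0: "finite K0" using E0 by (simp add: K0_def)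
  have S0: "finite S0" using K0 by (simp add: S0_def)
  have S0_ge: "15 / 16 * A \<le> (\<Sum>p\<in>S0. (a p)\<^sup>2)"
  proof -
    have "(\<Sum>p\<in>E0. (a p)\<^sup>2) = (\<Sum>p\<in>E0 \<inter> S0. (a p)\<^sup>2)"
    proof (intro sum.mono_neutral_right E0(1) ballI)
      fix p assume p: "p \<in> E0 - E0 \<inter> S0"
      obtain n h where nh: "p = (n, h)" by (cases p)
      have "n < n0" "h \<in> snd ` E0" using p n0 nh by force+
      then have "h \<notin> carrier G" using p nh by (auto simp: S0_def K0_def)
      then show "(a p)\<^sup>2 = 0" using off nh by simp
    qed auto
    also have "\<dots> \<le> (\<Sum>p\<in>S0. (a p)\<^sup>2)" using S0 by (intro sum_mono2) auto
    finally show ?thesis using E0(2) unfolding dist_real_def by linarith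
  qed
  \<comment> \<open>The truncated coefficient vectors have squared operator norm at most A times the
    number of group elements in the core; the \<open>+ 1\<close> makes positivity immediate.\<close>
  define L where "L = A * (real (card K0) + 1)"
  define \<beta> where "\<beta> = A / 2"
  \<comment> \<open>With k at most c0 * d and d at most twice the number of free vertices, this
    constant gives exactly the bound on k that the greedy selection demands.\<close>
  define c0 where "c0 = \<beta> / (32 * L)"
  have pos: "L > 0" "\<beta> > 0" "c0 > 0" using A(2) by (auto simp: L_def \<beta>_def c0_def)
  have "measure gauss {\<omega>. \<forall>v<d. cmod (iexp (W (\<omega> \<circ> model_index \<tau> K v)) - c v) \<le> 1 / real N}
       \<le> (4 * gauss_sum_const (sqrt (A / 4)) / real N) ^ nat \<lfloor>c0 * real d\<rfloor>"
    if K: "finite K" "K0 \<subseteq> K" and perm: "\<And>h. h \<in> K \<Longrightarrow> \<tau> h permutes {..<d}"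
      and many: "d \<le> 2 * card {v. v < d \<and> free_at \<tau> K v}" and d: "0 < d" and N: "0 < N"
      and c: "\<And>v. v < d \<Longrightarrow> cmod (c v) \<le> 1" for \<tau> d K N c
  proof -
    define \<iota> where "\<iota> = model_index \<tau> K"
    define V where "V = {v. v < d \<and> free_at \<tau> K v}"
    \<comment> \<open>Only shared variables of the layers below \<open>n0\<close> are kept. There
      the coefficients of free vertices are explicit, and dropping the others merely weakens the
      bound on the characteristic function.\<close>
    define J where "J = (\<lambda>(n, w). (n, w, None :: 'g option)) ` ({..<n0} \<times> {..<d})"
    define k where "k = nat \<lfloor>c0 * real d\<rfloor>"
    define b where "b v = push (\<iota> v) a" for v
    define b0 where "b0 v = push (\<iota> v) (\<lambda>p. if p \<in> S0 then a p else 0)" for v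
    have inj: "inj (\<iota> v)" for v unfolding \<iota>_def by (rule inj_model_index)
    have J: "finite J" by (simp add: J_def)
    have sinv_lt: "sinv \<tau> h v < d" if "h \<in> K" "v < d" for h v
      using permutes_in_image[OF permutes_inv[OF perm[OF that(1)]], of v] that by simp
    have ip_push: "ip J (push (\<iota> v) x) e = (\<Sum>p\<in>{..<n0} \<times> K. x p * e (\<iota> v p))" if v: "v \<in> V" for v x e
    proof -
      have sub: "\<iota> v ` ({..<n0} \<times> K) \<subseteq> J"
      proof -
        have "(n, w, None) \<in> J" if "n < n0" "w < d" for n w using that unfolding J_def by force
        then show ?thesis using v sinv_lt by (auto simp: \<iota>_def model_index_def V_def)
      qed
      have "ip J (push (\<iota> v) x) e = (\<Sum>q\<in>\<iota> v ` ({..<n0} \<times> K). push (\<iota> v) x q * e q)"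
        unfolding ip_def
      proof (intro sum.mono_neutral_right J sub ballI)
        fix q assume q: "q \<in> J - \<iota> v ` ({..<n0} \<times> K)"
        have "q \<notin> range (\<iota> v)"
        proof
          assume "q \<in> range (\<iota> v)"
          then obtain n h where nh: "q = \<iota> v (n, h)" by auto
          with q have "h \<in> K" "n < n0" by (auto simp: J_def \<iota>_def model_index_def split: if_splits)
          then show False using q nh by auto
        qed
        then show "push (\<iota> v) x q * e q = 0" by (simp add: push_def)
      qed
      also have "\<dots> = (\<Sum>p\<in>{..<n0} \<times> K. x p * e (\<iota> v p))"
        using inj[of v] by (subst sum.reindex) (auto simp: push_apply inj_on_def inj_def)
      finally show ?thesis .
    qed
    have ip_push2: "ip J (push (\<iota> v) x) (push (\<iota> v) x) = (\<Sum>p\<in>{..<n0} \<times> K. (x p)\<^sup>2)" if "v \<in> V" for v x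
      using ip_push[OF that] by (simp add: push_apply[OF inj] power2_eq_square)
    have SK: "S0 \<subseteq> {..<n0} \<times> K" "finite ({..<n0} \<times> K)" using K by (auto simp: S0_def)
    have op: "(\<Sum>v\<in>V. (ip J (b0 v) e)\<^sup>2) \<le> L * ip J e e" for e
    proof -
      \<comment> \<open>Cauchy-Schwarz is applied at each vertex before summing. For fixed h the
        vertices \<open>sinv \<tau> h v\<close> run through a permutation, so each shared variable
        is counted once per element of \<open>K0\<close>.\<close>
      have "(\<Sum>v\<in>V. (ip J (b0 v) e)\<^sup>2) \<le> (\<Sum>v\<in>V. A * (\<Sum>(n, h)\<in>S0. (e (n, sinv \<tau> h v, None))\<^sup>2))"
      proof (rule sum_mono)
        fix v assume v: "v \<in> V"
        have "ip J (b0 v) e = (\<Sum>p\<in>{..<n0} \<times> K. (if p \<in> S0 then a p else 0) * e (\<iota> v p))"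
          unfolding b0_def by (rule ip_push[OF v])
        also have "\<dots> = (\<Sum>p\<in>S0. a p * e (\<iota> v p))"
          using SK by (intro sum.mono_neutral_cong_right) auto
        finally have "(ip J (b0 v) e)\<^sup>2 \<le> (\<Sum>p\<in>S0. (a p)\<^sup>2) * (\<Sum>p\<in>S0. (e (\<iota> v p))\<^sup>2)"
          using Cauchy_Schwarz_ineq_sum[of a "\<lambda>p. e (\<iota> v p)" S0] by simp
        also have "\<dots> \<le> A * (\<Sum>p\<in>S0. (e (\<iota> v p))\<^sup>2)"
          using le[OF S0] by (intro mult_right_mono sum_nonneg) auto
        also have "(\<Sum>p\<in>S0. (e (\<iota> v p))\<^sup>2) = (\<Sum>(n, h)\<in>S0. (e (n, sinv \<tau> h v, None))\<^sup>2)"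
          using v K(2) by (intro sum.cong) (auto simp: \<iota>_def model_index_def V_def S0_def)
        finally show "(ip J (b0 v) e)\<^sup>2 \<le> A * (\<Sum>(n, h)\<in>S0. (e (n, sinv \<tau> h v, None))\<^sup>2)" .
      qed
      also have "\<dots> \<le> (\<Sum>v<d. A * (\<Sum>(n, h)\<in>S0. (e (n, sinv \<tau> h v, None))\<^sup>2))"
        using A(2) by (intro sum_mono2) (auto simp: V_def intro!: mult_nonneg_nonneg sum_nonneg)
      also have "\<dots> = A * (\<Sum>(n, h)\<in>S0. \<Sum>v<d. (e (n, sinv \<tau> h v, None))\<^sup>2)"
        unfolding sum_distrib_left[symmetric] by (subst sum.swap) (simp add: case_prod_beta')
      also have "(\<Sum>(n, h)\<in>S0. \<Sum>v<d. (e (n, sinv \<tau> h v, None))\<^sup>2) = (\<Sum>(n, h)\<in>S0. \<Sum>w<d. (e (n, w, None))\<^sup>2)"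
      proof (intro sum.cong refl, clarify)
        fix n h assume "(n, h) \<in> S0"
        then have "h \<in> K" using K(2) by (auto simp: S0_def)
        from sum.permute[OF permutes_inv[OF perm[OF this]], of "\<lambda>w. (e (n, w, None))\<^sup>2"]
        show "(\<Sum>v<d. (e (n, sinv \<tau> h v, None))\<^sup>2) = (\<Sum>w<d. (e (n, w, None))\<^sup>2)" by (simp add: comp_def)
      qed
      also have "\<dots> = real (card K0) * ip J e e"
      proof -
        have "ip J e e = (\<Sum>(n, w)\<in>{..<n0} \<times> {..<d}. (e (n, w, None))\<^sup>2)"
          unfolding ip_def J_def by (subst sum.reindex) (auto simp: inj_on_def power2_eq_square intro!: sum.cong)
        also have "\<dots> = (\<Sum>n<n0. \<Sum>w<d. (e (n, w, None))\<^sup>2)" by (simp add: sum.cartesian_product)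
        finally show ?thesis
          unfolding S0_def sum.cartesian_product[symmetric] by (simp add: sum_distrib_left)
      qed
      also have "A * (real (card K0) * ip J e e) \<le> L * ip J e e"
        using A(2) ip_nonneg[of J e] by (simp add: L_def algebra_simps)
      finally show ?thesis .
    qed
    have r: "ip J (\<lambda>p. b v p - b0 v p) (\<lambda>p. b v p - b0 v p) \<le> \<beta> / 8" if v: "v \<in> V" for v
    proof -
      have eq: "(\<lambda>p. b v p - b0 v p) = push (\<iota> v) (\<lambda>p. if p \<in> S0 then 0 else a p)"
        by (auto simp: b_def b0_def push_def)
      have "ip J (\<lambda>p. b v p - b0 v p) (\<lambda>p. b v p - b0 v p) = (\<Sum>p\<in>{..<n0} \<times> K. (if p \<in> S0 then 0 else a p)\<^sup>2)"
        unfolding eq by (rule ip_push2[OF v])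
      also have "\<dots> = (\<Sum>p\<in>{..<n0} \<times> K - S0. (a p)\<^sup>2)"
        using SK by (intro sum.mono_neutral_cong_right) auto
      also have "\<dots> = (\<Sum>p\<in>{..<n0} \<times> K. (a p)\<^sup>2) - (\<Sum>p\<in>S0. (a p)\<^sup>2)"
        using SK by (simp add: sum_diff)
      also have "\<dots> \<le> A - 15 / 16 * A" using le[OF SK(2)] S0_ge by linarith
      finally show ?thesis by (simp add: \<beta>_def)
    qed
    have bb: "\<beta> \<le> ip J (b v) (b v)" if v: "v \<in> V" for v
    proof -
      have "15 / 16 * A \<le> (\<Sum>p\<in>{..<n0} \<times> K. (a p)\<^sup>2)"
        by (rule order_trans[OF S0_ge]) (intro sum_mono2 SK; simp)
      also have "\<dots> = ip J (b v) (b v)" unfolding b_def by (rule ip_push2[OF v, symmetric])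
      finally show ?thesis using A(2) by (simp add: \<beta>_def)
    qed
    have kle: "16 * L * real k \<le> \<beta> * real (card V)"
    proof -
      have "real k \<le> c0 * real d" unfolding k_def using pos(3) by (simp add: of_nat_nat)
      then have "16 * L * real k \<le> 16 * L * (c0 * real d)" using pos by (intro mult_left_mono) auto
      also have "\<dots> = \<beta> * (real d / 2)" using pos by (simp add: c0_def)
      also have "\<dots> \<le> \<beta> * real (card V)" using many pos by (intro mult_left_mono) (auto simp: V_def)
      finally show ?thesis .
    qed
    have V: "finite V" "V \<noteq> {}"
    proof -
      show "finite V" by (simp add: V_def)
      have "0 < card V" using many d unfolding V_def by linarith
      then show "V \<noteq> {}" by (metis card.empty less_irrefl)
    qed
    obtain v e where ve: "(\<forall>i<k. v i \<in> V) \<and> (\<forall>i<k. \<forall>j<k. ip J (e i) (e j) = of_bool (i = j)) \<and>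
      (\<forall>i<k. \<forall>j<k. i < j \<longrightarrow> ip J (b (v i)) (e j) = 0) \<and> (\<forall>i<k. sqrt (\<beta> / 2) \<le> ip J (b (v i)) (e i))"
      using greedy_orthonormal[OF V pos(2) op r bb less_imp_le[OF pos(1)] kle] by blast
    then have vV: "\<And>i. i < k \<Longrightarrow> v i \<in> V" by simp
    have ball: "measure gauss {\<omega>. \<forall>i<k. cmod (iexp ((\<lambda>\<omega>. W (\<omega> \<circ> \<iota> (v i))) \<omega>) - c (v i)) \<le> 1 / real N}
      \<le> (4 * gauss_sum_const (sqrt (\<beta> / 2)) / real N) ^ k"
    proof (rule gauss_torus_small_ball[OF J, where b="\<lambda>i. b (v i)" and e=e])
      show "gauss_lin (b (v i)) (\<lambda>\<omega>. W (\<omega> \<circ> \<iota> (v i)))" for i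
        unfolding b_def by (rule gauss_lin_reindex[OF inj lin push_apply[OF inj]]) (simp add: push_def)
      show "sqrt (\<beta> / 2) > 0" using pos by simp
      show "cmod (c (v i)) \<le> 1" if "i < k" for i using c vV[OF that] by (simp add: V_def)
    qed (use ve N in simp_all)
    have "W \<in> borel_measurable gauss" using lin by (auto simp: gauss_lin_def)
    then have [measurable]: "(\<lambda>\<omega>. W (\<omega> \<circ> \<iota> u)) \<in> borel_measurable gauss" for u
      by (rule measurable_compose[OF gauss_reindex_measurable])
    have Em: "{\<omega>. \<forall>i<k. cmod (iexp (W (\<omega> \<circ> \<iota> (v i))) - c (v i)) \<le> 1 / real N} \<in> sets gauss"
    proof -
      have "{\<omega> \<in> space gauss. \<forall>i\<in>{..<k}. cmod (iexp (W (\<omega> \<circ> \<iota> (v i))) - c (v i)) \<le> 1 / real N} \<in> sets gauss"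
        by (intro sets.sets_Collect_finite_All; measurable)
      then show ?thesis by (simp add: Ball_def)
    qed
    \<comment> \<open>Only the constraints at the selected vertices are kept.\<close>
    have "measure gauss {\<omega>. \<forall>v<d. cmod (iexp (W (\<omega> \<circ> \<iota> v)) - c v) \<le> 1 / real N}
      \<le> measure gauss {\<omega>. \<forall>i<k. cmod (iexp (W (\<omega> \<circ> \<iota> (v i))) - c (v i)) \<le> 1 / real N}"
      using vV by (intro gauss.finite_measure_mono Em) (auto simp: V_def)
    also have "\<dots> \<le> (4 * gauss_sum_const (sqrt (\<beta> / 2)) / real N) ^ k" using ball by simp
    also have "\<beta> / 2 = A / 4" by (simp add: \<beta>_def)
    finally show ?thesis unfolding \<iota>_def k_def .
  qed
  moreover have "K0 \<subseteq> carrier G" by (simp add: K0_def)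
  ultimately show ?thesis using K0 pos(3)
    by (intro exI[of _ K0] exI[of _ c0] conjI allI impI) auto
qed

section \<open>Expected errors of the random model\<close>

lemma section_sets:
  assumes "A \<in> sets (M \<Otimes>\<^sub>M N)"
  shows "{x\<in>space M. (x, y) \<in> A} \<in> sets M"
proof -
  have "A \<subseteq> space M \<times> space N" using sets.sets_into_space[OF assms] by (simp add: space_pair_measure)
  then have "{x\<in>space M. (x, y) \<in> A} = (\<lambda>x. (x, y)) -` A" by auto
  then show ?thesis using sets_Pair2[OF assms, of y] by simp
qed

lemma pmp_system_product:
  assumes "pmp_system G M T" "pmp_system G N S"
  shows "pmp_system G (M \<Otimes>\<^sub>M N) (\<lambda>g (x, y). (T g x, S g y))"
proof -
  interpret M: pmp_system G M T by fact
  interpret N: pmp_system G N S by fact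
  interpret P: pair_prob_space M N ..
  have "pmp_action G (M \<Otimes>\<^sub>M N) (\<lambda>g (x, y). (T g x, S g y))"
    unfolding pmp_action_def
  proof (intro conjI ballI)
    show "prob_space (M \<Otimes>\<^sub>M N)" by unfold_locales
    fix g assume g: "g \<in> carrier G"
    note [measurable] = M.T_measurable[OF g] N.T_measurable[OF g]
    show "(\<lambda>(x, y). (T g x, S g y)) \<in> (M \<Otimes>\<^sub>M N) \<rightarrow>\<^sub>M (M \<Otimes>\<^sub>M N)" by measurable
    have "bij_betw (T g) (space M) (space M)" "bij_betw (S g) (space N) (space N)"
      using M.pmp N.pmp g by (auto simp: pmp_action_def)
    then have "bij_betw (map_prod (T g) (S g)) (space M \<times> space N) (space M \<times> space N)"
      by (rule bij_betw_map_prod)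
    then show "bij_betw (\<lambda>(x, y). (T g x, S g y)) (space (M \<Otimes>\<^sub>M N)) (space (M \<Otimes>\<^sub>M N))"
      by (simp add: space_pair_measure map_prod_def)
    have "distr M M (T g) \<Otimes>\<^sub>M distr N N (S g) = distr (M \<Otimes>\<^sub>M N) (M \<Otimes>\<^sub>M N) (\<lambda>(x, y). (T g x, S g y))"
      using N.T_distr[OF g] N.sigma_finite_measure_axioms by (intro pair_measure_distr) auto
    then show "distr (M \<Otimes>\<^sub>M N) (M \<Otimes>\<^sub>M N) (\<lambda>(x, y). (T g x, S g y)) = M \<Otimes>\<^sub>M N"
      by (simp add: M.T_distr[OF g] N.T_distr[OF g])
  next
    fix p assume "p \<in> space (M \<Otimes>\<^sub>M N)"
    then show "(case p of (x, y) \<Rightarrow> (T \<one>\<^bsub>G\<^esub> x, S \<one>\<^bsub>G\<^esub> y)) = p"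
      by (auto simp: space_pair_measure M.T_one N.T_one)
  next
    fix g h p assume *: "g \<in> carrier G" "h \<in> carrier G" "p \<in> space (M \<Otimes>\<^sub>M N)"
    have "T (g \<otimes>\<^bsub>G\<^esub> h) x = T g (T h x)" if "x \<in> space M" for x
      using M.pmp * that by (auto simp: pmp_action_def)
    moreover have "S (g \<otimes>\<^bsub>G\<^esub> h) y = S g (S h y)" if "y \<in> space N" for y
      using N.pmp * that by (auto simp: pmp_action_def)
    ultimately show "(case p of (x, y) \<Rightarrow> (T (g \<otimes>\<^bsub>G\<^esub> h) x, S (g \<otimes>\<^bsub>G\<^esub> h) y)) =
      (case case p of (x, y) \<Rightarrow> (T h x, S h y) of (x, y) \<Rightarrow> (T g x, S g y))"
      using *(3) by (auto simp: space_pair_measure)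
  qed
  moreover have "prob_space (M \<Otimes>\<^sub>M N)" by unfold_locales
  ultimately show ?thesis
    by (intro pmp_system.intro M.group_axioms) (auto simp: pmp_system_axioms_def)
qed

locale random_model = gaussian_factor G MX TX \<Theta> + Y: pmp_system G MY TY
  for G :: "'g monoid" and MX :: "'x measure" and TX \<Theta> and MY :: "'y measure" and TY :: "'g \<Rightarrow> 'y \<Rightarrow> 'y"
begin

sublocale XY: pmp_system G "MX \<Otimes>\<^sub>M MY" "\<lambda>g (x, y). (TX g x, TY g y)"
  by (rule pmp_system_product) unfold_locales

text \<open>Two deviations are added: the fluctuation of the count around its mean, small because
  few names overlap, and the distance of that mean from the product measure, governed by the label
  frequencies of the points \<open>y v\<close>.\<close>

lemma frequency_error:
  fixes k :: "'y \<Rightarrow> nat"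
  assumes K: "finite K" and \<tau>: "\<And>h. h \<in> K \<Longrightarrow> \<tau> h permutes {..<d}" and A: "A \<in> sets (MX \<Otimes>\<^sub>M MY)"
    and k: "k \<in> MY \<rightarrow>\<^sub>M count_space UNIV" "\<And>y. k y < n" and C: "\<And>l. C l \<in> sets MX"
    and close: "\<And>y. y \<in> space MY \<Longrightarrow> k y \<notin> Bad \<Longrightarrow> measure MX (symdiff {x\<in>space MX. (x, y) \<in> A} (C (k y))) \<le> \<eta>"
    and bad: "measure MY {y\<in>space MY. k y \<in> Bad} \<le> \<eta>" and \<eta>: "\<eta> \<ge> 0"
    and d: "d > 0" and y: "\<And>v. v < d \<Longrightarrow> y v \<in> space MY"
    and freq: "\<And>l. \<bar>real (card {v. v < d \<and> k (y v) = l}) / real d - measure MY {x\<in>space MY. k x = l}\<bar> < \<delta>"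
  defines "err \<equiv> \<lambda>\<omega>. \<bar>real (card {v. v < d \<and> (model_point \<tau> K v \<omega>, y v) \<in> A}) / real d - measure (MX \<Otimes>\<^sub>M MY) A\<bar>"
  shows "integrable gauss err"
    "(\<integral>\<omega>. err \<omega> \<partial>gauss) \<le> sqrt (real d * real (card K * card K + 1)) / real d + (4 * \<eta> + 2 * real n * \<delta>)"
proof -
  define S where "S v = {x\<in>space MX. (x, y v) \<in> A}" for v
  have S: "S v \<in> sets MX" for v unfolding S_def by (rule section_sets[OF A])
  define E where "E v = {\<omega>. model_point \<tau> K v \<omega> \<in> S v}" for v
  have E: "E v \<in> sets gauss" for v unfolding E_def by (rule model_point_event[OF S])
  have pE: "measure gauss (E v) = measure MX (S v)" for v unfolding E_def by (rule measure_model_point[OF S])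
  have set_eq: "{v. v < d \<and> (model_point \<tau> K v \<omega>, y v) \<in> A} = {v. v < d \<and> \<omega> \<in> E v}" for \<omega>
    using model_point_space by (auto simp: E_def S_def)
  let ?X = "\<lambda>\<omega>. real (card {v. v < d \<and> \<omega> \<in> E v})"
  have iX: "integrable gauss ?X" using E by (intro gauss.integrable_card)
  show ie: "integrable gauss err"
    unfolding err_def set_eq using iX by (intro integrable_abs Bochner_Integration.integrable_diff integrable_divide) auto
  have dev: "(\<integral>\<omega>. \<bar>?X \<omega> - (\<Sum>v<d. measure gauss (E v))\<bar> \<partial>gauss) \<le> sqrt (real d * real (card K * card K + 1))"
  proof (rule gauss.card_deviation[OF E])
    fix v assume "v < d"
    have "{w. w < d \<and> measure gauss (E v \<inter> E w) \<noteq> measure gauss (E v) * measure gauss (E w)}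
      \<subseteq> {w. w < d \<and> range (model_index \<tau> K v) \<inter> range (model_index \<tau> K w) \<noteq> {}}"
      using model_point_indep[OF _ S S] unfolding E_def by blast
    then have "card {w. w < d \<and> measure gauss (E v \<inter> E w) \<noteq> measure gauss (E v) * measure gauss (E w)}
      \<le> card {w. w < d \<and> range (model_index \<tau> K v) \<inter> range (model_index \<tau> K w) \<noteq> {}}"
      by (intro card_mono) auto
    also have "\<dots> \<le> card K * card K + 1" by (rule card_overlapping_names[OF K \<tau>])
    finally show "card {w. w < d \<and> measure gauss (E v \<inter> E w) \<noteq> measure gauss (E v) * measure gauss (E w)} \<le> card K * card K + 1" .
  qed
  have mean: "\<bar>(\<Sum>v<d. measure gauss (E v)) / real d - measure (MX \<Otimes>\<^sub>M MY) A\<bar> \<le> 4 * \<eta> + 2 * real n * \<delta>"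
    unfolding pE S_def
    by (rule label_frequencies(2)[OF prob_space_axioms Y.prob_space_axioms A k C close bad \<eta> d y freq])
  have "(\<integral>\<omega>. err \<omega> \<partial>gauss) \<le> (\<integral>\<omega>. \<bar>?X \<omega> - (\<Sum>v<d. measure gauss (E v))\<bar> / real d + (4 * \<eta> + 2 * real n * \<delta>) \<partial>gauss)"
  proof (rule integral_mono[OF ie])
    show "integrable gauss (\<lambda>\<omega>. \<bar>?X \<omega> - (\<Sum>v<d. measure gauss (E v))\<bar> / real d + (4 * \<eta> + 2 * real n * \<delta>))"
      using iX by auto
    fix \<omega>
    have "err \<omega> \<le> \<bar>(?X \<omega> - (\<Sum>v<d. measure gauss (E v))) / real d\<bar> + \<bar>(\<Sum>v<d. measure gauss (E v)) / real d - measure (MX \<Otimes>\<^sub>M MY) A\<bar>"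
      unfolding err_def set_eq diff_divide_distrib by linarith
    then show "err \<omega> \<le> \<bar>?X \<omega> - (\<Sum>v<d. measure gauss (E v))\<bar> / real d + (4 * \<eta> + 2 * real n * \<delta>)"
      using mean by simp
  qed
  also have "\<dots> = (\<integral>\<omega>. \<bar>?X \<omega> - (\<Sum>v<d. measure gauss (E v))\<bar> \<partial>gauss) / real d + (4 * \<eta> + 2 * real n * \<delta>)"
    using iX by (simp add: gauss.prob_space[simplified])
  also have "\<dots> \<le> sqrt (real d * real (card K * card K + 1)) / real d + (4 * \<eta> + 2 * real n * \<delta>)"
    using dev by (intro add_right_mono divide_right_mono) auto
  finally show "(\<integral>\<omega>. err \<omega> \<partial>gauss) \<le> sqrt (real d * real (card K * card K + 1)) / real d + (4 * \<eta> + 2 * real n * \<delta>)" .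
qed

text \<open>Outside three exceptional vertex sets, both points of Y carry the same good label l and
  both sections of A are close to \<open>C l\<close>; equivariance of the Gaussian points with
  respect to \<open>C l\<close> closes the triangle.\<close>

lemma equivariance_error:
  fixes k :: "'y \<Rightarrow> nat"
  assumes s: "s \<in> carrier G" and \<tau>: "\<tau> s permutes {..<d}" and A: "A \<in> sets (MX \<Otimes>\<^sub>M MY)"
    and k: "k \<in> MY \<rightarrow>\<^sub>M count_space UNIV" "\<And>y. k y < n" and C: "\<And>l. C l \<in> sets MX"
    and close: "\<And>y. y \<in> space MY \<Longrightarrow> k y \<notin> Bad \<Longrightarrow> measure MX (symdiff {x\<in>space MX. (x, y) \<in> A} (C (k y))) \<le> \<eta>"
    and bad: "measure MY {y\<in>space MY. k y \<in> Bad} \<le> \<eta>" and \<eta>: "\<eta> \<ge> 0"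
    and d: "d > 0" and y: "\<And>v. v < d \<Longrightarrow> y v \<in> space MY"
    and freq: "\<And>l. \<bar>real (card {v. v < d \<and> k (y v) = l}) / real d - measure MY {x\<in>space MY. k x = l}\<bar> < \<delta>"
    and match: "real (card {v. v < d \<and> k (TY (inv\<^bsub>G\<^esub> s) (y v)) \<noteq> k (y (sinv \<tau> s v))}) \<le> \<delta> * real d"
    and nice: "\<And>v l. v < d \<Longrightarrow> v \<notin> B \<Longrightarrow> l < n \<Longrightarrow>
      measure gauss {\<omega>. (TX (inv\<^bsub>G\<^esub> s) (model_point \<tau> K v \<omega>) \<in> C l) \<noteq> (model_point \<tau> K (sinv \<tau> s v) \<omega> \<in> C l)} \<le> e"
    and B: "B \<subseteq> {..<d}" and e: "e \<ge> 0"
  defines "err \<equiv> \<lambda>\<omega>. real (card {v. v < d \<and>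
      ((TX (inv\<^bsub>G\<^esub> s) (model_point \<tau> K v \<omega>), TY (inv\<^bsub>G\<^esub> s) (y v)) \<in> A) \<noteq> ((model_point \<tau> K (sinv \<tau> s v) \<omega>, y (sinv \<tau> s v)) \<in> A)}) / real d"
  shows "integrable gauss err"
    "(\<integral>\<omega>. err \<omega> \<partial>gauss) \<le> 3 * \<eta> + e + \<delta> + real n * \<delta> + real (card B) / real d"
proof -
  define t where "t = inv\<^bsub>G\<^esub> s"
  have t: "t \<in> carrier G" using s by (simp add: t_def)
  define w where "w v = sinv \<tau> s v" for v
  define y' where "y' v = TY t (y v)" for v
  have w: "w v < d" if "v < d" for v
    using permutes_in_image[OF permutes_inv[OF \<tau>], of v] that by (simp add: w_def)
  have y': "y' v \<in> space MY" if "v < d" for v unfolding y'_def using Y.T_space[OF t y[OF that]] .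
  define S where "S z = {x\<in>space MX. (x, z) \<in> A}" for z
  have S: "S z \<in> sets MX" for z unfolding S_def by (rule section_sets[OF A])
  have ev1: "{\<omega>. TX t (model_point \<tau> K v \<omega>) \<in> D} \<in> sets gauss"
    and m1: "measure gauss {\<omega>. TX t (model_point \<tau> K v \<omega>) \<in> D} = measure MX D" if D: "D \<in> sets MX" for v D
  proof -
    have TD: "TX t -` D \<inter> space MX \<in> sets MX" by (rule measurable_sets[OF T_measurable[OF t] D])
    have eq: "{\<omega>. TX t (model_point \<tau> K v \<omega>) \<in> D} = {\<omega>. model_point \<tau> K v \<omega> \<in> TX t -` D \<inter> space MX}"
      using model_point_space by auto
    show "{\<omega>. TX t (model_point \<tau> K v \<omega>) \<in> D} \<in> sets gauss" unfolding eq by (rule model_point_event[OF TD])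
    have "measure gauss {\<omega>. TX t (model_point \<tau> K v \<omega>) \<in> D} = measure MX (TX t -` D \<inter> space MX)"
      unfolding eq by (rule measure_model_point[OF TD])
    also have "\<dots> = measure (distr MX MX (TX t)) D" using D T_measurable[OF t] by (intro measure_distr[symmetric]) auto
    finally show "measure gauss {\<omega>. TX t (model_point \<tau> K v \<omega>) \<in> D} = measure MX D" by (simp add: T_distr[OF t])
  qed
  define E where "E v = {\<omega>. (TX t (model_point \<tau> K v \<omega>) \<in> S (y' v)) \<noteq> (model_point \<tau> K (w v) \<omega> \<in> S (y (w v)))}" for v
  have neq_sets: "{\<omega>. (TX t (model_point \<tau> K v \<omega>) \<in> D) \<noteq> (model_point \<tau> K u \<omega> \<in> D')} \<in> sets gauss"
    if "D \<in> sets MX" "D' \<in> sets MX" for v u D D'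
  proof -
    have "{\<omega>. (TX t (model_point \<tau> K v \<omega>) \<in> D) \<noteq> (model_point \<tau> K u \<omega> \<in> D')} =
      symdiff {\<omega>. TX t (model_point \<tau> K v \<omega>) \<in> D} {\<omega>. model_point \<tau> K u \<omega> \<in> D'}" by (auto simp: symdiff_def)
    then show ?thesis using ev1[OF that(1)] model_point_event[OF that(2)] by (simp add: symdiff_def)
  qed
  have E: "E v \<in> sets gauss" for v unfolding E_def by (rule neq_sets[OF S S])
  have set_eq: "{v. v < d \<and> ((TX (inv\<^bsub>G\<^esub> s) (model_point \<tau> K v \<omega>), TY (inv\<^bsub>G\<^esub> s) (y v)) \<in> A) \<noteq>
      ((model_point \<tau> K (sinv \<tau> s v) \<omega>, y (sinv \<tau> s v)) \<in> A)} = {v. v < d \<and> \<omega> \<in> E v}" for \<omega>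
    using model_point_space T_space[OF t model_point_space] by (auto simp: E_def S_def t_def[symmetric] w_def y'_def)
  have iX: "integrable gauss (\<lambda>\<omega>. real (card {v. v < d \<and> \<omega> \<in> E v}))" using E by (intro gauss.integrable_card)
  show "integrable gauss err" unfolding err_def set_eq using iX by simp
  define B1 where "B1 = {v. v < d \<and> k (y' v) \<noteq> k (y (w v))}"
  define B2 where "B2 = {v. v < d \<and> k (y (w v)) \<in> Bad}"
  \<comment> \<open>Each exceptional set pays the trivial bound 1 through its indicator; elsewhere
    two section errors \<eta> and one equivariance error e add up.\<close>
  have pE: "measure gauss (E v) \<le> (2 * \<eta> + e) + (indicat_real B1 v + indicat_real B2 v + indicat_real B v)" if v: "v < d" for v
  proof (cases "v \<in> B1 \<union> B2 \<union> B")
    case True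
    then have "1 \<le> indicat_real B1 v + indicat_real B2 v + indicat_real B v" by (auto simp: indicator_def)
    moreover have "measure gauss (E v) \<le> 1" by simp
    ultimately show ?thesis using \<eta> e by linarith
  next
    case False
    define l where "l = k (y (w v))"
    have l: "k (y' v) = l" "l \<notin> Bad" "l < n" using False v k(2) by (auto simp: B1_def B2_def l_def)
    let ?D1 = "symdiff (S (y' v)) (C l)" and ?D2 = "symdiff (S (y (w v))) (C l)"
    have D: "?D1 \<in> sets MX" "?D2 \<in> sets MX" using S C by (auto simp: symdiff_def)
    let ?E1 = "{\<omega>. TX t (model_point \<tau> K v \<omega>) \<in> ?D1}" and ?E2 = "{\<omega>. model_point \<tau> K (w v) \<omega> \<in> ?D2}"
      and ?E3 = "{\<omega>. (TX t (model_point \<tau> K v \<omega>) \<in> C l) \<noteq> (model_point \<tau> K (w v) \<omega> \<in> C l)}"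
    have sets3: "?E1 \<in> sets gauss" "?E2 \<in> sets gauss" "?E3 \<in> sets gauss"
      using ev1[OF D(1)] model_point_event[OF D(2)] neq_sets[OF C C] by auto
    have "measure gauss (E v) \<le> measure gauss (?E1 \<union> (?E2 \<union> ?E3))"
      using sets3 by (intro gauss.finite_measure_mono) (auto simp: E_def symdiff_def)
    also have "\<dots> \<le> measure gauss ?E1 + measure gauss (?E2 \<union> ?E3)" using sets3 by (intro measure_Un_le) auto
    also have "measure gauss (?E2 \<union> ?E3) \<le> measure gauss ?E2 + measure gauss ?E3" using sets3 by (intro measure_Un_le) auto
    also have "measure gauss ?E1 = measure MX ?D1" by (rule m1[OF D(1)])
    also have "\<dots> \<le> \<eta>" using close[OF y'[OF v]] l by (simp add: S_def)
    also have "measure gauss ?E2 = measure MX ?D2" by (rule measure_model_point[OF D(2)])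
    also have "\<dots> \<le> \<eta>" using close[OF y[OF w[OF v]]] l by (simp add: S_def l_def)
    also have "measure gauss ?E3 \<le> e" using nice[OF v _ l(3)] False by (simp add: t_def w_def)
    finally have "measure gauss (E v) \<le> 2 * \<eta> + e" by simp
    then show ?thesis by (simp add: add_increasing2 indicator_def)
  qed
  have sub: "B1 \<subseteq> {..<d}" "B2 \<subseteq> {..<d}" by (auto simp: B1_def B2_def)
  have card_ind: "(\<Sum>v<d. indicat_real Z v) = real (card Z)" if "Z \<subseteq> {..<d}" for Z
  proof -
    have "(\<Sum>v<d. indicat_real Z v) = (\<Sum>v\<in>Z. 1)"
      using that by (intro sum.mono_neutral_cong_right) auto
    then show ?thesis by simp
  qed
  have B1: "real (card B1) \<le> \<delta> * real d" using match by (simp add: B1_def y'_def w_def t_def)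
  have B2: "real (card B2) \<le> (\<eta> + real n * \<delta>) * real d"
  proof -
    \<comment> \<open>Bad labels seen at preimages are bad labels moved by \<open>\<tau> s\<close>,
      so there are no more of them than bad labels at all.\<close>
    have "B2 \<subseteq> \<tau> s ` {v. v < d \<and> k (y v) \<in> Bad}"
    proof
      fix v assume "v \<in> B2"
      then have "w v < d" "k (y (w v)) \<in> Bad" "v = \<tau> s (w v)"
        using w permutes_inverses(1)[OF \<tau>, of v] by (auto simp: B2_def w_def)
      then show "v \<in> \<tau> s ` {v. v < d \<and> k (y v) \<in> Bad}" by blast
    qed
    then have "card B2 \<le> card {v. v < d \<and> k (y v) \<in> Bad}" by (rule surj_card_le[rotated]) simp
    moreover have "real (card {v. v < d \<and> k (y v) \<in> Bad}) / real d \<le> \<eta> + real n * \<delta>"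
      by (rule label_frequencies(1)[OF prob_space_axioms Y.prob_space_axioms A k C close bad \<eta> d y freq])
    ultimately show ?thesis using d by (simp add: pos_divide_le_eq)
  qed
  have "(\<integral>\<omega>. err \<omega> \<partial>gauss) = (\<Sum>v<d. measure gauss (E v)) / real d"
    unfolding err_def set_eq using gauss.expectation_card[OF E] by simp
  also have "\<dots> \<le> (\<Sum>v<d. (2 * \<eta> + e) + (indicat_real B1 v + indicat_real B2 v + indicat_real B v)) / real d"
    using pE by (intro divide_right_mono sum_mono) auto
  also have "\<dots> = (real d * (2 * \<eta> + e) + real (card B1) + real (card B2) + real (card B)) / real d"
    using card_ind[OF sub(1)] card_ind[OF sub(2)] card_ind[OF B] by (simp add: sum.distrib)
  also have "\<dots> \<le> (real d * (2 * \<eta> + e) + \<delta> * real d + (\<eta> + real n * \<delta>) * real d + real (card B)) / real d"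
    using B1 B2 by (intro divide_right_mono) auto
  also have "\<dots> = 3 * \<eta> + e + \<delta> + real n * \<delta> + real (card B) / real d" using d by (simp add: field_simps)
  finally show "(\<integral>\<omega>. err \<omega> \<partial>gauss) \<le> 3 * \<eta> + e + \<delta> + real n * \<delta> + real (card B) / real d" .
qed

end

lemma negligible_not_free:
  assumes S: "sofic_approx G d \<sigma>" and K: "finite K" "K \<subseteq> carrier G"
  shows "negligible_sets d (\<lambda>i. {v. v < d i \<and> \<not> free_at (\<sigma> i) K v})"
proof (rule negligible_sets_subset)
  show "negligible_sets d (\<lambda>i. \<Union>q\<in>{q \<in> K \<times> K. fst q \<noteq> snd q}.
      {v. v < d i \<and> sinv (\<sigma> i) (fst q) v = sinv (\<sigma> i) (snd q) v})"
    using K by (intro negligible_sets_UN sofic_free[OF S]) auto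
qed (auto simp: free_at_def inj_on_def)

lemma negligible_pullback:
  assumes S: "sofic_approx G d \<sigma>" and s: "s \<in> carrier G" and B: "negligible_sets d B"
  shows "negligible_sets d (\<lambda>i. {v. v < d i \<and> sinv (\<sigma> i) s v \<in> B i})"
proof (rule negligible_sets_card_le[OF B])
  fix i
  note ps = sofic_approxD(1)[OF S s, of i]
  have "{v. v < d i \<and> sinv (\<sigma> i) s v \<in> B i} \<subseteq> \<sigma> i s ` B i"
  proof
    fix v assume "v \<in> {v. v < d i \<and> sinv (\<sigma> i) s v \<in> B i}"
    then show "v \<in> \<sigma> i s ` B i"
      using permutes_inverses(1)[OF ps, of v] by (intro image_eqI[of _ _ "sinv (\<sigma> i) s v"]) auto
  qed
  moreover have "finite (B i)" using B finite_subset by (auto simp: negligible_sets_def)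
  ultimately show "card {v. v < d i \<and> sinv (\<sigma> i) s v \<in> B i} \<le> card (B i)" by (rule surj_card_le[rotated])
qed auto

lemma negligible_eventually:
  assumes B: "negligible_sets d B" and d: "filterlim d at_top sequentially" and e: "e > 0"
  shows "\<forall>\<^sub>F i in sequentially. real (card (B i)) / real (d i) < e"
  using order_tendstoD(2)[of _ 0 sequentially e] B e by (auto simp: negligible_sets_def)

section \<open>Microstates of the product action\<close>

text \<open>Choices are made in the order: label k and sets C, cylinder windows for the C, a window
  K containing \<open>K0\<close>, these windows and their translates, then the label tolerance, and
  finally i. Starting from \<open>K0\<close> keeps the small-ball bound available for K. For each i
  the points of Y are fixed and only the Gaussian part is random.\<close>

lemma (in random_model) sofic_points:
  fixes P :: "('x \<times> 'y) set set"
  defines "T \<equiv> (\<lambda>g (x, y). (TX g x, TY g y))"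
  assumes S: "sofic_approx G d \<sigma>" and h: "sofic_entropy G d \<sigma> MY TY \<ge> 0"
    and K0: "finite K0" "K0 \<subseteq> carrier G" and P: "fin_meas_partition (MX \<Otimes>\<^sub>M MY) P"
    and F: "finite F" "F \<subseteq> carrier G" "\<one>\<^bsub>G\<^esub> \<in> F" and \<delta>: "\<delta> > 0"
  shows "\<exists>K. finite K \<and> K0 \<subseteq> K \<and> K \<subseteq> carrier G \<and> (\<exists>\<^sub>F i in sequentially. \<exists>y \<Omega>.
    (\<forall>v<d i. y v \<in> space MY) \<and> \<Omega> \<in> sets gauss \<and> 1/2 \<le> measure gauss \<Omega> \<and>
    (\<forall>\<omega>\<in>\<Omega>. XY.point_hom P F (d i) (\<lambda>v. (model_point (\<sigma> i) K v \<omega>, y v)) \<in> sofic_homs (MX \<Otimes>\<^sub>M MY) T (d i) (\<sigma> i) P F \<delta>))"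
proof -
  let ?M = "MX \<Otimes>\<^sub>M MY"
  define R where "R = part_join ?M T P F"
  have R: "fin_meas_partition ?M R"
    unfolding R_def T_def by (rule XY.fin_meas_partition_part_join[OF P F])
  note PD = fin_meas_partitionD[OF P] and RD = fin_meas_partitionD[OF R]
  \<comment> \<open>The number of error terms: an equivariance defect for each s in F and each cell
    of P, and a frequency error for each atom of the join.\<close>
  define c where "c = real (card F) * real (card P) + real (card R)"
  define \<eta>0 where "\<eta>0 = \<delta> / (2 * (c + 1))"
  have c0: "c \<ge> 0" by (simp add: c_def)
  have \<eta>0: "\<eta>0 > 0" "c * \<eta>0 \<le> \<delta> / 2" using \<delta> c0 by (auto simp: \<eta>0_def field_simps)
  \<comment> \<open>Together with \<open>e = \<eta>0 / 8\<close> and a quarter of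
    \<open>\<eta>0\<close> for the remaining term, either kind of expected error is bounded by 10/16
    of \<open>\<eta>0\<close>.\<close>
  define \<eta> where "\<eta> = \<eta>0 / 16"
  have \<eta>: "\<eta> > 0" using \<eta>0 by (simp add: \<eta>_def)
  have "finite (P \<union> R)" "P \<union> R \<subseteq> sets ?M" using PD RD by auto
  from approx_family[OF prob_space_axioms Y.prob_space_axioms this \<eta>]
  obtain k and n :: nat and C Bad where kC: "k \<in> MY \<rightarrow>\<^sub>M count_space UNIV \<and> (\<forall>y. k y < n) \<and> (\<forall>A l. C A l \<in> sets MX) \<and>
     (\<forall>A\<in>P \<union> R. \<forall>y\<in>space MY. k y \<notin> Bad \<longrightarrow> measure MX (symdiff {x\<in>space MX. (x, y) \<in> A} (C A (k y))) \<le> \<eta>) \<and>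
     measure MY {y\<in>space MY. k y \<in> Bad} \<le> \<eta>" by (elim exE)
  then have k: "k \<in> MY \<rightarrow>\<^sub>M count_space UNIV" "\<And>y. k y < n" and C: "\<And>A l. C A l \<in> sets MX"
    and close: "\<And>A y. A \<in> P \<union> R \<Longrightarrow> y \<in> space MY \<Longrightarrow> k y \<notin> Bad \<Longrightarrow> measure MX (symdiff {x\<in>space MX. (x, y) \<in> A} (C A (k y))) \<le> \<eta>"
    and bad: "measure MY {y\<in>space MY. k y \<in> Bad} \<le> \<eta>" by simp_all
  define e where "e = \<eta>0 / 8"
  have e: "e > 0" using \<eta>0 by (simp add: e_def)
  define Good where "Good s C K1 \<longleftrightarrow> finite K1 \<and> K1 \<subseteq> carrier G \<and> (\<forall>\<tau> K v w. K1 \<subseteq> K \<longrightarrow> (\<lambda>h. s \<otimes>\<^bsub>G\<^esub> h) ` K1 \<subseteq> K \<longrightarrow> K \<subseteq> carrier G \<longrightarrow>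
    free_at \<tau> K v \<longrightarrow> free_at \<tau> K w \<longrightarrow> (\<forall>h\<in>K1. sinv \<tau> h w = sinv \<tau> (s \<otimes>\<^bsub>G\<^esub> h) v) \<longrightarrow>
    measure gauss {\<omega>. (TX (inv\<^bsub>G\<^esub> s) (model_point \<tau> K v \<omega>) \<in> C) \<noteq> (model_point \<tau> K w \<omega> \<in> C)} \<le> e)" for s C K1
  have "\<exists>K1. Good s (C A l) K1" if "s \<in> F" for s A l
    unfolding Good_def by (rule approx_equivariance[OF C _ e]) (use that F in auto)
  then obtain K1 where K1: "\<And>s A l. s \<in> F \<Longrightarrow> Good s (C A l) (K1 s A l)" by metis
  define KK where "KK = (\<Union>s\<in>F. \<Union>A\<in>P. \<Union>l<n. K1 s A l)"
  have KK: "finite KK" "KK \<subseteq> carrier G"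
    using K1 F(1) PD(1) by (auto simp: KK_def Good_def)
  define K where "K = K0 \<union> KK \<union> (\<Union>s\<in>F. (\<lambda>h. s \<otimes>\<^bsub>G\<^esub> h) ` KK)"
  have K: "finite K" "K0 \<subseteq> K" "K \<subseteq> carrier G" "KK \<subseteq> K" "\<And>s. s \<in> F \<Longrightarrow> (\<lambda>h. s \<otimes>\<^bsub>G\<^esub> h) ` KK \<subseteq> K"
    using K0 KK F by (auto simp: K_def)
  define D where "D = card K * card K + 1"
  \<comment> \<open>One mismatch of labels and n frequency errors together cost exactly
    \<eta>.\<close>
  define \<delta>' where "\<delta>' = \<eta> / (real n + 1)"
  have \<delta>': "\<delta>' > 0" "\<delta>' + real n * \<delta>' = \<eta>"
  proof -
    have n: "real n + 1 > 0" by (simp add: add_nonneg_pos)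
    show "\<delta>' > 0" using \<eta> n by (simp add: \<delta>'_def)
    have "\<delta>' + real n * \<delta>' = (real n + 1) * \<delta>'" by (simp add: algebra_simps)
    also have "\<dots> = \<eta>" using n unfolding \<delta>'_def by (intro nonzero_mult_div_cancel_left[of "real n + 1" \<eta>, unfolded times_divide_eq_right[symmetric]]) simp
    finally show "\<delta>' + real n * \<delta>' = \<eta>" .
  qed
  have perm: "\<And>i s. s \<in> carrier G \<Longrightarrow> \<sigma> i s permutes {..<d i}" and dlim: "filterlim d at_top sequentially"
    using sofic_approxD[OF S] by auto
  \<comment> \<open>A vertex is exceptional when it or its preimage under s is not free, or when
    stepping back by s and then by some h of the cylinder windows differs from stepping back by
    their product.\<close>
  define B where "B s i = {v. v < d i \<and> \<not> free_at (\<sigma> i) K v} \<union> {v. v < d i \<and> sinv (\<sigma> i) s v \<in> {v. v < d i \<and> \<not> free_at (\<sigma> i) K v}}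
    \<union> (\<Union>h\<in>KK. {v. v < d i \<and> sinv (\<sigma> i) h (sinv (\<sigma> i) s v) \<noteq> sinv (\<sigma> i) (s \<otimes>\<^bsub>G\<^esub> h) v})" for s i
  have negB: "negligible_sets d (B s)" if "s \<in> F" for s
    unfolding B_def[abs_def] using that F KK
    by (intro negligible_sets_Un negligible_sets_UN negligible_not_free[OF S K(1,3)] negligible_pullback[OF S] sofic_mult[OF group_axioms S]) auto
  have evB: "\<forall>\<^sub>F i in sequentially. \<forall>s\<in>F. real (card (B s i)) / real (d i) < \<eta>0 / 4"
    using F(1) \<eta>0 by (intro eventually_ball_finite ballI negligible_eventually[OF negB dlim]) auto
  have evd: "\<forall>\<^sub>F i in sequentially. sqrt (real (d i) * real D) / real (d i) \<le> \<eta>0 / 4 \<and> 0 < d i"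
  proof -
    \<comment> \<open>From this size of d on, the fluctuation term \<open>sqrt (d * D) / d\<close>
      is at most \<open>\<eta>0 / 4\<close>.\<close>
    obtain m where m: "16 * real D / \<eta>0\<^sup>2 \<le> real m" using real_arch_simple by blast
    have "\<forall>\<^sub>F i in sequentially. max 1 m \<le> d i"
      using dlim[unfolded filterlim_at_top] by (rule spec)
    then show ?thesis
    proof eventually_elim
      case (elim i)
      have d: "0 < d i" using elim by simp
      have "16 * real D / \<eta>0\<^sup>2 \<le> real (d i)" using m elim by linarith
      then have "16 * real D \<le> real (d i) * \<eta>0\<^sup>2" using \<eta>0 by (simp add: pos_divide_le_eq)
      then have "real (d i) * (16 * real D) \<le> real (d i) * (real (d i) * \<eta>0\<^sup>2)" by (intro mult_left_mono) auto
      then have "real (d i) * real D \<le> (\<eta>0 / 4 * real (d i))\<^sup>2"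
        by (simp add: power2_eq_square mult_ac)
      then have "sqrt (real (d i) * real D) \<le> \<eta>0 / 4 * real (d i)" using \<eta>0 by (intro real_le_lsqrt) auto
      then show ?case using d by (simp add: pos_divide_le_eq)
    qed
  qed
  have "\<exists>\<^sub>F i in sequentially. \<exists>y \<Omega>. (\<forall>v<d i. y v \<in> space MY) \<and> \<Omega> \<in> sets gauss \<and> 1/2 \<le> measure gauss \<Omega> \<and>
    (\<forall>\<omega>\<in>\<Omega>. XY.point_hom P F (d i) (\<lambda>v. (model_point (\<sigma> i) K v \<omega>, y v)) \<in> sofic_homs ?M T (d i) (\<sigma> i) P F \<delta>)"
    using frequently_eventually_frequently[OF Y.sofic_labels[OF h perm k F \<delta>'(1)] eventually_conj[OF evB evd]]
  proof (rule frequently_elim1)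
    fix i
    let ?d = "d i" and ?\<tau> = "\<sigma> i"
    assume "(\<exists>y. (\<forall>v<?d. y v \<in> space MY) \<and>
      (\<forall>s\<in>F. real (card {v. v < ?d \<and> k (TY (inv\<^bsub>G\<^esub> s) (y v)) \<noteq> k (y (sinv ?\<tau> s v))}) \<le> \<delta>' * real ?d) \<and>
      (\<forall>l. \<bar>real (card {v. v < ?d \<and> k (y v) = l}) / real ?d - measure MY {x\<in>space MY. k x = l}\<bar> < \<delta>')) \<and>
      (\<forall>s\<in>F. real (card (B s i)) / real ?d < \<eta>0 / 4) \<and> sqrt (real ?d * real D) / real ?d \<le> \<eta>0 / 4 \<and> 0 < ?d"
    then obtain y where y: "\<And>v. v < ?d \<Longrightarrow> y v \<in> space MY"
      and match: "\<And>s. s \<in> F \<Longrightarrow> real (card {v. v < ?d \<and> k (TY (inv\<^bsub>G\<^esub> s) (y v)) \<noteq> k (y (sinv ?\<tau> s v))}) \<le> \<delta>' * real ?d"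
      and freq: "\<And>l. \<bar>real (card {v. v < ?d \<and> k (y v) = l}) / real ?d - measure MY {x\<in>space MY. k x = l}\<bar> < \<delta>'"
      and Bs: "\<And>s. s \<in> F \<Longrightarrow> real (card (B s i)) / real ?d < \<eta>0 / 4"
      and sq: "sqrt (real ?d * real D) / real ?d \<le> \<eta>0 / 4" and d: "0 < ?d" by blast
    have permK: "\<And>h. h \<in> K \<Longrightarrow> ?\<tau> h permutes {..<?d}" using perm K(3) by auto
    define p where "p v \<omega> = (model_point ?\<tau> K v \<omega>, y v)" for v \<omega>
    define err1 where "err1 s A \<omega> = real (card {v. v < ?d \<and>
      ((TX (inv\<^bsub>G\<^esub> s) (model_point ?\<tau> K v \<omega>), TY (inv\<^bsub>G\<^esub> s) (y v)) \<in> A) \<noteq> ((model_point ?\<tau> K (sinv ?\<tau> s v) \<omega>, y (sinv ?\<tau> s v)) \<in> A)}) / real ?d"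
      for s A \<omega>
    define err2 where "err2 A \<omega> = \<bar>real (card {v. v < ?d \<and> (model_point ?\<tau> K v \<omega>, y v) \<in> A}) / real ?d - measure ?M A\<bar>" for A \<omega>
    have sets: "A \<in> sets ?M" if "A \<in> P \<union> R" for A using that PD(2) RD(2) by auto
    have err2: "integrable gauss (err2 A)" "(\<integral>\<omega>. err2 A \<omega> \<partial>gauss) \<le> \<eta>0" if A: "A \<in> R" for A
    proof -
      have A': "A \<in> P \<union> R" using A by simp
      note fe = frequency_error[OF K(1) permK sets[OF A'] k C close[OF A'] bad less_imp_le[OF \<eta>] d y freq]
      show "integrable gauss (err2 A)" unfolding err2_def[abs_def] by (rule fe(1))
      have "(\<integral>\<omega>. err2 A \<omega> \<partial>gauss) \<le> sqrt (real ?d * real (card K * card K + 1)) / real ?d + (4 * \<eta> + 2 * real n * \<delta>')"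
        unfolding err2_def[abs_def] by (rule fe(2))
      also have "\<dots> \<le> \<eta>0 / 4 + (4 * \<eta> + 2 * \<eta>)"
        using sq \<delta>' unfolding D_def by (intro add_mono) auto
      also have "\<dots> \<le> \<eta>0" using \<eta>0 by (simp add: \<eta>_def)
      finally show "(\<integral>\<omega>. err2 A \<omega> \<partial>gauss) \<le> \<eta>0" .
    qed
    have err1: "integrable gauss (err1 s A)" "(\<integral>\<omega>. err1 s A \<omega> \<partial>gauss) \<le> \<eta>0" if s: "s \<in> F" and A: "A \<in> P" for s A
    proof -
      have A': "A \<in> P \<union> R" using A by simp
      have sG: "s \<in> carrier G" using s F by auto
      have nice: "measure gauss {\<omega>. (TX (inv\<^bsub>G\<^esub> s) (model_point ?\<tau> K v \<omega>) \<in> C A l) \<noteq> (model_point ?\<tau> K (sinv ?\<tau> s v) \<omega> \<in> C A l)} \<le> e"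
        if v: "v < ?d" "v \<notin> B s i" "l < n" for v l
      proof -
        have "sinv ?\<tau> s v < ?d"
          using permutes_in_image[OF permutes_inv[OF perm[OF sG, of i]], of v] v by simp
        then have free: "free_at ?\<tau> K v" "free_at ?\<tau> K (sinv ?\<tau> s v)"
          and mul: "\<And>h. h \<in> KK \<Longrightarrow> sinv ?\<tau> h (sinv ?\<tau> s v) = sinv ?\<tau> (s \<otimes>\<^bsub>G\<^esub> h) v"
          using v by (auto simp: B_def)
        have sub: "K1 s A l \<subseteq> KK" using s A v(3) by (auto simp: KK_def)
        have sub': "K1 s A l \<subseteq> K" "(\<lambda>h. s \<otimes>\<^bsub>G\<^esub> h) ` K1 s A l \<subseteq> K" using sub K(4) K(5)[OF s] by blast+
        show ?thesis
          by (rule K1[OF s, of A l, unfolded Good_def, THEN conjunct2, THEN conjunct2, rule_format])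
            (use sub' K(3) free mul sub in blast)+
      qed
      have Bsub: "B s i \<subseteq> {..<?d}" by (auto simp: B_def)
      note ee = equivariance_error[OF sG perm[OF sG] sets[OF A'] k C close[OF A'] bad less_imp_le[OF \<eta>] d y freq match[OF s] nice Bsub less_imp_le[OF e]]
      show "integrable gauss (err1 s A)" unfolding err1_def[abs_def] by (rule ee(1))
      have "(\<integral>\<omega>. err1 s A \<omega> \<partial>gauss) \<le> 3 * \<eta> + e + \<delta>' + real n * \<delta>' + real (card (B s i)) / real ?d"
        unfolding err1_def[abs_def] by (rule ee(2))
      also have "\<dots> \<le> 3 * \<eta> + e + \<eta> + \<eta>0 / 4" using Bs[OF s] \<delta>'(2) by linarith
      also have "\<dots> \<le> \<eta>0" using \<eta>0 by (simp add: \<eta>_def e_def)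
      finally show "(\<integral>\<omega>. err1 s A \<omega> \<partial>gauss) \<le> \<eta>0" .
    qed
    \<comment> \<open>One nonnegative sum dominates all conditions on a sofic homomorphism. Its mean
      is at most \<delta>/2, so by Markov's inequality they hold simultaneously with probability at
      least 1/2.\<close>
    define X where "X \<omega> = (\<Sum>s\<in>F. \<Sum>A\<in>P. err1 s A \<omega>) + (\<Sum>A\<in>R. err2 A \<omega>)" for \<omega>
    have nonneg: "0 \<le> err1 s A \<omega>" "0 \<le> err2 A \<omega>" for s A \<omega> by (auto simp: err1_def err2_def)
    have i1: "integrable gauss (\<lambda>\<omega>. \<Sum>s\<in>F. \<Sum>A\<in>P. err1 s A \<omega>)" and i2: "integrable gauss (\<lambda>\<omega>. \<Sum>A\<in>R. err2 A \<omega>)"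
      by (intro Bochner_Integration.integrable_sum err1 err2; assumption)+
    have Xi: "integrable gauss X" unfolding X_def[abs_def] using i1 i2 by (rule Bochner_Integration.integrable_add)
    have "(\<integral>\<omega>. X \<omega> \<partial>gauss) = (\<Sum>s\<in>F. \<Sum>A\<in>P. \<integral>\<omega>. err1 s A \<omega> \<partial>gauss) + (\<Sum>A\<in>R. \<integral>\<omega>. err2 A \<omega> \<partial>gauss)"
    proof -
      have "(\<integral>\<omega>. (\<Sum>s\<in>F. \<Sum>A\<in>P. err1 s A \<omega>) \<partial>gauss) = (\<Sum>s\<in>F. \<integral>\<omega>. (\<Sum>A\<in>P. err1 s A \<omega>) \<partial>gauss)"
        by (intro Bochner_Integration.integral_sum Bochner_Integration.integrable_sum err1(1))
      also have "\<dots> = (\<Sum>s\<in>F. \<Sum>A\<in>P. \<integral>\<omega>. err1 s A \<omega> \<partial>gauss)"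
        by (intro sum.cong refl Bochner_Integration.integral_sum err1(1))
      finally show ?thesis
        unfolding X_def using Bochner_Integration.integral_add[OF i1 i2] Bochner_Integration.integral_sum[of R gauss err2] err2(1)
        by simp
    qed
    also have "\<dots> \<le> (\<Sum>s\<in>F. \<Sum>A\<in>P. \<eta>0) + (\<Sum>A\<in>R. \<eta>0)"
      by (intro add_mono sum_mono err1(2) err2(2))
    also have "\<dots> = c * \<eta>0" by (simp add: c_def algebra_simps)
    finally have XE: "(\<integral>\<omega>. X \<omega> \<partial>gauss) \<le> \<delta> / 2" using \<eta>0(2) by linarith
    define \<Omega> where "\<Omega> = {\<omega>. X \<omega> < \<delta>}"
    have \<Omega>s: "\<Omega> \<in> sets gauss"
    proof -
      have "{\<omega> \<in> space gauss. X \<omega> < \<delta>} \<in> sets gauss" using Xi by measurable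
      then show ?thesis by (simp add: \<Omega>_def)
    qed
    have X0: "0 \<le> X \<omega>" for \<omega> unfolding X_def by (intro add_nonneg_nonneg sum_nonneg nonneg)
    have "measure gauss {\<omega>\<in>space gauss. \<delta> \<le> X \<omega>} \<le> (\<integral>\<omega>. X \<omega> \<partial>gauss) / \<delta>"
      by (rule integral_Markov_inequality_measure[OF Xi sets.top]) (use \<delta> X0 in auto)
    also have "\<dots> \<le> 1 / 2" using XE \<delta> by (simp add: pos_divide_le_eq)
    also have "{\<omega>\<in>space gauss. \<delta> \<le> X \<omega>} = space gauss - \<Omega>" by (auto simp: \<Omega>_def)
    also have "measure gauss (space gauss - \<Omega>) = 1 - measure gauss \<Omega>" by (rule gauss.prob_compl[OF \<Omega>s])
    finally have \<Omega>half: "1 / 2 \<le> measure gauss \<Omega>" by simp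
    have "XY.point_hom P F ?d (\<lambda>v. (model_point ?\<tau> K v \<omega>, y v)) \<in> sofic_homs ?M T ?d ?\<tau> P F \<delta>" if "\<omega> \<in> \<Omega>" for \<omega>
      unfolding T_def
    proof (rule XY.point_hom_sofic[OF P F])
      have X: "X \<omega> < \<delta>" using that by (simp add: \<Omega>_def)
      show "(model_point ?\<tau> K v \<omega>, y v) \<in> space ?M" if "v < ?d" for v
        using model_point_space y[OF that] by (simp add: space_pair_measure)
      show "?\<tau> s permutes {..<?d}" if "s \<in> F" for s using perm F(2) that by auto
      show "(\<Sum>A\<in>P. real (card {v. v < ?d \<and>
          ((case (model_point ?\<tau> K v \<omega>, y v) of (x, y) \<Rightarrow> (TX (inv\<^bsub>G\<^esub> s) x, TY (inv\<^bsub>G\<^esub> s) y)) \<in> A) \<noteq>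
          ((model_point ?\<tau> K (sinv ?\<tau> s v) \<omega>, y (sinv ?\<tau> s v)) \<in> A)}) / real ?d) < \<delta>" if s: "s \<in> F" for s
      proof -
        have "(\<Sum>A\<in>P. err1 s A \<omega>) \<le> (\<Sum>s\<in>F. \<Sum>A\<in>P. err1 s A \<omega>)"
          using s F(1) by (intro member_le_sum sum_nonneg nonneg) auto
        also have "\<dots> \<le> X \<omega>" unfolding X_def using nonneg by (simp add: sum_nonneg)
        finally show ?thesis using X unfolding err1_def by simp
      qed
      have "(\<Sum>A\<in>R. err2 A \<omega>) \<le> X \<omega>" unfolding X_def using nonneg by (simp add: sum_nonneg)
      then show "(\<Sum>A\<in>part_join ?M (\<lambda>g (x, y). (TX g x, TY g y)) P F.
          \<bar>real (card {v. v < ?d \<and> (model_point ?\<tau> K v \<omega>, y v) \<in> A}) / real ?d - measure ?M A\<bar>) < \<delta>"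
        using X unfolding err2_def R_def T_def by simp
    qed
    then show "\<exists>y \<Omega>. (\<forall>v<?d. y v \<in> space MY) \<and> \<Omega> \<in> sets gauss \<and> 1/2 \<le> measure gauss \<Omega> \<and>
      (\<forall>\<omega>\<in>\<Omega>. XY.point_hom P F ?d (\<lambda>v. (model_point ?\<tau> K v \<omega>, y v)) \<in> sofic_homs ?M T ?d ?\<tau> P F \<delta>)"
      using y \<Omega>s \<Omega>half by (intro exI[of _ y] exI[of _ \<Omega>]) simp
  qed
  then show ?thesis using K by blast
qed

section \<open>Cells of the torus and the final count\<close>

text \<open>A grid of mesh 1/(2N) in both real coordinates replaces arcs, so that values in one cell
  are within 1/N. Normalising by \<open>sgn\<close> keeps the number of cells finite also where
  \<open>u\<close> fails to have modulus one.\<close>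

definition torus_cell :: "nat \<Rightarrow> complex \<Rightarrow> int \<times> int" where
  "torus_cell N z = (\<lfloor>2 * real N * Re (sgn z)\<rfloor>, \<lfloor>2 * real N * Im (sgn z)\<rfloor>)"

lemma torus_cell_close:
  assumes "torus_cell N z = torus_cell N z'" "N > 0"
  shows "cmod (sgn z - sgn z') \<le> 1 / real N"
proof -
  have fl: "\<bar>a - b\<bar> \<le> 1 / (2 * real N)" if "\<lfloor>2 * real N * a\<rfloor> = \<lfloor>2 * real N * b\<rfloor>" for a b
  proof -
    have "\<bar>2 * real N * a - 2 * real N * b\<bar> < 1" using that by linarith
    also have "2 * real N * a - 2 * real N * b = 2 * real N * (a - b)" by (simp add: algebra_simps)
    finally have "2 * real N * \<bar>a - b\<bar> < 1" by (simp add: abs_mult)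
    then show ?thesis using assms(2) by (simp add: field_simps)
  qed
  have "\<bar>Re (sgn z - sgn z')\<bar> \<le> 1 / (2 * real N)" "\<bar>Im (sgn z - sgn z')\<bar> \<le> 1 / (2 * real N)"
    using assms(1) fl by (auto simp: torus_cell_def)
  then have "cmod (sgn z - sgn z') \<le> 1 / (2 * real N) + 1 / (2 * real N)"
    using cmod_le[of "sgn z - sgn z'"] by linarith
  then show ?thesis by simp
qed

lemma finite_range_torus_cell: "finite (range (torus_cell N))"
proof (rule finite_subset)
  show "range (torus_cell N) \<subseteq> {- (2 * int N)..2 * int N} \<times> {- (2 * int N)..2 * int N}"
  proof -
    have fl: "\<lfloor>2 * real N * a\<rfloor> \<in> {- (2 * int N)..2 * int N}" if "\<bar>a\<bar> \<le> 1" for a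
    proof -
      have "\<bar>2 * real N * a\<bar> \<le> 2 * real N * 1" unfolding abs_mult using that by (intro mult_mono) auto
      then have "- (2 * real N) \<le> 2 * real N * a" "2 * real N * a \<le> 2 * real N" by linarith+
      then show ?thesis by (simp add: le_floor_iff floor_le_iff)
    qed
    have "\<bar>Re (sgn z)\<bar> \<le> 1" "\<bar>Im (sgn z)\<bar> \<le> 1" for z :: complex
      using abs_Re_le_cmod[of "sgn z"] abs_Im_le_cmod[of "sgn z"] by (auto simp: norm_sgn split: if_splits)
    then show ?thesis unfolding torus_cell_def by (intro image_subsetI SigmaI fl)
  qed
qed simp

lemma measurable_torus_cell: "torus_cell N \<in> borel \<rightarrow>\<^sub>M count_space UNIV"
  unfolding torus_cell_def by measurable

theorem theorem4p16:
  fixes G :: "'g monoid"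
    and d :: "nat \<Rightarrow> nat"
    and \<sigma> :: "nat \<Rightarrow> 'g \<Rightarrow> nat \<Rightarrow> nat"
    and \<rho> :: "'g \<Rightarrow> 'h::{real_inner, complete_space} \<Rightarrow> 'h"
    and MX :: "'x measure" and TX :: "'g \<Rightarrow> 'x \<Rightarrow> 'x"
    and MY :: "'y measure" and TY :: "'g \<Rightarrow> 'y \<Rightarrow> 'y"
  assumes "group G" and "countable (carrier G)"
    and "sofic_approx G d \<sigma>"
    and "separable_space TYPE('h)" and "\<exists>x::'h. x \<noteq> 0"
    and "orth_rep G \<rho>" and "reg_subrep G \<rho>"
    and "gaussian_action G \<rho> MX TX"
    and "pmp_action G MY TY" and "standard_prob_space MY"
    and "sofic_entropy G d \<sigma> MY TY \<ge> 0"
  shows "sofic_entropy G d \<sigma> (MX \<Otimes>\<^sub>M MY) (\<lambda>g (x, y). (TX g x, TY g y)) = \<infinity>"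
proof -
  obtain \<xi> :: 'h where \<xi>: "\<xi> \<noteq> 0" using assms(5) by blast
  obtain u :: "'x \<Rightarrow> complex" and a :: "nat \<times> 'g \<Rightarrow> real" and W \<Theta> where
    u [measurable]: "u \<in> borel_measurable MX" and lin: "gauss_lin a W"
    and A: "((\<lambda>p. (a p)\<^sup>2) has_sum (2 * pi * (norm \<xi>)\<^sup>2)) UNIV" and off: "\<And>n h. h \<notin> carrier G \<Longrightarrow> a (n, h) = 0"
    and \<Theta>: "\<Theta> \<in> gauss \<rightarrow>\<^sub>M MX" "distr gauss MX \<Theta> = MX"
    and u\<Theta>: "AE \<omega> in gauss. u (\<Theta> \<omega>) = iexp (W \<omega>)"
    and shift: "\<And>s. s \<in> carrier G \<Longrightarrow> AE \<omega> in gauss. \<Theta> (\<omega> \<circ> left_shift G s) = TX (inv\<^bsub>G\<^esub> s) (\<Theta> \<omega>)"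
    and carr: "\<And>\<iota> \<iota>' :: nat \<times> 'g \<Rightarrow> nat \<times> nat \<times> 'g option. inj \<iota> \<Longrightarrow> inj \<iota>' \<Longrightarrow>
       (\<And>n h. h \<in> carrier G \<Longrightarrow> \<iota> (n, h) = \<iota>' (n, h)) \<Longrightarrow> AE \<omega> in gauss. \<Theta> (\<omega> \<circ> \<iota>) = \<Theta> (\<omega> \<circ> \<iota>')"
    by (rule gaussian_factor_map[OF assms(1,2,6,7,8), of \<xi>]) blast
  have pX: "pmp_action G MX TX" using assms(8) by (simp add: gaussian_action_def)
  interpret X: pmp_system G MX TX
    using pX assms(1) by (intro pmp_system.intro) (auto simp: pmp_system_axioms_def pmp_action_def)
  interpret Y: pmp_system G MY TY
    using assms(1,9) by (intro pmp_system.intro) (auto simp: pmp_system_axioms_def pmp_action_def)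
  interpret Gf: gaussian_factor G MX TX \<Theta>
    by unfold_locales (rule \<Theta> shift carr; assumption?)+
  interpret random_model G MX TX \<Theta> MY TY ..
  let ?M = "MX \<Otimes>\<^sub>M MY" and ?T = "\<lambda>g (x, y). (TX g x, TY g y)"
  define A where "A = 2 * pi * (norm \<xi>)\<^sup>2"
  have A0: "A > 0" using \<xi> by (simp add: A_def)
  define C where "C = gauss_sum_const (sqrt (A / 4))"
  have C0: "C > 0" by (simp add: C_def gauss_sum_const_def)
  have "\<exists>K0 c0. finite K0 \<and> K0 \<subseteq> carrier G \<and> c0 > 0 \<and> (\<forall>\<tau> d K N c. finite K \<longrightarrow> K0 \<subseteq> K \<longrightarrow>
     (\<forall>h\<in>K. \<tau> h permutes {..<d}) \<longrightarrow> d \<le> 2 * card {v. v < d \<and> free_at \<tau> K v} \<longrightarrow> 0 < d \<longrightarrow> 0 < N \<longrightarrow>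
     (\<forall>v<d. cmod (c v) \<le> 1) \<longrightarrow>
     measure gauss {\<omega>. \<forall>v<d. cmod (iexp (W (\<omega> \<circ> model_index \<tau> K v)) - c v) \<le> 1 / real N}
       \<le> (4 * C / real N) ^ nat \<lfloor>c0 * real d\<rfloor>)"
    unfolding C_def by (rule model_small_ball[OF lin A[folded A_def] A0]) (rule off)
  then obtain K0 c0 where K0c0: "finite K0 \<and> K0 \<subseteq> carrier G \<and> c0 > 0 \<and> (\<forall>\<tau> d K N c. finite K \<longrightarrow> K0 \<subseteq> K \<longrightarrow>
     (\<forall>h\<in>K. \<tau> h permutes {..<d}) \<longrightarrow> d \<le> 2 * card {v. v < d \<and> free_at \<tau> K v} \<longrightarrow> 0 < d \<longrightarrow> 0 < N \<longrightarrow>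
     (\<forall>v<d. cmod (c v) \<le> 1) \<longrightarrow>
     measure gauss {\<omega>. \<forall>v<d. cmod (iexp (W (\<omega> \<circ> model_index \<tau> K v)) - c v) \<le> 1 / real N}
       \<le> (4 * C / real N) ^ nat \<lfloor>c0 * real d\<rfloor>)"
    by (elim exE)
  then have K0: "finite K0" "K0 \<subseteq> carrier G" and c0: "c0 > 0" by simp_all
  have ball: "measure gauss {\<omega>. \<forall>v<d. cmod (iexp (W (\<omega> \<circ> model_index \<tau> K v)) - c v) \<le> 1 / real N}
       \<le> (4 * C / real N) ^ nat \<lfloor>c0 * real d\<rfloor>"
    if "finite K" "K0 \<subseteq> K" "\<And>h. h \<in> K \<Longrightarrow> \<tau> h permutes {..<d}" "d \<le> 2 * card {v. v < d \<and> free_at \<tau> K v}" "0 < d" "0 < N"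
      "\<And>v. v < d \<Longrightarrow> cmod (c v) \<le> 1" for \<tau> d K N c
    using K0c0 that by simp
  have uW: "AE \<omega> in gauss. \<forall>v. u (Gf.model_point \<tau> K v \<omega>) = iexp (W (\<omega> \<circ> model_index \<tau> K v))" for \<tau> K
  proof (subst AE_all_countable, intro allI)
    fix v
    show "AE \<omega> in gauss. u (Gf.model_point \<tau> K v \<omega>) = iexp (W (\<omega> \<circ> model_index \<tau> K v))"
      unfolding Gf.model_point_def
      by (rule AE_distrD[OF gauss_reindex_measurable], unfold distr_gauss_reindex[OF inj_model_index]) (rule u\<Theta>)
  qed
  show ?thesis
  proof (rule sofic_entropy_eq_infinity)
    fix r :: real
    \<comment> \<open>Each of about c0 * d selected vertices contributes a factor exp t to the
      count, and t * c0 exceeds \<bar>r\<bar> by 1 to absorb the losses.\<close>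
    define t where "t = (\<bar>r\<bar> + 1) / c0"
    have t: "t > 0" "t * c0 = \<bar>r\<bar> + 1" using c0 by (auto simp: t_def)
    \<comment> \<open>The rate r affects the partition only through N, the fineness of the cells;
      \<open>K0\<close> and \<open>c0\<close> are already fixed.\<close>
    obtain N where "4 * C * exp t < real N" using reals_Archimedean2 by blast
    moreover have "0 < 4 * C * exp t" using C0 by simp
    ultimately have N: "N > 0" "4 * C / real N \<le> exp (- t)"
      by (auto simp: exp_minus field_simps intro: ccontr)
    define \<kappa> where "\<kappa> p = torus_cell N (u (fst p))" for p :: "'x \<times> 'y"
    have \<kappa>: "\<kappa> \<in> ?M \<rightarrow>\<^sub>M count_space UNIV"
    proof -
      have "(\<lambda>p. u (fst p)) \<in> borel_measurable ?M" by measurable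
      then show ?thesis unfolding \<kappa>_def using measurable_torus_cell by (rule measurable_compose)
    qed
    have "finite (\<kappa> ` space ?M)"
      by (rule finite_subset[OF _ finite_range_torus_cell[of N]]) (auto simp: \<kappa>_def)
    \<comment> \<open>Refining the trivial partition by \<kappa> yields a partition into cells that
      depends on the first factor only.\<close>
    moreover have "fin_meas_partition ?M {space ?M}"
      using XY.not_empty by (auto simp: fin_meas_partition_def)
    ultimately obtain Q where Q: "fin_meas_partition ?M Q" and Q\<kappa>: "\<And>A x x'. A \<in> Q \<Longrightarrow> x \<in> A \<Longrightarrow> x' \<in> A \<Longrightarrow> \<kappa> x = \<kappa> x'"
      using fin_meas_partition_common_refinement[OF _ \<kappa>] by metis
    note QD = fin_meas_partitionD[OF Q]
    have "\<exists>\<^sub>F i in sequentially. 0 < d i \<and> exp (r * real (d i)) \<le> real (restr_count Q (sofic_homs ?M ?T (d i) (\<sigma> i) P F \<delta>))"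
      if P: "fin_meas_partition ?M P" and PQ: "refines P Q" and F: "finite F" "F \<subseteq> carrier G" "\<one>\<^bsub>G\<^esub> \<in> F" and \<delta>: "\<delta> > 0" for P F \<delta>
    proof -
      note PD = fin_meas_partitionD[OF P]
      from sofic_points[OF assms(3,11) K0 P F \<delta>] obtain K where K: "finite K" "K0 \<subseteq> K" "K \<subseteq> carrier G"
        and fr: "\<exists>\<^sub>F i in sequentially. \<exists>y \<Omega>. (\<forall>v<d i. y v \<in> space MY) \<and> \<Omega> \<in> sets gauss \<and> 1/2 \<le> measure gauss \<Omega> \<and>
          (\<forall>\<omega>\<in>\<Omega>. XY.point_hom P F (d i) (\<lambda>v. (Gf.model_point (\<sigma> i) K v \<omega>, y v)) \<in> sofic_homs ?M ?T (d i) (\<sigma> i) P F \<delta>)"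
        by (elim exE conjE) (rule that)
      have dlim: "filterlim d at_top sequentially" by (rule sofic_approxD(2)[OF assms(3)])
      \<comment> \<open>At least half of the vertices must be free, and d must outweigh t + ln 2,
        the cost of rounding the exponent and of the probability 1/2.\<close>
      have ev: "\<forall>\<^sub>F i in sequentially. real (card {v. v < d i \<and> \<not> free_at (\<sigma> i) K v}) / real (d i) < 1 / 2 \<and> nat \<lceil>t + ln 2\<rceil> + 1 \<le> d i"
        by (intro eventually_conj negligible_eventually[OF negligible_not_free[OF assms(3) K(1,3)] dlim]
            spec[OF dlim[unfolded filterlim_at_top]]) simp
      show ?thesis
        using frequently_eventually_frequently[OF fr ev]
      proof (rule frequently_elim1)
        fix i
        let ?d = "d i" and ?\<tau> = "\<sigma> i"
        let ?H = "sofic_homs ?M ?T ?d ?\<tau> P F \<delta>"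
        assume "(\<exists>y \<Omega>. (\<forall>v<?d. y v \<in> space MY) \<and> \<Omega> \<in> sets gauss \<and> 1/2 \<le> measure gauss \<Omega> \<and>
          (\<forall>\<omega>\<in>\<Omega>. XY.point_hom P F ?d (\<lambda>v. (Gf.model_point ?\<tau> K v \<omega>, y v)) \<in> ?H)) \<and>
          real (card {v. v < ?d \<and> \<not> free_at ?\<tau> K v}) / real ?d < 1 / 2 \<and> nat \<lceil>t + ln 2\<rceil> + 1 \<le> ?d"
        then obtain y \<Omega> where y: "\<And>v. v < ?d \<Longrightarrow> y v \<in> space MY" and \<Omega>: "\<Omega> \<in> sets gauss" "1/2 \<le> measure gauss \<Omega>"
          and hom: "\<And>\<omega>. \<omega> \<in> \<Omega> \<Longrightarrow> XY.point_hom P F ?d (\<lambda>v. (Gf.model_point ?\<tau> K v \<omega>, y v)) \<in> ?H"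
          and notfree: "real (card {v. v < ?d \<and> \<not> free_at ?\<tau> K v}) / real ?d < 1 / 2" and dt: "nat \<lceil>t + ln 2\<rceil> + 1 \<le> ?d" by blast
        have d: "0 < ?d" "t + ln 2 \<le> real ?d"
        proof -
          show "0 < ?d" using dt by simp
          have "t + ln 2 \<le> real (nat \<lceil>t + ln 2\<rceil>)" by (rule real_nat_ceiling_ge)
          then show "t + ln 2 \<le> real ?d" using dt by linarith
        qed
        have perm: "?\<tau> h permutes {..<?d}" if "h \<in> K" for h
          using sofic_approxD(1)[OF assms(3)] K(3) that by auto
        have many: "?d \<le> 2 * card {v. v < ?d \<and> free_at ?\<tau> K v}"
        proof -
          have "card {v. v < ?d \<and> free_at ?\<tau> K v} + card {v. v < ?d \<and> \<not> free_at ?\<tau> K v}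
            = card ({v. v < ?d \<and> free_at ?\<tau> K v} \<union> {v. v < ?d \<and> \<not> free_at ?\<tau> K v})"
            by (intro card_Un_disjoint[symmetric]) auto
          also have "{v. v < ?d \<and> free_at ?\<tau> K v} \<union> {v. v < ?d \<and> \<not> free_at ?\<tau> K v} = {..<?d}" by auto
          finally have "card {v. v < ?d \<and> free_at ?\<tau> K v} + card {v. v < ?d \<and> \<not> free_at ?\<tau> K v} = ?d" by simp
          moreover have "2 * real (card {v. v < ?d \<and> \<not> free_at ?\<tau> K v}) < real ?d" using notfree d by (simp add: field_simps)
          ultimately show ?thesis by linarith
        qed
        define p where "p v \<omega> = (Gf.model_point ?\<tau> K v \<omega>, y v)" for v \<omega>
        \<comment> \<open>The homomorphism restricted to Q, as a function of the Gaussian sample;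
          its distinct values are what \<open>restr_count\<close> counts.\<close>
        define \<Phi> where "\<Phi> \<omega> = (\<lambda>B. if B \<in> part_alg Q then XY.point_hom P F ?d (\<lambda>v. p v \<omega>) B else {})" for \<omega>
        define q where "q = (4 * C / real N) ^ nat \<lfloor>c0 * real ?d\<rfloor>"
        have sub: "\<Phi> ` \<Omega> \<subseteq> (\<lambda>\<phi> B. if B \<in> part_alg Q then \<phi> B else {}) ` ?H"
          using hom unfolding \<Phi>_def p_def by (intro image_subsetI) (rule imageI)
        have fin: "finite ((\<lambda>\<phi> B. if B \<in> part_alg Q then \<phi> B else {}) ` ?H)"
          by (rule XY.finite_restrictions[OF P F QD(1)])
        have "1/2 \<le> real (card (\<Phi> ` \<Omega>)) * q"
        proof (rule gauss.card_image_from_small_prob[OF finite_subset[OF sub fin] \<Omega>])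
          fix \<omega>0 assume \<omega>0: "\<omega>0 \<in> \<Omega>"
          \<comment> \<open>Centres are the values at the reference sample; \<open>sgn\<close>
            bounds their modulus by one for every sample, not just almost surely.\<close>
          define c where "c v = sgn (u (Gf.model_point ?\<tau> K v \<omega>0))" for v
          define E where "E = {\<omega>. \<forall>v<?d. cmod (iexp (W (\<omega> \<circ> model_index ?\<tau> K v)) - c v) \<le> 1 / real N}"
          have "W \<in> borel_measurable gauss" using lin by (auto simp: gauss_lin_def)
          then have [measurable]: "(\<lambda>\<omega>. W (\<omega> \<circ> model_index ?\<tau> K v)) \<in> borel_measurable gauss" for v
            by (rule measurable_compose[OF gauss_reindex_measurable])
          have E: "E \<in> sets gauss"
          proof -
            have "{\<omega> \<in> space gauss. \<forall>v\<in>{..<?d}. cmod (iexp (W (\<omega> \<circ> model_index ?\<tau> K v)) - c v) \<le> 1 / real N} \<in> sets gauss"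
              by (intro sets.sets_Collect_finite_All; measurable)
            then show ?thesis by (simp add: E_def Ball_def)
          qed
          have pE: "measure gauss E \<le> q"
            unfolding E_def q_def
            by (rule ball[OF K(1,2) perm many d(1) N(1)]) (auto simp: c_def norm_sgn)
          \<comment> \<open>The values on Q reveal the atom of Q at each vertex. As
            \<open>point_hom\<close> is informative only on the join algebra, the atom is first seen
            to be a union of cells of P.\<close>
          have cell: "\<kappa> (p v \<omega>) = \<kappa> (p v \<omega>0)" if v: "v < ?d" and eq: "\<Phi> \<omega> = \<Phi> \<omega>0" for v \<omega>
          proof -
            have "p v \<omega>0 \<in> space ?M" using y[OF v] Gf.model_point_space by (simp add: p_def space_pair_measure)
            then obtain B where B: "B \<in> Q" "p v \<omega>0 \<in> B" using QD(4) by blast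
            have BQ: "B \<in> part_alg Q" using part_alg_UN[of "{B}" Q] B(1) by simp
            have "B \<in> part_alg P"
            proof (rule part_algI)
              show "B \<subseteq> \<Union>P" using B(1) QD(4) PD(4) by blast
              fix Z assume Z: "Z \<in> P" "Z \<inter> B \<noteq> {}"
              then obtain B' where B': "B' \<in> Q" "Z \<subseteq> B'" using PQ by (auto simp: refines_def)
              then have "B' = B" using Z(2) B(1) QD(5) unfolding disjoint_def by blast
              then show "Z \<subseteq> B" using B'(2) by simp
            qed
            then have BR: "B \<in> part_alg (part_join ?M ?T P F)"
              by (rule XY.part_alg_subset_part_join[OF P F])
            have "\<Phi> \<omega>' B = {v. v < ?d \<and> p v \<omega>' \<in> B}" for \<omega>'
              using BQ BR by (simp add: \<Phi>_def XY.point_hom_def[OF P F])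
            then have "p v \<omega> \<in> B" using fun_cong[OF eq, of B] B(2) v by blast
            then show ?thesis using Q\<kappa>[OF B(1)] B(2) by blast
          qed
          have "AE \<omega> in gauss. \<omega> \<in> \<Omega> \<longrightarrow> \<Phi> \<omega> = \<Phi> \<omega>0 \<longrightarrow> \<omega> \<in> E"
            using uW[of ?\<tau> K]
          proof eventually_elim
            case (elim \<omega>)
            show ?case
            proof (intro impI)
              assume eq: "\<Phi> \<omega> = \<Phi> \<omega>0"
              have "cmod (iexp (W (\<omega> \<circ> model_index ?\<tau> K v)) - c v) \<le> 1 / real N" if v: "v < ?d" for v
              proof -
                have "torus_cell N (u (Gf.model_point ?\<tau> K v \<omega>)) = torus_cell N (u (Gf.model_point ?\<tau> K v \<omega>0))"
                  using cell[OF v eq] by (simp add: \<kappa>_def p_def)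
                from torus_cell_close[OF this N(1)]
                have "cmod (sgn (iexp (W (\<omega> \<circ> model_index ?\<tau> K v))) - c v) \<le> 1 / real N"
                  using elim by (simp add: c_def)
                then show ?thesis by (simp add: sgn_div_norm)
              qed
              then show "\<omega> \<in> E" by (simp add: E_def)
            qed
          qed
          then show "\<exists>E\<in>sets gauss. measure gauss E \<le> q \<and> (AE \<omega> in gauss. \<omega> \<in> \<Omega> \<longrightarrow> \<Phi> \<omega> = \<Phi> \<omega>0 \<longrightarrow> \<omega> \<in> E)"
            using E pE by blast
        qed
        \<comment> \<open>Rounding down the number of selected vertices costs at most one factor exp
          t.\<close>
        also have "\<dots> \<le> real (restr_count Q ?H) * exp (- t * (c0 * real ?d - 1))"
        proof (rule mult_mono)
          show "real (card (\<Phi> ` \<Omega>)) \<le> real (restr_count Q ?H)"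
            unfolding restr_count_def of_nat_le_iff by (rule card_mono[OF fin sub])
          have "q \<le> exp (- t) ^ nat \<lfloor>c0 * real ?d\<rfloor>"
            unfolding q_def using N C0 by (intro power_mono) auto
          also have "\<dots> = exp (real (nat \<lfloor>c0 * real ?d\<rfloor>) * (- t))" by (rule exp_of_nat_mult[symmetric])
          also have "\<dots> \<le> exp (- t * (c0 * real ?d - 1))"
          proof -
            have "c0 * real ?d - 1 \<le> real (nat \<lfloor>c0 * real ?d\<rfloor>)" by linarith
            then have "t * (c0 * real ?d - 1) \<le> t * real (nat \<lfloor>c0 * real ?d\<rfloor>)" using t by (intro mult_left_mono) auto
            then show ?thesis by (simp add: mult.commute)
          qed
          finally show "q \<le> exp (- t * (c0 * real ?d - 1))" .
          show "0 \<le> q" unfolding q_def using C0 by simp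
        qed simp
        finally have half: "1/2 \<le> real (restr_count Q ?H) * exp (- t * (c0 * real ?d - 1))" .
        have "1/2 * exp (t * (c0 * real ?d - 1)) \<le> real (restr_count Q ?H)"
        proof -
          have "1/2 * exp (t * (c0 * real ?d - 1)) \<le> real (restr_count Q ?H) * exp (- t * (c0 * real ?d - 1)) * exp (t * (c0 * real ?d - 1))"
            using half by (rule mult_right_mono) simp
          also have "\<dots> = real (restr_count Q ?H)"
            by (simp add: mult.assoc exp_add[symmetric] del: mult_minus_left)
          finally show ?thesis .
        qed
        \<comment> \<open>The surplus d in (\<bar>r\<bar> + 1) * d pays for t and ln 2.\<close>
        moreover have "exp (r * real ?d) \<le> 1/2 * exp (t * (c0 * real ?d - 1))"
        proof -
          have "t * (c0 * real ?d - 1) = (\<bar>r\<bar> + 1) * real ?d - t"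
            using t(2) by (simp add: right_diff_distrib mult.assoc[symmetric])
          moreover have "r * real ?d \<le> \<bar>r\<bar> * real ?d" by (intro mult_right_mono) auto
          ultimately have "r * real ?d + ln 2 \<le> t * (c0 * real ?d - 1)" using d(2) by (simp add: distrib_right)
          then have "exp (r * real ?d + ln 2) \<le> exp (t * (c0 * real ?d - 1))" by simp
          then show ?thesis by (simp add: exp_add)
        qed
        ultimately show "0 < ?d \<and> exp (r * real ?d) \<le> real (restr_count Q ?H)" using d(1) by linarith
      qed
    qed
    then show "\<exists>Q. fin_meas_partition ?M Q \<and> (\<forall>P F \<delta>. fin_meas_partition ?M P \<longrightarrow> refines P Q \<longrightarrow> finite F \<longrightarrow>
       F \<subseteq> carrier G \<longrightarrow> \<one>\<^bsub>G\<^esub> \<in> F \<longrightarrow> \<delta> > 0 \<longrightarrow>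
       (\<exists>\<^sub>F i in sequentially. 0 < d i \<and> exp (r * real (d i)) \<le> real (restr_count Q (sofic_homs ?M ?T (d i) (\<sigma> i) P F \<delta>))))"
      using Q by (intro exI[of _ Q]) simp
  qed
qed

end
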